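(* Assume the DRSM setting below, with $\alpha\in(0,\bar\alpha]$ and an integer $t\ge\lceil\log_{\sigma_2}(\frac1{2\sqrt n})\rceil$. Suppose there exist $x^*\in\mathcal M$ and constants $\kappa>0$, $B>0$ such that $f(x)-f(x^* )\ge\kappa\|x-x^*\|_F$ for all $x\in\mathcal M$ with $\|x-x^*\|_F<B$ (an isolated weak sharp minimum of $f=\frac1n\sum_if_i$ over $\mathcal M$). Let $\Gamma\ge3$ and define $$e_0=\min\Big\{\max\Big\{\frac{\kappa}{(\rho+L)\Gamma},\sqrt{\tfrac1n\textstyle\sum_{i=1}^n\|x_{i,0}-x^*\|_F^2}\Big\},\frac B\Gamma\Big\},$$ $a=2(L+\kappa+\alpha LL_t)L$, $b=(4\alpha\sqrt r+2\alpha^2r)L_tL^2$, $q=\frac{2\kappa e_0}{\Gamma}-(\rho+L)e_0^2$. Suppose the initial point satisfies $$\sum_{i=1}^n\|x_{i,0}-x^*\|_F^2<\frac n{\Gamma^2}\min\Big\{\Big(\frac{2\kappa}{\rho+L}\Big)^2,B^2\Big\}\quad\text{and}\quad \|\mathbf x_0-\bar{\mathbf x}_0\|_F=0,$$ and let the stepsizes be $\beta_k=\mu_0\gamma^k$, where $0<\mu_0\le\min\{\frac{(1-\rho_t)\delta_1}{L},\frac{\alpha\delta_1}{5L}\}$ and $$\mu_0<\min\Big\{\frac{e_0}{2\kappa-(\rho+L)e_0},\ \frac{q}{L^2e_0^2+\frac{4(a+b)}{(1-\rho_t)^2}},\ \frac{(1-\rho_t)e_0}{2\sqrt nL}\Big\}.$$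 Then there exists a sufficiently small $\delta\in(0,1)$ such that, with $\gamma=\rho_t^\delta$, the DRSM iterates satisfy for all $k\ge0$: $$\sum_{i=1}^n\|x_{i,k}-x^*\|_F^2\le n\gamma^{2k}e_0^2\quad\text{and}\quad\|x_{i,k}-x^*\|_F^2\le\Gamma^2\gamma^{2k}e_0^2\ \ \forall i\in[n].$$
   Context: DRSM setting. Let $d\ge r\ge1$, $n\ge1$ be integers and $\mathcal M=\mathrm{St}(d,r)=\{x\in\mathbb{R}^{d\times r}:x^\top x=I_r\}$, with inner product $\langle a,b\rangle=\mathrm{tr}(a^\top b)$ and Frobenius norm. For $x\in\mathcal M$, $T_x\mathcal M=\{\xi:x^\top\xi+\xi^\top x=0\}$ and $\mathcal P_{T_x\mathcal M}(y)=y-\frac12x(y^\top x+x^\top y)$; $\mathcal P_{\mathcal M}(y)$ denotes a Frobenius-nearest point of $\mathcal M$ to $y$. Each $f_i:\mathbb{R}^{d\times r}\to\mathbb{R}$, $i\in[n]$, is $\rho$-weakly convex ($\rho\ge0$, i.e. $g_i=f_i+\frac\rho2\|\cdot\|_F^2$ is convex), with subdifferential $\partial f_i(x)=\partial g_i(x)-\rho x$ and Riemannian subdifferential $\partial_{\mathcal R}f_i(x)=\mathcal P_{T_x\mathcal M}(\partial f_i(x))$ for $x\in\mathcal M$; $f=\frac1n\sum_i f_i$. $L>0$ is a constant such that, for some bounded open convex $\mathcal U\supseteq\mathcal M$, each $f_i$ is $L$-Lipschitz on $\mathcal U$ and for all $x,y\in\mathcal M$ and $\xi\in\partial_{\mathcal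 R}f_i(x)$: $f_i(y)\ge f_i(x)+\langle\xi,y-x\rangle-\frac{\rho+L}{2}\|y-x\|_F^2$ (such $L$ exists); moreover $\|\xi\|_F\le L$ for all such $\xi$. Network: a connected undirected graph on $[n]$, $\mathcal N_i$ the neighbors of $i$ including $i$; the mixing matrix $W\in\mathbb{R}^{n\times n}$ is symmetric, entrywise nonnegative, each row sums to $1$, and $W_{ij}=0$ iff $j\notin\mathcal N_i$. $\sigma_2\in[0,1)$ is the second largest singular value of $W$; $W^t$ is the $t$-th power; $\lambda_2(\cdot),\lambda_n(\cdot)$ denote the second largest and smallest eigenvalue; $L_t=1-\lambda_n(W^t)$, $\mu_t=1-\lambda_2(W^t)$. The polar retraction is $\mathcal R_x(\xi)=(x+\xi)(I_r+\xi^\top\xi)^{-1/2}$, and $M>0$ is a constant with $\|\mathcal R_x(\xi)-(x+\xi)\|_F\le M\|\xi\|_F^2$ for all $x\in\mathcal M,\xi\in T_x\mathcal M$. DRSM: given $\alpha>0$, an integer $t\ge1$, stepsizes $\beta_k>0$ and $x_{1,0},\dots,x_{n,0}\in\mathcal M$, for $k\ge0$ and each $i$, $x_{i,k+1}=\mathcal R_{x_{i,k}}\big(\alpha\,\mathcal P_{T_{x_{i,k}}\mathcal M}(\sum_{j=1}^n(W^t)_{ij}x_{j,k})-\beta_k\xi_{i,k}\big)$ with arbitrary $\xi_{i,k}\in\partial_{\mathcal R}f_i(x_{i,k})$. Write $\mathbf x_k=(x_{1,k};\dots;x_{n,k})\in\mathbb{R}^{nd\times r}$, $\hat x_k=\frac1n\sum_ix_{i,k}$,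 $\bar x_k=\mathcal P_{\mathcal M}(\hat x_k)$, $\bar{\mathbf x}_k=1_n\otimes\bar x_k$ ($n$ stacked copies of $\bar x_k$), and $\|\mathbf x\|_{F,\infty}=\max_i\|x_i\|_F$. Fix constants $\delta_2\le\frac16$ and $\delta_1\le\frac{\delta_2}{5\sqrt r}$, and let $\mathcal N=\{\mathbf x:\|\mathbf x-\bar{\mathbf x}\|_F^2\le n\delta_1^2,\ \|\mathbf x-\bar{\mathbf x}\|_{F,\infty}\le\delta_2\}$, where for $\mathbf x=(x_1;\dots;x_n)$, $\bar{\mathbf x}=1_n\otimes\mathcal P_{\mathcal M}(\frac1n\sum_ix_i)$. Fix $\nu\in(0,1)$, and set $\Phi=2-\delta_2^2$, $\bar\alpha=\min\{\nu\Phi/L_t,1,1/M\}$, $\gamma_t=(1-4r\delta_1^2)(1-\frac{\delta_2^2}{2})\mu_t$, $\rho_t=\sqrt{1-2(1-\nu)\alpha\gamma_t}$. *)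

theory Defs
  imports "HOL-Analysis.Analysis" "HOL-Computational_Algebra.Polynomial" "HOL-Library.Multiset"
begin

(* Matrices in R^{d x r} are rendered as real^'r^'d (rows indexed by 'd, columns by 'r);
   the vec-instance norm / inner product on this type are exactly the Frobenius
   norm and tr(a^T b). *)

definition stiefel :: "(real^'r^'d) set" where
  "stiefel = {x. transpose x ** x = mat 1}"

definition tangent_space :: "real^'r^'d \<Rightarrow> (real^'r^'d) set" where
  "tangent_space x = {\<xi>. transpose x ** \<xi> + transpose \<xi> ** x = 0}"

definition proj_tangent :: "real^'r^'d \<Rightarrow> real^'r^'d \<Rightarrow> real^'r^'d" where
  "proj_tangent x y = y - (1/2) *\<^sub>R (x ** (transpose y ** x + transpose x ** y))"

definition proj_stiefel :: "real^'r^'d \<Rightarrow> real^'r^'d" where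
  "proj_stiefel y = (SOME p. p \<in> stiefel \<and> (\<forall>z\<in>stiefel. norm (y - p) \<le> norm (y - z)))"

definition sym_pos_def :: "real^'r^'r \<Rightarrow> bool" where
  "sym_pos_def S \<longleftrightarrow> transpose S = S \<and> (\<forall>v. v \<noteq> 0 \<longrightarrow> v \<bullet> (S *v v) > 0)"

definition inv_sqrtm :: "real^'r^'r \<Rightarrow> real^'r^'r" where
  "inv_sqrtm A = (THE S. sym_pos_def S \<and> S ** S = matrix_inv A)"

definition polar_retr :: "real^'r^'d \<Rightarrow> real^'r^'d \<Rightarrow> real^'r^'d" where
  "polar_retr x \<xi> = (x + \<xi>) ** inv_sqrtm (mat 1 + transpose \<xi> ** \<xi>)"

definition convex_subdiff :: "('a::real_inner \<Rightarrow> real) \<Rightarrow> 'a \<Rightarrow> 'a set" where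
  "convex_subdiff g x = {v. \<forall>y. g y \<ge> g x + inner v (y - x)}"

definition wc_subdiff :: "real \<Rightarrow> ('a::real_inner \<Rightarrow> real) \<Rightarrow> 'a \<Rightarrow> 'a set" where
  "wc_subdiff \<rho> f x = (\<lambda>v. v - \<rho> *\<^sub>R x) ` convex_subdiff (\<lambda>y. f y + \<rho>/2 * (norm y)\<^sup>2) x"

definition riem_subdiff :: "real \<Rightarrow> (real^'r^'d \<Rightarrow> real) \<Rightarrow> real^'r^'d \<Rightarrow> (real^'r^'d) set" where
  "riem_subdiff \<rho> f x = proj_tangent x ` wc_subdiff \<rho> f x"

fun mpow :: "real^'n^'n \<Rightarrow> nat \<Rightarrow> real^'n^'n" where
  "mpow A 0 = mat 1"
| "mpow A (Suc k) = A ** mpow A k"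

definition charpoly :: "real^'n^'n \<Rightarrow> real poly" where
  "charpoly A = det (\<chi> i j. (if i = j then [:0, 1:] else 0) - [:A $ i $ j:])"

definition eigs_desc :: "real^'n^'n \<Rightarrow> real list" where
  "eigs_desc A = rev (sorted_list_of_multiset (proots (charpoly A)))"

definition eig_k :: "nat \<Rightarrow> real^'n^'n \<Rightarrow> real" where
  "eig_k k A = eigs_desc A ! (k - 1)"

definition eig_min :: "real^'n^'n \<Rightarrow> real" where
  "eig_min A = last (eigs_desc A)"

definition sing_k :: "nat \<Rightarrow> real^'n^'n \<Rightarrow> real" where
  "sing_k k A = sqrt (eig_k k (transpose A ** A))"

end

theory Submission
  imports Defs
begin

text \<open>
  Write \<open>c\<^sub>k\<close> for the Frobenius distance of the iterates to their induced mean on the manifold.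
  The polar retraction is the nearest-point map, so it does not increase distances to points of
  the manifold; in the consensus region the Riemannian gradient of the consensus potential
  satisfies a restricted secant inequality, whence \<open>c\<^sub>k\<^sub>+\<^sub>1 \<le> \<rho>\<^sub>t c\<^sub>k + \<surd>n L \<beta>\<^sub>k\<close>. Since the stepsizes
  decay at a rate \<open>\<gamma>\<close> slower than \<open>\<rho>\<^sub>t\<close>, this gives \<open>c\<^sub>k \<le> 2 \<surd>n L \<beta>\<^sub>k / (1 - \<rho>\<^sub>t)\<close>.
  The region is preserved because \<open>W\<^sup>t\<close> halves the maximal deviation.
  In the descent inequality for \<open>d\<^sub>k\<^sup>2 = \<Sum>\<^sub>i |x\<^sub>i\<^sub>,\<^sub>k - x\<^sup>*|\<^sup>2\<close> sharpness contributes
  \<open>- 2 \<beta>\<^sub>k \<kappa> \<Sum>\<^sub>i |x\<^sub>i\<^sub>,\<^sub>k - x\<^sup>*|\<close>, which is at most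
  \<open>- 2 \<mu>\<^sub>0 \<kappa> d\<^sub>k\<^sup>2 / (\<Gamma> e\<^sub>0)\<close> because each agent stays within \<open>\<Gamma> \<gamma>\<^sup>k e\<^sub>0\<close> of the minimizer. All error
  terms are of order \<open>\<beta>\<^sub>k\<^sup>2\<close>, so \<open>d\<^sub>k\<^sub>+\<^sub>1\<^sup>2 \<le> n \<gamma>\<^sup>2\<^sup>k (e\<^sub>0\<^sup>2 - \<epsilon>)\<close> with a fixed
  \<open>\<epsilon> > 0\<close>, and any \<open>\<gamma> < 1\<close> close enough to 1 closes the induction.
\<close>

section \<open>Spectral theory of symmetric stochastic matrices\<close>

text \<open>The eigenvalues in the statement are entries of a sorted list of roots of a
  characteristic polynomial, so a spectral theorem is built and then tied to that list. On the
  manifold everything rests on one identity: the tangent projection at \<open>x\<close> of another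
  Stiefel point \<open>y\<close> is \<open>y - x\<close> plus a term quadratic in
  \<open>x - y\<close>. Curvature effects are therefore of second order, and in the sum over agents
  the first-order parts of the consensus directions cancel. The obstacle is that agents are compared
  with the nearest point of their mean, and that point moves. Averaging wins half of \<delta>2 per
  agent, scaled by \<alpha>; curvature and the shift of the reference point must cost less, which is
  what the ratios 1/5 and 1/6 secure. The consensus step need not bring the agents closer to the
  minimizer; in the descent it enters only as an error quadratic in the consensus error. Finally,
  \<delta> is chosen before the iterates, so the slack \<epsilon> may depend on the constants
  alone.\<close>

lemma linear_term_zero:
  fixes a b :: real
  assumes "\<And>s. 0 \<le> 2 * s * a + s\<^sup>2 * b"
  shows "a = 0"
proof (rule ccontr)
  assume "a \<noteq> 0"
  \<comment> \<open>A step against the sign of \<open>a\<close>, short enough that the linear term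
    dominates: the expression becomes \<open>s\<^sup>2 * (b - 2 * \<bar>b\<bar> - 2)\<close>,
    negative for either sign of \<open>b\<close>.\<close>
  define s where "s = - a / (\<bar>b\<bar> + 1)"
  have pos: "\<bar>b\<bar> + 1 > 0" by simp
  have "s * (\<bar>b\<bar> + 1) = - a" unfolding s_def using pos by simp
  then have a: "a = - (s * (\<bar>b\<bar> + 1))" by simp
  have "s \<noteq> 0" using \<open>a \<noteq> 0\<close> a by auto
  have "2 * s * a + s\<^sup>2 * b = s\<^sup>2 * (b - 2 * \<bar>b\<bar> - 2)"
    by (subst a) (simp add: power2_eq_square algebra_simps)
  also have "\<dots> < 0"
    using \<open>s \<noteq> 0\<close> by (intro mult_pos_neg) auto
  finally show False using assms[of s] by simp
qed

section \<open>Orthonormal eigenbases of self-adjoint maps\<close>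

definition orthonormal :: "'a::euclidean_space set \<Rightarrow> bool" where
  "orthonormal B \<longleftrightarrow> pairwise orthogonal B \<and> (\<forall>b\<in>B. norm b = 1)"

lemma orthonormal_independent: "orthonormal B \<Longrightarrow> independent B"
  unfolding orthonormal_def
  by (metis norm_zero pairwise_orthogonal_independent zero_neq_one)

lemma orthonormal_finite: "orthonormal B \<Longrightarrow> finite B"
  by (simp add: orthonormal_independent independent_imp_finite)

lemma orthonormal_expand:
  "orthonormal B \<Longrightarrow> x \<in> span B \<Longrightarrow> (\<Sum>b\<in>B. (x \<bullet> b) *\<^sub>R b) = x"
  using orthonormal_basis_expand orthonormal_finite unfolding orthonormal_def by blast

lemma orthonormal_inner:
  assumes "orthonormal B" "x \<in> span B"
  shows "x \<bullet> y = (\<Sum>b\<in>B. (x \<bullet> b) * (y \<bullet> b))"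
proof -
  have "x \<bullet> y = (\<Sum>b\<in>B. (x \<bullet> b) *\<^sub>R b) \<bullet> y"
    using orthonormal_expand[OF assms] by simp
  also have "\<dots> = (\<Sum>b\<in>B. (x \<bullet> b) * (y \<bullet> b))"
    by (simp add: inner_sum_left) (simp add: inner_commute)
  finally show ?thesis .
qed

text \<open>\<open>x\<close> maximizes the Rayleigh quotient on the unit sphere of \<open>S\<close>,
  with value \<open>m\<close>. Then \<open>g z = m *\<^sub>R z - f z\<close> has a nonnegative form
  on \<open>S\<close> that vanishes at \<open>x\<close>. Testing this form at
  \<open>x + s *\<^sub>R g x\<close>, which stays in \<open>S\<close> by invariance, forces the
  linear coefficient \<open>g x \<bullet> g x\<close> to be zero.\<close>

lemma selfadjoint_eigenvector_exists:
  fixes f :: "'a::euclidean_space \<Rightarrow> 'a"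
  assumes lin: "linear f" and sa: "\<And>x y. f x \<bullet> y = x \<bullet> f y"
    and S: "subspace S" "f ` S \<subseteq> S" "S \<noteq> {0}"
  obtains x c where "x \<in> S" "norm x = 1" "f x = c *\<^sub>R x"
proof -
  have zS: "0 \<in> S" using S(1) by (rule subspace_0)
  then obtain y where y: "y \<in> S" "y \<noteq> 0" using S(3) by blast
  let ?K = "S \<inter> sphere 0 1"
  have "compact ?K"
    by (intro closed_Int_compact closed_subspace S(1) compact_sphere)
  moreover have "(1 / norm y) *\<^sub>R y \<in> ?K"
    using y S(1) by (auto simp: subspace_scale)
  moreover have "continuous_on ?K (\<lambda>x. x \<bullet> f x)"
    by (intro continuous_intros linear_continuous_on_compose[OF _ lin])
  ultimately obtain x where x: "x \<in> ?K" and mx: "\<forall>z\<in>?K. z \<bullet> f z \<le> x \<bullet> f x"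
    using continuous_attains_sup[of ?K "\<lambda>x. x \<bullet> f x"] by (metis empty_iff)
  define m where "m = x \<bullet> f x"
  have up: "z \<bullet> f z \<le> m * (z \<bullet> z)" if z: "z \<in> S" for z
  proof (cases "z = 0")
    case False
    let ?w = "(1 / norm z) *\<^sub>R z"
    have "?w \<in> ?K" using z False S(1) by (auto simp: subspace_scale)
    then have "?w \<bullet> f ?w \<le> m" using mx m_def by blast
    moreover have "?w \<bullet> f ?w = (z \<bullet> f z) / (norm z)\<^sup>2"
      by (simp add: linear_scale[OF lin] power2_eq_square)
    ultimately show ?thesis
      using False by (simp only: dot_square_norm) (simp add: divide_simps)
  qed (simp add: linear_0[OF lin])
  define g where "g z = m *\<^sub>R z - f z" for z
  have xx: "x \<bullet> x = 1" "x \<in> S" using x by (auto simp: dot_square_norm)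
  have gS: "g z \<in> S" if "z \<in> S" for z
    unfolding g_def using that S by (auto intro!: subspace_diff subspace_scale)
  have xgx: "x \<bullet> g x = 0"
    unfolding g_def inner_diff_right using xx m_def by simp
  then have gxx: "g x \<bullet> x = 0" by (simp add: inner_commute)
  have gl: "g (u + s *\<^sub>R v) = g u + s *\<^sub>R g v" for u v s
    unfolding g_def by (simp add: linear_add[OF lin] linear_scale[OF lin] algebra_simps)
  have gsa: "g u \<bullet> v = u \<bullet> g v" for u v
    unfolding g_def by (simp add: inner_diff_left inner_diff_right sa)
  have gpos: "0 \<le> z \<bullet> g z" if "z \<in> S" for z
    unfolding g_def using up[OF that] by (simp add: inner_diff_right)
  have "0 \<le> 2 * s * (g x \<bullet> g x) + s\<^sup>2 * (g x \<bullet> g (g x))" for s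
  proof -
    have "0 \<le> (x + s *\<^sub>R g x) \<bullet> g (x + s *\<^sub>R g x)"
      by (intro gpos subspace_add subspace_scale S(1) xx gS)
    also have "\<dots> = 2 * s * (g x \<bullet> g x) + s\<^sup>2 * (g x \<bullet> g (g x))"
      unfolding gl by (simp add: inner_add_left inner_add_right xgx gsa[of x, symmetric] gxx
          power2_eq_square algebra_simps)
    finally show ?thesis .
  qed
  then have "g x \<bullet> g x = 0" by (rule linear_term_zero)
  then have "f x = m *\<^sub>R x" by (simp add: g_def)
  with x show ?thesis by (intro that[of x m]) auto
qed

text \<open>Induction on the dimension: an eigenvector splits off, and self-adjointness makes its
  orthogonal complement inside \<open>S\<close> invariant. General invariant subspaces are allowed
  because the complement of the constant vector is needed later. Writing eigenvalues as
  \<open>b \<bullet> f b\<close> avoids a separate eigenvalue map.\<close>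

lemma selfadjoint_eigenbasis:
  fixes f :: "'a::euclidean_space \<Rightarrow> 'a"
  assumes lin: "linear f" and sa: "\<And>x y. f x \<bullet> y = x \<bullet> f y"
    and S: "subspace S" "f ` S \<subseteq> S"
  shows "\<exists>B. orthonormal B \<and> span B = S \<and> (\<forall>b\<in>B. f b = (b \<bullet> f b) *\<^sub>R b)"
  using S
proof (induction "dim S" arbitrary: S rule: less_induct)
  case less
  show ?case
  proof (cases "S = {0}")
    case True
    then show ?thesis by (intro exI[of _ "{}"]) (auto simp: orthonormal_def)
  next
    case False
    then obtain x c where x: "x \<in> S" "norm x = 1" "f x = c *\<^sub>R x"
      using selfadjoint_eigenvector_exists[OF lin sa less.prems] by blast
    have xx: "x \<bullet> x = 1" using x by (simp add: dot_square_norm)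
    define T where "T = S \<inter> {v. x \<bullet> v = 0}"
    have T: "subspace T"
      unfolding T_def by (intro subspace_inter less.prems subspace_hyperplane)
    have fT: "f ` T \<subseteq> T"
    proof
      fix w assume "w \<in> f ` T"
      then obtain v where v: "v \<in> S" "x \<bullet> v = 0" "w = f v" by (auto simp: T_def)
      have "x \<bullet> f v = 0" using sa[of x v] x v by simp
      then show "w \<in> T" using v less.prems by (auto simp: T_def)
    qed
    have "x \<notin> T" using xx by (auto simp: T_def)
    moreover have "T \<subseteq> S" by (simp add: T_def)
    ultimately have "T \<subset> S" using x by blast
    then have "dim T < dim S"
      using T less.prems by (intro dim_psubset) (metis span_eq_iff)
    then obtain B where B: "orthonormal B" "span B = T" "\<forall>b\<in>B. f b = (b \<bullet> f b) *\<^sub>R b"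
      using less.hyps T fT by blast
    have BT: "b \<in> T" if "b \<in> B" for b using that B(2) span_base by blast
    have "orthonormal (insert x B)"
      using B(1) x BT unfolding orthonormal_def
      by (auto simp: pairwise_insert orthogonal_def T_def inner_commute)
    moreover have "span (insert x B) = S"
    proof
      show "span (insert x B) \<subseteq> S"
        using x BT less.prems(1) by (intro span_minimal) (auto simp: T_def)
      show "S \<subseteq> span (insert x B)"
      proof
        fix v assume v: "v \<in> S"
        have "v - (x \<bullet> v) *\<^sub>R x \<in> T"
          using v x xx less.prems(1)
          by (auto simp: T_def subspace_diff subspace_scale inner_diff_right)
        then show "v \<in> span (insert x B)" using B(2) by (auto simp: span_insert)
      qed
    qed
    moreover have "f x = (x \<bullet> f x) *\<^sub>R x" using x xx by simp
    ultimately show ?thesis using B(3) by (intro exI[of _ "insert x B"]) auto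
  qed
qed

section \<open>Symmetric matrices and the characteristic polynomial\<close>

lemma symmetric_inner:
  fixes A :: "real^'n^'n"
  assumes "transpose A = A"
  shows "(A *v x) \<bullet> y = x \<bullet> (A *v y)"
  using assms by (metis dot_lmul_matrix vector_transpose_matrix)

lemma matrix_diff_left_distrib: "(A - B) ** C = A ** C - B ** (C :: 'a::ring_1^'n^'m)"
  by (simp add: matrix_matrix_mult_def vec_eq_iff sum_subtractf algebra_simps)

lemma matrix_diff_right_distrib: "A ** (B - C) = A ** B - A ** (C :: 'a::ring_1^'n^'m)"
  by (simp add: matrix_matrix_mult_def vec_eq_iff sum_subtractf algebra_simps)

text \<open>The characteristic matrix is conjugated, over the polynomial ring, by the constant matrix
  whose columns are the eigenvectors.\<close>

lemma charpoly_eigenbasis: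
  fixes A :: "real^'n^'n"
  assumes on: "orthonormal B" and sp: "span B = UNIV"
    and ev: "\<And>b. b \<in> B \<Longrightarrow> A *v b = l b *\<^sub>R b"
  shows "proots (charpoly A) = image_mset l (mset_set B)"
proof -
  have fin: "finite B" using on by (rule orthonormal_finite)
  have "card B = dim (UNIV :: (real^'n) set)"
    using orthonormal_independent[OF on] sp by (metis dim_span dim_eq_card_independent)
  then have card: "card B = CARD('n)" by simp
  then obtain v where v: "bij_betw v (UNIV :: 'n set) B"
    using fin by (metis finite_class.finite_UNIV finite_same_card_bij)
  have vB: "v i \<in> B" for i using v by (auto simp: bij_betw_def)
  have orth: "v i \<bullet> v j = (if i = j then 1 else 0)" for i j
  proof (cases "i = j")
    case True then show ?thesis using on vB[of j] by (simp add: orthonormal_def dot_square_norm)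
  next
    case False
    then have "v i \<noteq> v j" using v by (auto simp: bij_betw_def inj_on_def)
    then show ?thesis using on vB False by (auto simp: orthonormal_def pairwise_def orthogonal_def)
  qed
  define C :: "real^'n^'n \<Rightarrow> real poly^'n^'n" where "C M = (\<chi> i j. [:M $ i $ j:])" for M
  define D :: "real^'n^'n" where "D = (\<chi> i j. if i = j then l (v i) else 0)"
  define Q :: "real^'n^'n" where "Q = (\<chi> i j. v j $ i)"
  define X :: "real poly^'n^'n" where "X = mat [:0, 1:]"
  have Cs: "(\<Sum>i\<in>UNIV. [:g i:]) = [:\<Sum>i\<in>UNIV. g i:]" for g :: "'n \<Rightarrow> real"
    by (simp add: poly_eq_iff coeff_sum coeff_pCons split: nat.splits)
  have Cmul: "C (M ** N) = C M ** C N" for M N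
    by (simp add: C_def matrix_matrix_mult_def vec_eq_iff Cs mult.commute)
  have cp: "charpoly M = det (X - C M)" for M
    unfolding charpoly_def X_def C_def by (rule arg_cong[where f=det]) (simp add: vec_eq_iff mat_def)
  have QQ: "transpose Q ** Q = mat 1"
    using orth by (simp add: Q_def matrix_matrix_mult_def transpose_def mat_def vec_eq_iff inner_vec_def)
  have AQ: "A ** Q = Q ** D"
  proof -
    have "(A ** Q) $ i $ j = (A *v v j) $ i" for i j
      by (simp add: Q_def matrix_matrix_mult_def matrix_vector_mult_def)
    moreover have "(Q ** D) $ i $ j = v j $ i * l (v j)" for i j
      by (simp add: Q_def D_def matrix_matrix_mult_def if_distrib sum.delta cong: if_cong)
    ultimately show ?thesis using ev[OF vB] by (simp add: vec_eq_iff)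
  qed
  have C1: "C (mat 1) = mat 1"
    by (simp add: C_def mat_def vec_eq_iff)
  \<comment> \<open>Orthogonality of \<open>Q\<close> survives the passage to constant polynomials.
    A nonzero determinant suffices, since it is then cancelled in the integral domain of
    polynomials.\<close>
  have "det (C (transpose Q)) * det (C Q) = 1"
    by (metis Cmul C1 QQ det_I det_mul)
  then have dQ: "det (C Q) \<noteq> 0" by auto
  have Xc: "X ** N = N ** X" for N
    unfolding X_def matrix_matrix_mult_def mat_def
    by (simp add: vec_eq_iff if_distrib if_distribR sum.delta cong: if_cong)
  have "(X - C A) ** C Q = C Q ** (X - C D)"
    by (simp only: matrix_diff_left_distrib matrix_diff_right_distrib Xc
        Cmul[of A Q, symmetric] Cmul[of Q D, symmetric] AQ)
  then have "det (X - C A) * det (C Q) = det (C Q) * det (X - C D)"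
    by (metis det_mul)
  then have "charpoly A = det (X - C D)" using dQ by (simp add: cp)
  also have "\<dots> = (\<Prod>i\<in>UNIV. [:- l (v i), 1:])"
    by (subst det_diagonal) (auto simp: X_def C_def D_def mat_def)
  finally have "proots (charpoly A) = (\<Sum>i\<in>UNIV. {#l (v i)#})"
    by (simp add: proots_prod)
  also have "\<dots> = image_mset (\<lambda>i. l (v i)) (mset_set UNIV)"
    by (simp add: sum_unfold_sum_mset)
  also have "\<dots> = image_mset l (image_mset v (mset_set UNIV))"
    by (simp add: multiset.map_comp comp_def)
  also have "image_mset v (mset_set UNIV) = mset_set B"
    using v by (simp add: image_mset_mset_set bij_betw_def)
  finally show ?thesis .
qed

section \<open>Symmetric stochastic matrices and their spectrum\<close>

definition sym_stochastic :: "real^'n^'n \<Rightarrow> bool" where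
  "sym_stochastic P \<longleftrightarrow> transpose P = P \<and> (\<forall>i j. 0 \<le> P $ i $ j) \<and> (\<forall>i. (\<Sum>j\<in>UNIV. P $ i $ j) = 1)"

lemma sym_stochasticD:
  assumes "sym_stochastic P"
  shows "transpose P = P" "P $ i $ j = P $ j $ i" "0 \<le> P $ i $ j" "(\<Sum>j\<in>UNIV. P $ i $ j) = 1"
    "(\<Sum>i\<in>UNIV. P $ i $ j) = 1"
proof -
  show 1: "transpose P = P" "0 \<le> P $ i $ j" "(\<Sum>j\<in>UNIV. P $ i $ j) = 1"
    using assms by (auto simp: sym_stochastic_def)
  show 2: "P $ i $ j = P $ j $ i" for i j
    using 1(1) by (metis transpose_def vec_lambda_beta)
  show "(\<Sum>i\<in>UNIV. P $ i $ j) = 1"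
    using assms by (subst 2) (auto simp: sym_stochastic_def)
qed

lemma sym_stochastic_mult:
  assumes P: "sym_stochastic P" and Q: "sym_stochastic Q" and c: "P ** Q = Q ** P"
  shows "sym_stochastic (P ** Q)"
proof -
  have "(\<Sum>j\<in>UNIV. (P ** Q) $ i $ j) = 1" for i
    unfolding matrix_matrix_mult_def
    by (simp, subst sum.swap)
       (simp add: sum_distrib_left[symmetric] sym_stochasticD[OF P] sym_stochasticD[OF Q])
  moreover have "transpose (P ** Q) = P ** Q"
    using c sym_stochasticD(1)[OF P] sym_stochasticD(1)[OF Q] by (simp add: matrix_transpose_mul)
  moreover have "0 \<le> (P ** Q) $ i $ j" for i j
    by (auto simp: matrix_matrix_mult_def sym_stochasticD[OF P] sym_stochasticD[OF Q] intro!: sum_nonneg)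
  ultimately show ?thesis by (simp add: sym_stochastic_def)
qed

lemma stochastic_one: "sym_stochastic P \<Longrightarrow> P *v 1 = 1"
  by (simp add: matrix_vector_mult_def vec_eq_iff sym_stochasticD)

lemma mpow_commute: "A ** mpow A k = mpow A k ** A"
proof (induction k)
  case (Suc k)
  then show ?case by (metis mpow.simps(2) matrix_mul_assoc)
qed simp

lemma sym_stochastic_mpow: "sym_stochastic P \<Longrightarrow> sym_stochastic (mpow P k)"
proof (induction k)
  case 0
  then show ?case by (simp add: sym_stochastic_def) (simp add: mat_def)
next
  case (Suc k)
  then show ?case by (simp add: sym_stochastic_mult mpow_commute)
qed

text \<open>Row and column sums equal to 1 collapse both squared terms. The case
  \<open>s = 1\<close> is the Dirichlet form, the case \<open>s = -1\<close> its counterpart with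
  plus signs; being sums of squares, they confine the spectrum to the interval from -1 to 1.\<close>

lemma stochastic_energy:
  fixes x :: "'n::finite \<Rightarrow> 'a::real_inner"
  assumes P: "sym_stochastic P"
  shows "(\<Sum>i\<in>UNIV. \<Sum>j\<in>UNIV. P $ i $ j * (norm (x i - s *\<^sub>R x j))\<^sup>2) =
    (1 + s\<^sup>2) * (\<Sum>i\<in>UNIV. (norm (x i))\<^sup>2) - 2 * s * (\<Sum>i\<in>UNIV. x i \<bullet> (\<Sum>j\<in>UNIV. P $ i $ j *\<^sub>R x j))"
proof -
  have e: "P $ i $ j * (norm (x i - s *\<^sub>R x j))\<^sup>2 =
      P $ i $ j * (norm (x i))\<^sup>2 + s\<^sup>2 * (P $ i $ j * (norm (x j))\<^sup>2) - 2 * s * (P $ i $ j * (x i \<bullet> x j))" for i j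
  proof -
    have "(norm (x i - s *\<^sub>R x j))\<^sup>2 = (norm (x i))\<^sup>2 + s\<^sup>2 * (norm (x j))\<^sup>2 - 2 * s * (x i \<bullet> x j)"
      unfolding power2_norm_eq_inner
      by (simp add: inner_diff_left inner_diff_right inner_commute power2_eq_square algebra_simps)
    then show ?thesis by (simp only:) (simp add: algebra_simps)
  qed
  have 1: "(\<Sum>i\<in>UNIV. \<Sum>j\<in>UNIV. P $ i $ j * (norm (x i))\<^sup>2) = (\<Sum>i\<in>UNIV. (norm (x i))\<^sup>2)"
    by (simp add: sum_distrib_right[symmetric] sym_stochasticD[OF P])
  have 2: "(\<Sum>i\<in>UNIV. \<Sum>j\<in>UNIV. P $ i $ j * (norm (x j))\<^sup>2) = (\<Sum>i\<in>UNIV. (norm (x i))\<^sup>2)"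
    by (subst sum.swap) (simp add: sum_distrib_right[symmetric] sym_stochasticD[OF P])
  have 3: "(\<Sum>i\<in>UNIV. x i \<bullet> (\<Sum>j\<in>UNIV. P $ i $ j *\<^sub>R x j)) = (\<Sum>i\<in>UNIV. \<Sum>j\<in>UNIV. P $ i $ j * (x i \<bullet> x j))"
    by (simp add: inner_sum_right)
  show ?thesis
    unfolding e sum.distrib sum_subtractf sum_distrib_left[symmetric] 1 2 3
    by (simp add: algebra_simps)
qed

lemma stochastic_dirichlet:
  fixes x :: "'n::finite \<Rightarrow> 'a::real_inner"
  assumes P: "sym_stochastic P"
  shows "(\<Sum>i\<in>UNIV. x i \<bullet> (x i - (\<Sum>j\<in>UNIV. P $ i $ j *\<^sub>R x j))) =
    (\<Sum>i\<in>UNIV. \<Sum>j\<in>UNIV. P $ i $ j * (norm (x i - x j))\<^sup>2) / 2"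
  using stochastic_energy[OF P, of x 1]
  by (simp add: inner_diff_right sum_subtractf dot_square_norm)

lemma stochastic_quadform:
  fixes z :: "real^'n"
  assumes P: "sym_stochastic P"
  shows "z \<bullet> z - z \<bullet> (P *v z) = (\<Sum>i\<in>UNIV. \<Sum>j\<in>UNIV. P $ i $ j * (z $ i - z $ j)\<^sup>2) / 2"
    and "z \<bullet> z + z \<bullet> (P *v z) = (\<Sum>i\<in>UNIV. \<Sum>j\<in>UNIV. P $ i $ j * (z $ i + z $ j)\<^sup>2) / 2"
  using stochastic_energy[OF P, of "\<lambda>i. z $ i" 1] stochastic_energy[OF P, of "\<lambda>i. z $ i" "-1"]
  by (simp_all add: inner_vec_def matrix_vector_mult_def power2_eq_square)

text \<open>Splitting off the constant vector, whose eigenvalue 1 is the largest one, makes the second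
  entry of the sorted spectrum the largest eigenvalue on the orthogonal complement.\<close>

lemma stochastic_eigenbasis:
  fixes P :: "real^'n^'n"
  assumes P: "sym_stochastic P" and n2: "CARD('n) \<ge> 2"
  obtains B :: "(real^'n) set" where "orthonormal B" "span B = {z. 1 \<bullet> z = 0}"
    "\<And>b. b \<in> B \<Longrightarrow> P *v b = (b \<bullet> (P *v b)) *\<^sub>R b"
    "\<And>b. b \<in> B \<Longrightarrow> eig_min P \<le> b \<bullet> (P *v b)"
    "\<And>b. b \<in> B \<Longrightarrow> b \<bullet> (P *v b) \<le> eig_k 2 P"
    "\<exists>b\<in>B. b \<bullet> (P *v b) = eig_k 2 P" "\<exists>b\<in>B. b \<bullet> (P *v b) = eig_min P"
proof -
  define e :: "real^'n" where "e = 1"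
  have P1: "P *v e = e"
    unfolding e_def by (rule stochastic_one[OF P])
  have sa: "(P *v x) \<bullet> y = x \<bullet> (P *v y)" for x y
    by (rule symmetric_inner) (rule sym_stochasticD[OF P])
  define S where "S = {z. e \<bullet> z = 0}"
  have sS: "subspace S" unfolding S_def by (rule subspace_hyperplane)
  have "e \<bullet> (P *v z) = 0" if "e \<bullet> z = 0" for z
    using sa[of e z] P1 that by simp
  then have inv: "(*v) P ` S \<subseteq> S" by (auto simp: S_def)
  obtain B where on: "orthonormal B" and sp: "span B = S"
    and ev: "\<forall>b\<in>B. P *v b = (b \<bullet> (P *v b)) *\<^sub>R b"
    using selfadjoint_eigenbasis[OF matrix_vector_mul_linear sa sS inv] by blast
  have BS: "e \<bullet> b = 0" if "b \<in> B" for b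
    using that sp span_base S_def by blast
  define l where "l b = b \<bullet> (P *v b)" for b
  define u where "u = (1 / norm e) *\<^sub>R e"
  have e0: "e \<noteq> 0" by (simp add: e_def vec_eq_iff)
  have nu: "norm u = 1" using e0 by (simp add: u_def)
  have eu: "e = norm e *\<^sub>R u" using e0 by (simp add: u_def)
  have onu: "orthonormal (insert u B)"
    using on nu BS unfolding orthonormal_def
    by (auto simp: pairwise_insert orthogonal_def u_def inner_commute)
  have uB: "u \<notin> B"
    using BS[of u] e0 by (auto simp: u_def)
  have spu: "span (insert u B) = UNIV"
  proof -
    have "z \<in> span (insert u B)" for z
    proof -
      have "z - (u \<bullet> z) *\<^sub>R u \<in> S"
        using e0 unfolding S_def u_def
        by (simp add: inner_diff_right dot_square_norm power2_eq_square)
      then show ?thesis using sp by (auto simp: span_insert)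
    qed
    then show ?thesis by blast
  qed
  have lu: "l u = 1" unfolding l_def u_def
    using e0 P1 by (simp add: matrix_vector_mult_scaleR dot_square_norm power2_eq_square)
  have evu: "P *v b = l b *\<^sub>R b" if "b \<in> insert u B" for b
    using that ev lu P1 by (auto simp: l_def u_def matrix_vector_mult_scaleR)
  have fin: "finite B" using on by (rule orthonormal_finite)
  have cp: "proots (charpoly P) = add_mset 1 (image_mset l (mset_set B))"
    using charpoly_eigenbasis[OF onu spu evu] fin uB lu by simp
  define xs where "xs = sorted_list_of_multiset (image_mset l (mset_set B))"
  have le1: "l b \<le> 1" if "b \<in> B" for b
  proof -
    have "b \<bullet> b = 1" using on that by (simp add: orthonormal_def dot_square_norm)
    moreover have "0 \<le> b \<bullet> b - l b"
      unfolding l_def stochastic_quadform(1)[OF P]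
      by (auto intro!: sum_nonneg mult_nonneg_nonneg sym_stochasticD[OF P])
    ultimately show ?thesis by simp
  qed
  have xs: "sorted xs" "set xs = l ` B"
    unfolding xs_def using fin by (auto simp: sorted_sorted_list_of_multiset)
  \<comment> \<open>No eigenvalue on the complement exceeds 1, so inserting 1 into the ascending
    list puts it last, and reversal puts it first.\<close>
  have ed: "eigs_desc P = 1 # rev xs"
    unfolding eigs_desc_def cp sorted_list_of_multiset_insert xs_def[symmetric]
    by (subst sorted_insort_is_snoc) (use xs le1 in auto)
  \<comment> \<open>With at least two agents the complement of the constant vector is nontrivial, so
    the position read by \<open>eig_k 2\<close> exists in the list.\<close>
  have "B \<noteq> {}"
  proof
    assume "B = {}"
    then have "dim (UNIV :: (real^'n) set) \<le> card {u}"
      using spu by (metis dim_le_card dim_span finite.emptyI finite_insert order_refl)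
    then show False using n2 by simp
  qed
  then have ne: "xs \<noteq> []" using xs by auto
  have k2: "eig_k 2 P = last xs" using ne by (simp add: eig_k_def ed rev_nth last_conv_nth)
  have mn: "eig_min P = hd xs" using ne by (simp add: eig_min_def ed last_rev)
  have "y \<le> last xs \<and> hd xs \<le> y" if "y \<in> set xs" for y
    using that xs(1) ne
    by (metis in_set_conv_nth sorted_nth_mono last_conv_nth hd_conv_nth le0 One_nat_def Suc_pred length_pos_if_in_set less_Suc_eq_le diff_less zero_less_one)
  then have bd: "hd xs \<le> l b" "l b \<le> last xs" if "b \<in> B" for b
    using that xs by auto
  have "last xs \<in> l ` B" "hd xs \<in> l ` B" using ne xs by auto
  then show ?thesis
    using that[of B] on sp ev bd unfolding k2 mn l_def S_def e_def by (metis (no_types, lifting) imageE)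
qed

text \<open>In the eigenbasis all three claims are termwise. The third is co-coercivity:
  \<open>0 \<le> 1 - l b \<le> 1 - eig_min P\<close> bounds the square of \<open>1 - l b\<close> by
  \<open>1 - eig_min P\<close> times its first power. It lets the squared consensus step be absorbed
  by the linear one when \<open>\<alpha> * L\<^sub>t\<close> is bounded.\<close>

lemma stochastic_spectral:
  fixes P :: "real^'n^'n"
  assumes P: "sym_stochastic P" and n2: "CARD('n) \<ge> 2" and z: "1 \<bullet> z = 0"
  shows "(1 - eig_k 2 P) * (z \<bullet> z) \<le> z \<bullet> (z - P *v z)"
    and "z \<bullet> (z - P *v z) \<le> (1 - eig_min P) * (z \<bullet> z)"
    and "(norm (z - P *v z))\<^sup>2 \<le> (1 - eig_min P) * (z \<bullet> (z - P *v z))"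
proof -
  obtain B where on: "orthonormal B" and sp: "span B = {z. 1 \<bullet> z = 0}"
    and ev: "\<And>b. b \<in> B \<Longrightarrow> P *v b = (b \<bullet> (P *v b)) *\<^sub>R b"
    and mn: "\<And>b. b \<in> B \<Longrightarrow> eig_min P \<le> b \<bullet> (P *v b)"
    and mx: "\<And>b. b \<in> B \<Longrightarrow> b \<bullet> (P *v b) \<le> eig_k 2 P"
    using stochastic_eigenbasis[OF P n2] by metis
  define l where "l b = b \<bullet> (P *v b)" for b
  have zB: "z \<in> span B" using sp z by simp
  have c: "(P *v z) \<bullet> b = l b * (z \<bullet> b)" if "b \<in> B" for b
    using symmetric_inner[OF sym_stochasticD(1)[OF P], of z b] ev[OF that] l_def
    by (metis inner_scaleR_right)
  have le1: "l b \<le> 1" if "b \<in> B" for b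
  proof -
    have "b \<bullet> b = 1" using on that by (simp add: orthonormal_def dot_square_norm)
    moreover have "0 \<le> b \<bullet> b - l b"
      unfolding l_def stochastic_quadform(1)[OF P]
      by (auto intro!: sum_nonneg mult_nonneg_nonneg sym_stochasticD[OF P])
    ultimately show ?thesis by simp
  qed
  have zz: "z \<bullet> z = (\<Sum>b\<in>B. (z \<bullet> b)\<^sup>2)"
    using orthonormal_inner[OF on zB, of z] by (simp add: power2_eq_square)
  have PzB: "z - P *v z \<in> span B"
    using sp z symmetric_inner[OF sym_stochasticD(1)[OF P], of 1 z] stochastic_one[OF P]
    by (simp add: inner_diff_right)
  have q: "z \<bullet> (z - P *v z) = (\<Sum>b\<in>B. (1 - l b) * (z \<bullet> b)\<^sup>2)"
    by (subst orthonormal_inner[OF on zB])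
       (auto intro!: sum.cong simp: inner_diff_left c power2_eq_square algebra_simps)
  have q2: "(norm (z - P *v z))\<^sup>2 = (\<Sum>b\<in>B. (1 - l b)\<^sup>2 * (z \<bullet> b)\<^sup>2)"
    unfolding power2_norm_eq_inner
    by (subst orthonormal_inner[OF on PzB])
       (auto intro!: sum.cong simp: inner_diff_left c power2_eq_square algebra_simps)
  show "(1 - eig_k 2 P) * (z \<bullet> z) \<le> z \<bullet> (z - P *v z)"
    unfolding q zz sum_distrib_left
    by (intro sum_mono mult_right_mono) (use mx l_def in auto)
  show "z \<bullet> (z - P *v z) \<le> (1 - eig_min P) * (z \<bullet> z)"
    unfolding q zz sum_distrib_left
    by (intro sum_mono mult_right_mono) (use mn l_def in auto)
  show "(norm (z - P *v z))\<^sup>2 \<le> (1 - eig_min P) * (z \<bullet> (z - P *v z))"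
    unfolding q q2 sum_distrib_left power2_eq_square[of "1 - _"] mult.assoc
    by (intro sum_mono mult_right_mono mult_nonneg_nonneg) (use mn le1 l_def in auto)
qed

text \<open>The scalar inequalities are applied to each coordinate of the centred agents along
  \<open>Basis\<close> and summed. Centring changes no difference between agents, so the quadratic
  forms add up to \<open>E / 2\<close>.\<close>

lemma stochastic_spectral_vec:
  fixes P :: "real^'n^'n" and x :: "'n \<Rightarrow> 'a::euclidean_space"
  assumes P: "sym_stochastic P" and n2: "CARD('n) \<ge> 2"
  defines "m \<equiv> (1 / real CARD('n)) *\<^sub>R (\<Sum>i\<in>UNIV. x i)"
    and "E \<equiv> (\<Sum>i\<in>UNIV. \<Sum>j\<in>UNIV. P $ i $ j * (norm (x i - x j))\<^sup>2)"
  shows "(1 - eig_k 2 P) * (\<Sum>i\<in>UNIV. (norm (x i - m))\<^sup>2) \<le> E / 2"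
    and "E / 2 \<le> (1 - eig_min P) * (\<Sum>i\<in>UNIV. (norm (x i - m))\<^sup>2)"
    and "(\<Sum>i\<in>UNIV. (norm (x i - (\<Sum>j\<in>UNIV. P $ i $ j *\<^sub>R x j)))\<^sup>2) \<le> (1 - eig_min P) * (E / 2)"
proof -
  define Z :: "'a \<Rightarrow> real^'n" where "Z b = (\<chi> i. (x i - m) \<bullet> b)" for b
  have Pm: "(\<Sum>j\<in>UNIV. m \<bullet> b * P $ i $ j) = m \<bullet> b" for i b
    by (simp add: sum_distrib_left[symmetric] sym_stochasticD[OF P])
  have Zi: "1 \<bullet> Z b = 0" for b
    by (simp add: Z_def inner_vec_def inner_diff_left sum_subtractf m_def inner_sum_left)
  have nn: "(\<Sum>b\<in>Basis. (v \<bullet> b)\<^sup>2) = (norm v)\<^sup>2" for v :: 'a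
    unfolding power2_norm_eq_inner unfolding power2_eq_square by (rule euclidean_inner[symmetric])
  have s1: "(\<Sum>b\<in>Basis. Z b \<bullet> Z b) = (\<Sum>i\<in>UNIV. (norm (x i - m))\<^sup>2)"
    unfolding Z_def inner_vec_def
    by (subst sum.swap) (simp add: power2_eq_square[symmetric] nn)
  have "Z b \<bullet> (Z b - P *v Z b) = (\<Sum>i\<in>UNIV. \<Sum>j\<in>UNIV. P $ i $ j * ((x i - x j) \<bullet> b)\<^sup>2) / 2" for b
    using stochastic_quadform(1)[OF P, of "Z b"] by (simp add: Z_def inner_diff_right inner_diff_left)
  then have "(\<Sum>b\<in>Basis. Z b \<bullet> (Z b - P *v Z b)) =
      (\<Sum>b\<in>Basis. \<Sum>i\<in>UNIV. \<Sum>j\<in>UNIV. P $ i $ j * ((x i - x j) \<bullet> b)\<^sup>2) / 2"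
    by (simp add: sum_divide_distrib)
  also have "(\<Sum>b\<in>Basis. \<Sum>i\<in>UNIV. \<Sum>j\<in>UNIV. P $ i $ j * ((x i - x j) \<bullet> b)\<^sup>2) =
      (\<Sum>i\<in>UNIV. \<Sum>j\<in>UNIV. \<Sum>b\<in>Basis. P $ i $ j * ((x i - x j) \<bullet> b)\<^sup>2)"
    by (subst sum.swap, rule sum.cong[OF refl], rule sum.swap)
  also have "\<dots> = E"
    by (simp add: E_def sum_distrib_left[symmetric] nn)
  finally have s2: "(\<Sum>b\<in>Basis. Z b \<bullet> (Z b - P *v Z b)) = E / 2" .
  have "(Z b - P *v Z b) $ i = (x i - (\<Sum>j\<in>UNIV. P $ i $ j *\<^sub>R x j)) \<bullet> b" for b i
    by (simp add: Z_def matrix_vector_mult_def inner_diff_left inner_sum_left algebra_simps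
        sum_subtractf Pm)
  then have "(norm (Z b - P *v Z b))\<^sup>2 = (\<Sum>i\<in>UNIV. ((x i - (\<Sum>j\<in>UNIV. P $ i $ j *\<^sub>R x j)) \<bullet> b)\<^sup>2)" for b
    unfolding power2_norm_eq_inner inner_vec_def by (simp add: power2_eq_square)
  then have "(\<Sum>b\<in>Basis. (norm (Z b - P *v Z b))\<^sup>2) =
      (\<Sum>b\<in>Basis. \<Sum>i\<in>UNIV. ((x i - (\<Sum>j\<in>UNIV. P $ i $ j *\<^sub>R x j)) \<bullet> b)\<^sup>2)"
    by simp
  also have "\<dots> = (\<Sum>i\<in>UNIV. (norm (x i - (\<Sum>j\<in>UNIV. P $ i $ j *\<^sub>R x j)))\<^sup>2)"
    by (subst sum.swap) (simp add: nn)
  finally have s3: "(\<Sum>b\<in>Basis. (norm (Z b - P *v Z b))\<^sup>2) =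
      (\<Sum>i\<in>UNIV. (norm (x i - (\<Sum>j\<in>UNIV. P $ i $ j *\<^sub>R x j)))\<^sup>2)" .
  note sp = stochastic_spectral[OF P n2 Zi]
  show "(1 - eig_k 2 P) * (\<Sum>i\<in>UNIV. (norm (x i - m))\<^sup>2) \<le> E / 2"
    unfolding s1[symmetric] s2[symmetric] sum_distrib_left by (intro sum_mono sp)
  show "E / 2 \<le> (1 - eig_min P) * (\<Sum>i\<in>UNIV. (norm (x i - m))\<^sup>2)"
    unfolding s1[symmetric] s2[symmetric] sum_distrib_left by (intro sum_mono sp)
  show "(\<Sum>i\<in>UNIV. (norm (x i - (\<Sum>j\<in>UNIV. P $ i $ j *\<^sub>R x j)))\<^sup>2) \<le> (1 - eig_min P) * (E / 2)"
    unfolding s2[symmetric] s3[symmetric] sum_distrib_left by (intro sum_mono sp)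
qed

text \<open>The smallest eigenvalue is attained on the complement of the constant vector, where the
  second one is an upper bound; the form with plus signs keeps it above -1. This later gives
  \<open>\<mu>\<^sub>t \<le> L\<^sub>t \<le> 2\<close>.\<close>

lemma stochastic_eig_bounds:
  fixes P :: "real^'n^'n"
  assumes P: "sym_stochastic P" and n2: "CARD('n) \<ge> 2"
  shows "eig_min P \<le> eig_k 2 P" and "- 1 \<le> eig_min P"
proof -
  obtain B where on: "orthonormal B"
    and mn: "\<And>b. b \<in> B \<Longrightarrow> eig_min P \<le> b \<bullet> (P *v b)"
    and mx: "\<And>b. b \<in> B \<Longrightarrow> b \<bullet> (P *v b) \<le> eig_k 2 P"
    and at: "\<exists>b\<in>B. b \<bullet> (P *v b) = eig_min P"
    using stochastic_eigenbasis[OF P n2] by metis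
  obtain b where b: "b \<in> B" "b \<bullet> (P *v b) = eig_min P" using at by blast
  show "eig_min P \<le> eig_k 2 P" using mx[OF b(1)] b(2) by simp
  have "b \<bullet> b = 1" using on b(1) by (simp add: orthonormal_def dot_square_norm)
  moreover have "0 \<le> b \<bullet> b + b \<bullet> (P *v b)"
    unfolding stochastic_quadform(2)[OF P]
    by (auto intro!: sum_nonneg mult_nonneg_nonneg sym_stochasticD[OF P])
  ultimately show "- 1 \<le> eig_min P" using b(2) by simp
qed

section \<open>Second singular value and powers of the mixing matrix\<close>

lemma sing2_contraction:
  fixes W :: "real^'n^'n"
  assumes W: "sym_stochastic W" and n2: "CARD('n) \<ge> 2" and z: "1 \<bullet> z = 0"
  shows "norm (W *v z) \<le> sing_k 2 W * norm z"
proof -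
  have tW: "transpose W = W" by (rule sym_stochasticD[OF W])
  have W2: "sym_stochastic (W ** W)" by (intro sym_stochastic_mult W refl)
  \<comment> \<open>The singular value is read off from \<open>W ** W\<close>, whose quadratic form
    is the squared length of \<open>W *v y\<close>. As \<open>W ** W\<close> is again symmetric
    stochastic, its spectral bound on centred vectors is a contraction bound for
    \<open>W\<close>.\<close>
  have sq: "y \<bullet> ((W ** W) *v y) = (norm (W *v y))\<^sup>2" for y
    unfolding matrix_vector_mul_assoc[symmetric] power2_norm_eq_inner
    by (rule symmetric_inner[OF tW, symmetric])
  obtain b where "b \<bullet> ((W ** W) *v b) = eig_k 2 (W ** W)"
    using stochastic_eigenbasis[OF W2 n2] by metis
  then have pos: "0 \<le> eig_k 2 (W ** W)" using sq by (metis zero_le_power2)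
  have "(1 - eig_k 2 (W ** W)) * (z \<bullet> z) \<le> z \<bullet> z - (norm (W *v z))\<^sup>2"
    using stochastic_spectral(1)[OF W2 n2 z] by (simp add: inner_diff_right sq)
  then have "(norm (W *v z))\<^sup>2 \<le> (sing_k 2 W * norm z)\<^sup>2"
    using pos by (simp add: sing_k_def tW power_mult_distrib dot_square_norm algebra_simps)
  then show ?thesis
    using pos by (intro power2_le_imp_le[of "norm (W *v z)"]) (auto simp: sing_k_def tW)
qed

text \<open>By the positive diagonal every edge of the graph of \<open>W\<close> is an edge of the graph of
  \<open>W\<^sup>2\<close>, so the Dirichlet form of \<open>W\<^sup>2\<close> vanishes on constant vectors only; this also excludes
  the eigenvalue -1 of \<open>W\<close>.\<close>

lemma sing2_bounds:
  fixes W :: "real^'n^'n"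
  assumes W: "sym_stochastic W" and n2: "CARD('n) \<ge> 2"
    and diag: "\<And>i. W $ i $ i > 0"
    and conn: "\<And>i j. (i, j) \<in> {(u, v). W $ u $ v > 0}\<^sup>*"
  shows "0 \<le> sing_k 2 W" and "sing_k 2 W < 1"
proof -
  have tW: "transpose W = W" by (rule sym_stochasticD[OF W])
  have W2: "sym_stochastic (W ** W)" by (intro sym_stochastic_mult W refl)
  have sq: "y \<bullet> ((W ** W) *v y) = (norm (W *v y))\<^sup>2" for y
    unfolding matrix_vector_mul_assoc[symmetric] power2_norm_eq_inner
    by (rule symmetric_inner[OF tW, symmetric])
  obtain B b where on: "orthonormal B" and sp: "span B = {z. 1 \<bullet> z = 0}"
    and b: "b \<in> B" and bl: "b \<bullet> ((W ** W) *v b) = eig_k 2 (W ** W)"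
    using stochastic_eigenbasis[OF W2 n2] by metis
  have pos: "0 \<le> eig_k 2 (W ** W)" using sq bl by (metis zero_le_power2)
  then show "0 \<le> sing_k 2 W" by (simp add: sing_k_def tW)
  have bb: "b \<bullet> b = 1" using on b by (simp add: orthonormal_def dot_square_norm)
  have "eig_k 2 (W ** W) < 1"
  proof (rule ccontr)
    assume "\<not> ?thesis"
    then have "b \<bullet> b - b \<bullet> ((W ** W) *v b) \<le> 0" using bb bl by simp
    then have "(\<Sum>i\<in>UNIV. \<Sum>j\<in>UNIV. (W ** W) $ i $ j * (b $ i - b $ j)\<^sup>2) \<le> 0"
      unfolding stochastic_quadform(1)[OF W2] by simp
    moreover have nn: "0 \<le> (W ** W) $ i $ j * (b $ i - b $ j)\<^sup>2" for i j
      by (simp add: sym_stochasticD[OF W2])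
    ultimately have "(\<Sum>i\<in>UNIV. \<Sum>j\<in>UNIV. (W ** W) $ i $ j * (b $ i - b $ j)\<^sup>2) = 0"
      by (intro antisym sum_nonneg) auto
    then have z: "(W ** W) $ i $ j * (b $ i - b $ j)\<^sup>2 = 0" for i j
      using nn by (simp add: sum_nonneg_eq_0_iff sum_nonneg)
    have "b $ i = b $ j" if "W $ i $ j > 0" for i j
    proof -
      have "0 < W $ i $ i * W $ i $ j" using that diag by simp
      also have "\<dots> \<le> (W ** W) $ i $ j"
        unfolding matrix_matrix_mult_def
        by (simp, rule member_le_sum[where i=i and f="\<lambda>k. W $ i $ k * W $ k $ j"])
           (auto simp: sym_stochasticD[OF W])
      finally show ?thesis using z[of i j] by simp
    qed
    note edge = this
    have c: "b $ i = b $ j" for i j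
      using conn[of i j] by (induction rule: rtrancl_induct) (auto dest: edge)
    have "1 \<bullet> b = 0" using sp span_base[OF b] by blast
    then have "(\<Sum>j\<in>UNIV. b $ j) = 0" by (simp add: inner_vec_def)
    moreover have "(\<Sum>j\<in>UNIV. b $ j) = (\<Sum>j\<in>(UNIV::'n set). b $ i)" for i
      by (intro sum.cong refl c)
    ultimately have "real CARD('n) * b $ i = 0" for i by simp
    then have "b = 0" by (simp add: vec_eq_iff)
    then show False using bb by simp
  qed
  then show "sing_k 2 W < 1" by (simp add: sing_k_def tW)
qed

lemma mpow_contraction:
  fixes W :: "real^'n^'n"
  assumes W: "sym_stochastic W" and n2: "CARD('n) \<ge> 2" and s: "0 \<le> sing_k 2 W" and z: "1 \<bullet> z = 0"
  shows "norm (mpow W t *v z) \<le> sing_k 2 W ^ t * norm z"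
proof (induction t)
  case (Suc t)
  have Pt: "sym_stochastic (mpow W t)" by (rule sym_stochastic_mpow[OF W])
  have "1 \<bullet> (mpow W t *v z) = 0"
    using symmetric_inner[OF sym_stochasticD(1)[OF Pt], of 1 z] stochastic_one[OF Pt] z by simp
  then have "norm (W *v (mpow W t *v z)) \<le> sing_k 2 W * norm (mpow W t *v z)"
    by (rule sing2_contraction[OF W n2])
  also have "\<dots> \<le> sing_k 2 W * (sing_k 2 W ^ t * norm z)"
    using Suc s by (rule mult_left_mono)
  finally show ?case by (simp add: matrix_vector_mul_assoc mult.assoc)
qed simp

text \<open>Row \<open>i\<close> minus the uniform row is the power of \<open>W\<close> applied to a
  unit coordinate vector minus its mean, which is centred and of norm at most 1. Passing from the
  Euclidean norm to the sum of absolute values costs the square root of the number of agents; this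
  is why that root appears in the lower bound on \<open>t\<close>.\<close>

lemma mpow_row_deviation:
  fixes W :: "real^'n^'n"
  assumes W: "sym_stochastic W" and n2: "CARD('n) \<ge> 2" and s: "0 \<le> sing_k 2 W"
  shows "(\<Sum>j\<in>UNIV. \<bar>mpow W t $ i $ j - 1 / real CARD('n)\<bar>) \<le> sqrt (real CARD('n)) * sing_k 2 W ^ t"
proof -
  let ?P = "mpow W t" and ?n = "real CARD('n)"
  have Pt: "sym_stochastic ?P" by (rule sym_stochastic_mpow[OF W])
  define z :: "real^'n" where "z = axis i 1 - (1 / ?n) *\<^sub>R 1"
  have z: "1 \<bullet> z = 0"
    by (simp add: z_def inner_diff_right inner_axis) (simp add: inner_vec_def)
  have "z \<bullet> z = axis i 1 \<bullet> z"
    using z by (simp add: z_def inner_diff_left)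
  also have "\<dots> \<le> 1" by (simp add: z_def inner_axis' )
  finally have nz: "norm z \<le> 1" by (simp add: norm_eq_sqrt_inner)
  define y where "y = ?P *v z"
  have yc: "y $ j = ?P $ i $ j - 1 / ?n" for j
    using stochastic_one[OF Pt]
    by (simp add: y_def z_def matrix_vector_mult_diff_distrib matrix_vector_mult_scaleR
        matrix_vector_mult_basis column_def sym_stochasticD(2)[OF Pt, of j i])
  have "(\<Sum>j\<in>UNIV. \<bar>y $ j\<bar>)\<^sup>2 = (\<Sum>j\<in>UNIV. 1 * \<bar>y $ j\<bar>)\<^sup>2" by simp
  also have "\<dots> \<le> (\<Sum>j\<in>(UNIV::'n set). 1\<^sup>2) * (\<Sum>j\<in>UNIV. \<bar>y $ j\<bar>\<^sup>2)"
    by (rule Cauchy_Schwarz_ineq_sum)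
  also have "\<dots> = ?n * (norm y)\<^sup>2"
    unfolding power2_norm_eq_inner inner_vec_def by (simp add: power2_eq_square)
  also have "\<dots> = (sqrt ?n * norm y)\<^sup>2" by (simp add: power_mult_distrib)
  finally have "(\<Sum>j\<in>UNIV. \<bar>y $ j\<bar>) \<le> sqrt ?n * norm y"
    by (rule power2_le_imp_le) simp
  also have "norm y \<le> sing_k 2 W ^ t * 1"
    using mpow_contraction[OF W n2 s z, of t] nz s unfolding y_def
    by (meson mult_left_mono order_trans zero_le_power)
  finally show ?thesis by (simp add: yc)
qed

text \<open>For \<open>s = 0\<close> the bound comes from \<open>t \<ge> 1\<close> alone, because
  then the power vanishes. Otherwise \<open>ln s\<close> is negative and multiplying by it reverses
  the inequality.\<close>

lemma power_le_of_log_le: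
  fixes s c :: real
  assumes s: "0 \<le> s" "s < 1" and c: "0 < c" "c < 1" and t: "t \<ge> 1" "real t \<ge> of_int \<lceil>log s c\<rceil>"
  shows "s ^ t \<le> c"
proof (cases "s = 0")
  case False
  then have s0: "0 < s" using s by simp
  have "log s c \<le> real t" using t(2) by linarith
  then have "ln c / ln s \<le> real t" by (simp add: log_def)
  moreover have "ln s < 0" using s0 s by simp
  ultimately have "real t * ln s \<le> ln c" by (simp add: divide_simps mult.commute split: if_splits)
  then have "ln (s ^ t) \<le> ln c" using s0 by (simp add: ln_realpow)
  then show ?thesis using s0 c by simp
qed (use c t in \<open>simp add: power_0_left\<close>)

section \<open>Geometry of the Stiefel manifold\<close>

lemma transpose_add: "transpose (A + B) = transpose A + transpose B"
  by (simp add: transpose_def vec_eq_iff)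

lemma transpose_diff: "transpose (A - B) = transpose A - transpose B"
  by (simp add: transpose_def vec_eq_iff)

lemma transpose_sum: "transpose (\<Sum>i\<in>I. f i) = (\<Sum>i\<in>I. transpose (f i))"
  by (simp add: transpose_def vec_eq_iff)

lemma matrix_mult_scaleR_left: "(c *\<^sub>R A) ** B = c *\<^sub>R (A ** (B :: real^'n^'m))"
  by (simp add: matrix_matrix_mult_def vec_eq_iff sum_distrib_left mult.assoc)

lemma matrix_mult_scaleR_right: "A ** (c *\<^sub>R B) = c *\<^sub>R (A ** (B :: real^'n^'m))"
  by (simp add: matrix_matrix_mult_def vec_eq_iff sum_distrib_left mult.left_commute)

lemma matrix_mult_sum_right: "A ** (\<Sum>i\<in>I. f i) = (\<Sum>i\<in>I. A ** (f i :: real^'n^'m))"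
  by (simp add: matrix_matrix_mult_def vec_eq_iff sum_distrib_left, subst sum.swap, simp)

lemma matrix_add_right_distrib: "(A + B) ** C = A ** C + B ** (C :: 'a::semiring_1^'n^'m)"
  by (simp add: matrix_matrix_mult_def vec_eq_iff sum.distrib algebra_simps)

lemma inner_matrix_mult_left:
  fixes A :: "real^'m^'d" and B :: "real^'r^'m"
  shows "(A ** B) \<bullet> C = B \<bullet> (transpose A ** C)"
proof -
  have "(A ** B) \<bullet> C = (\<Sum>i\<in>UNIV. \<Sum>j\<in>UNIV. \<Sum>k\<in>UNIV. A $ i $ k * B $ k $ j * C $ i $ j)"
    by (simp add: inner_vec_def matrix_matrix_mult_def sum_distrib_right)
  also have "\<dots> = (\<Sum>i\<in>UNIV. \<Sum>k\<in>UNIV. \<Sum>j\<in>UNIV. A $ i $ k * B $ k $ j * C $ i $ j)"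
    by (intro sum.cong refl sum.swap)
  also have "\<dots> = (\<Sum>k\<in>UNIV. \<Sum>i\<in>UNIV. \<Sum>j\<in>UNIV. A $ i $ k * B $ k $ j * C $ i $ j)"
    by (rule sum.swap)
  also have "\<dots> = (\<Sum>k\<in>UNIV. \<Sum>j\<in>UNIV. \<Sum>i\<in>UNIV. A $ i $ k * B $ k $ j * C $ i $ j)"
    by (intro sum.cong refl sum.swap)
  also have "\<dots> = B \<bullet> (transpose A ** C)"
    by (simp add: inner_vec_def matrix_matrix_mult_def transpose_def sum_distrib_left mult.assoc mult.left_commute)
  finally show ?thesis .
qed

lemma inner_transpose: "transpose A \<bullet> transpose B = A \<bullet> (B :: real^'m^'d)"
  unfolding inner_vec_def transpose_def by simp (rule sum.swap)

lemma norm_transpose: "norm (transpose A) = norm (A :: real^'m^'d)"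
  by (simp add: norm_eq_sqrt_inner inner_transpose)

lemma inner_matrix_mult_right:
  fixes A :: "real^'m^'d" and B :: "real^'r^'m"
  shows "(A ** B) \<bullet> C = A \<bullet> (C ** transpose B)"
proof -
  have "(A ** B) \<bullet> C = (transpose B ** transpose A) \<bullet> transpose C"
    unfolding matrix_transpose_mul[symmetric] by (rule inner_transpose[symmetric])
  also have "\<dots> = transpose A \<bullet> transpose (C ** transpose B)"
    by (simp only: inner_matrix_mult_left matrix_transpose_mul transpose_transpose)
  finally show ?thesis by (simp add: inner_transpose)
qed

text \<open>Each row of the product is \<open>transpose B\<close> applied to a row of
  \<open>A\<close>, so Cauchy-Schwarz row by row suffices.\<close>

lemma norm_matrix_mult_le:
  fixes A :: "real^'m^'d" and B :: "real^'r^'m"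
  shows "norm (A ** B) \<le> norm A * norm B"
proof -
  have nn: "(norm M)\<^sup>2 = (\<Sum>i\<in>UNIV. (norm (M $ i))\<^sup>2)" for M :: "real^'x^'y"
    unfolding power2_norm_eq_inner by (simp add: inner_vec_def)
  have c: "(norm (transpose B *v v))\<^sup>2 \<le> (norm v)\<^sup>2 * (norm B)\<^sup>2" for v :: "real^'m"
  proof -
    have "(norm (transpose B *v v))\<^sup>2 = (\<Sum>j\<in>UNIV. (transpose B $ j \<bullet> v)\<^sup>2)"
      unfolding power2_norm_eq_inner
      by (simp only: inner_vec_def matrix_vector_mul_component) (simp add: power2_eq_square inner_vec_def)
    also have "\<dots> \<le> (\<Sum>j\<in>UNIV. (norm (transpose B $ j))\<^sup>2 * (norm v)\<^sup>2)"
      by (intro sum_mono) (metis Cauchy_Schwarz_ineq power2_norm_eq_inner)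
    also have "\<dots> = (norm v)\<^sup>2 * (norm B)\<^sup>2"
      unfolding sum_distrib_right[symmetric] nn[of "transpose B", symmetric] norm_transpose
      by (rule mult.commute)
    finally show ?thesis .
  qed
  have r: "(A ** B) $ i = transpose B *v (A $ i)" for i
    by (simp only: vec_eq_iff)
       (simp add: matrix_matrix_mult_def matrix_vector_mult_def vector_matrix_mult_def transpose_def mult.commute)
  have "(norm (A ** B))\<^sup>2 \<le> (\<Sum>i\<in>UNIV. (norm (A $ i))\<^sup>2 * (norm B)\<^sup>2)"
    unfolding nn[of "A ** B"] r by (intro sum_mono c)
  also have "\<dots> = (norm A * norm B)\<^sup>2"
    by (simp add: sum_distrib_right[symmetric] nn[of A] power_mult_distrib)
  finally show ?thesis by (rule power2_le_imp_le) simp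
qed

section \<open>Square roots of symmetric matrices\<close>

lemma matrix_eq_on_basis:
  fixes M N :: "real^'n^'m"
  assumes "span B = UNIV" "\<And>b. b \<in> B \<Longrightarrow> M *v b = N *v b"
  shows "M = N"
proof -
  have "M *v v = N *v v" for v
    by (rule linear_eq_on_span[of "(*v) M" "(*v) N" B]) (use assms in auto)
  then show ?thesis by (simp add: matrix_eq)
qed

lemma symmetric_eigenbasis:
  fixes A :: "real^'n^'n"
  assumes "transpose A = A"
  obtains B where "orthonormal B" "span B = UNIV" "\<And>b. b \<in> B \<Longrightarrow> A *v b = (b \<bullet> (A *v b)) *\<^sub>R b"
  using selfadjoint_eigenbasis[of "(*v) A" UNIV] symmetric_inner[OF assms] by auto

text \<open>A small functional calculus: eigenvalues may be prescribed freely on an orthonormal set.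
  It provides the square root and the inverse square root of a matrix on one common
  eigenbasis.\<close>

lemma matrix_with_eigenbasis:
  fixes B :: "(real^'n) set"
  assumes on: "orthonormal B"
  obtains T :: "real^'n^'n" where "transpose T = T" "\<And>b. b \<in> B \<Longrightarrow> T *v b = g b *\<^sub>R b"
    "\<And>v. v \<bullet> (T *v v) = (\<Sum>b\<in>B. g b * (v \<bullet> b)\<^sup>2)"
proof -
  define h where "h v = (\<Sum>b\<in>B. (g b * (v \<bullet> b)) *\<^sub>R b)" for v
  have lin: "linear h"
    unfolding h_def
    by (intro linearI)
       (simp_all add: inner_add_left algebra_simps sum.distrib scaleR_sum_right)
  have Th: "matrix h *v v = h v" for v by (simp add: matrix_works lin)
  have "h u \<bullet> v = u \<bullet> h v" for u v
    by (simp add: h_def inner_sum_left inner_sum_right inner_commute mult_ac)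
  then have "adjoint h = h" by (intro adjoint_unique) auto
  then have "transpose (matrix h) = matrix h" using matrix_adjoint[OF lin] by simp
  moreover have "matrix h *v b = g b *\<^sub>R b" if "b \<in> B" for b
  proof -
    have "(g c * (b \<bullet> c)) *\<^sub>R c = (if c = b then g b *\<^sub>R b else 0)" if "c \<in> B" for c
      using on \<open>b \<in> B\<close> that
      by (auto simp: orthonormal_def pairwise_def orthogonal_def dot_square_norm)
    then have "h b = (\<Sum>c\<in>B. if c = b then g b *\<^sub>R b else 0)"
      unfolding h_def by (intro sum.cong refl) auto
    then show ?thesis using that orthonormal_finite[OF on] by (simp add: Th)
  qed
  moreover have "v \<bullet> (matrix h *v v) = (\<Sum>b\<in>B. g b * (v \<bullet> b)\<^sup>2)" for v
    by (simp add: Th h_def inner_sum_right power2_eq_square mult.assoc)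
  ultimately show ?thesis by (rule that)
qed

text \<open>For \<open>D = S - T\<close> equality of the squares says
  \<open>S ** D + D ** T = 0\<close>. Tested on an eigenvector \<open>b\<close> of \<open>D\<close>,
  this is the eigenvalue times \<open>b \<bullet> (S *v b) + b \<bullet> (T *v b) > 0\<close>, so
  every eigenvalue of \<open>D\<close> is zero. Uniqueness is what gives the description operator in
  \<open>inv_sqrtm\<close> a value.\<close>

lemma sym_pos_def_sqrt_unique:
  fixes S T :: "real^'n^'n"
  assumes S: "sym_pos_def S" and T: "sym_pos_def T" and eq: "S ** S = T ** T"
  shows "S = T"
proof -
  define D where "D = S - T"
  have st: "transpose S = S" "transpose T = T" using S T by (auto simp: sym_pos_def_def)
  then have sD: "transpose D = D" by (simp add: D_def transpose_diff)
  obtain B where on: "orthonormal B" and sp: "span B = UNIV"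
    and ev: "\<And>b. b \<in> B \<Longrightarrow> D *v b = (b \<bullet> (D *v b)) *\<^sub>R b"
    using symmetric_eigenbasis[OF sD] by metis
  have z: "S ** D + D ** T = 0"
    by (simp add: D_def matrix_diff_left_distrib matrix_diff_right_distrib eq)
  have "D = 0"
  proof (rule matrix_eq_on_basis[OF sp])
    fix b assume b: "b \<in> B"
    define c where "c = b \<bullet> (D *v b)"
    have Db: "D *v b = c *\<^sub>R b" using ev[OF b] c_def by simp
    have b0: "b \<noteq> 0" using on b by (auto simp: orthonormal_def)
    have "0 = b \<bullet> ((S ** D + D ** T) *v b)" by (simp add: z)
    also have "\<dots> = b \<bullet> (S *v (D *v b)) + (D *v b) \<bullet> (T *v b)"
      by (simp add: matrix_vector_mult_add_rdistrib inner_add_right matrix_vector_mul_assoc[symmetric]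
          symmetric_inner[OF sD])
    also have "\<dots> = c * (b \<bullet> (S *v b) + b \<bullet> (T *v b))"
      by (simp add: Db matrix_vector_mult_scaleR algebra_simps)
    finally have "c = 0" using S T b0 unfolding sym_pos_def_def
      by (metis add_pos_pos less_irrefl mult_eq_0_iff)
    then show "D *v b = 0 *v b" by (simp add: Db)
  qed
  then show ?thesis by (simp add: D_def)
qed

text \<open>The abstract inverse root is traded for its inverse \<open>T\<close>, a root of
  \<open>A\<close>. The eigenvalues of \<open>A\<close> are at least 1, hence so are those of
  \<open>T\<close>; the resulting positivity of \<open>T\<close> minus the identity keeps the polar
  retraction from increasing distances.\<close>

lemma inv_sqrtm_root:
  fixes A :: "real^'n^'n"
  assumes sA: "transpose A = A" and ge: "\<And>v. v \<bullet> v \<le> v \<bullet> (A *v v)"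
  obtains T where "transpose T = T" "T ** T = A" "\<And>v. v \<bullet> v \<le> v \<bullet> (T *v v)"
    "T ** inv_sqrtm A = mat 1" "inv_sqrtm A ** T = mat 1" "transpose (inv_sqrtm A) = inv_sqrtm A"
proof -
  obtain B where on: "orthonormal B" and sp: "span B = UNIV"
    and ev: "\<And>b. b \<in> B \<Longrightarrow> A *v b = (b \<bullet> (A *v b)) *\<^sub>R b"
    using symmetric_eigenbasis[OF sA] by metis
  define l where "l b = b \<bullet> (A *v b)" for b
  have l1: "1 \<le> l b" if "b \<in> B" for b
    using ge[of b] on that by (simp add: l_def orthonormal_def dot_square_norm)
  have vv: "v \<bullet> v = (\<Sum>b\<in>B. (v \<bullet> b)\<^sup>2)" for v
    using orthonormal_inner[OF on, of v v] sp by (simp add: power2_eq_square)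
  obtain T :: "real^'n^'n" where T: "transpose T = T" "\<And>b. b \<in> B \<Longrightarrow> T *v b = sqrt (l b) *\<^sub>R b"
      "\<And>v. v \<bullet> (T *v v) = (\<Sum>b\<in>B. sqrt (l b) * (v \<bullet> b)\<^sup>2)"
    using matrix_with_eigenbasis[OF on, where g="\<lambda>b. sqrt (l b)"] by blast
  obtain S :: "real^'n^'n" where S: "transpose S = S" "\<And>b. b \<in> B \<Longrightarrow> S *v b = (1 / sqrt (l b)) *\<^sub>R b"
      "\<And>v. v \<bullet> (S *v v) = (\<Sum>b\<in>B. (1 / sqrt (l b)) * (v \<bullet> b)\<^sup>2)"
    using matrix_with_eigenbasis[OF on, where g="\<lambda>b. 1 / sqrt (l b)"] by blast
  have TT: "T ** T = A"
  proof (rule matrix_eq_on_basis[OF sp])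
    fix b assume b: "b \<in> B"
    show "(T ** T) *v b = A *v b"
      using l1[OF b] ev[OF b]
      by (simp add: matrix_vector_mul_assoc[symmetric] T(2)[OF b] matrix_vector_mult_scaleR l_def)
  qed
  have TS: "T ** S = mat 1"
  proof (rule matrix_eq_on_basis[OF sp])
    fix b assume b: "b \<in> B"
    show "(T ** S) *v b = mat 1 *v b"
      using l1[OF b]
      by (simp add: matrix_vector_mul_assoc[symmetric] T(2)[OF b] S(2)[OF b] matrix_vector_mult_scaleR)
  qed
  then have ST: "S ** T = mat 1" by (simp add: matrix_left_right_inverse)
  have "v \<bullet> v \<le> v \<bullet> (T *v v)" for v
    unfolding vv T(3)
  proof (rule sum_mono)
    fix b assume "b \<in> B"
    then have "1 \<le> sqrt (l b)" using l1 by simp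
    then show "(v \<bullet> b)\<^sup>2 \<le> sqrt (l b) * (v \<bullet> b)\<^sup>2"
      using mult_right_mono[of 1 "sqrt (l b)" "(v \<bullet> b)\<^sup>2"] by simp
  qed
  note T1 = this
  have pS: "sym_pos_def S"
    unfolding sym_pos_def_def
  proof (intro conjI S(1) allI impI)
    fix v :: "real^'n" assume "v \<noteq> 0"
    have nn: "0 \<le> 1 / sqrt (l b) * (v \<bullet> b)\<^sup>2" if "b \<in> B" for b using l1[OF that] by simp
    have "v \<bullet> (S *v v) \<noteq> 0"
    proof
      assume "v \<bullet> (S *v v) = 0"
      then have "\<forall>b\<in>B. 1 / sqrt (l b) * (v \<bullet> b)\<^sup>2 = 0"
        unfolding S(3) using nn orthonormal_finite[OF on] by (subst (asm) sum_nonneg_eq_0_iff) auto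
      then have "\<forall>b\<in>B. (v \<bullet> b)\<^sup>2 = 0" using l1 by fastforce
      then have "v \<bullet> v = 0" unfolding vv by simp
      then show False using \<open>v \<noteq> 0\<close> by simp
    qed
    moreover have "0 \<le> v \<bullet> (S *v v)" unfolding S(3) by (intro sum_nonneg nn)
    ultimately show "v \<bullet> (S *v v) > 0" by simp
  qed
  have "(S ** S) ** A = mat 1"
    by (metis ST TT matrix_mul_assoc matrix_mul_lid)
  then have "A ** (S ** S) = mat 1" by (simp add: matrix_left_right_inverse)
  then have iA: "matrix_inv A = S ** S"
    unfolding matrix_inv_def
    by (intro some_equality) (metis \<open>(S ** S) ** A = mat 1\<close> matrix_mul_assoc matrix_mul_lid matrix_mul_rid)+
  have "inv_sqrtm A = S"
    unfolding inv_sqrtm_def iA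
    by (rule the_equality) (auto simp: pS intro: sym_pos_def_sqrt_unique[OF _ pS])
  then show ?thesis using that[OF T(1) TT T1] TS ST S(1) by simp
qed

section \<open>Gram matrices and tangent projections\<close>

lemma norm_add_sq:
  fixes u v :: "'a::real_inner"
  shows "(norm (u + v))\<^sup>2 = (norm u)\<^sup>2 + (norm v)\<^sup>2 + 2 * (u \<bullet> v)"
  unfolding power2_norm_eq_inner by (simp add: inner_add_left inner_add_right inner_commute)

abbreviation gram :: "real^'r^'d \<Rightarrow> real^'r^'r" where
  "gram A \<equiv> transpose A ** A"

lemma norm_gram_le: "norm (gram A) \<le> (norm A)\<^sup>2"
  using norm_matrix_mult_le[of "transpose A" A] by (simp add: norm_transpose power2_eq_square)

text \<open>This turns the curvature contribution to the consensus inner product into a weighted sum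
  of squares.\<close>

lemma inner_gram_gram: "gram A \<bullet> gram B = (norm (A ** transpose B))\<^sup>2"
proof -
  have "gram A \<bullet> gram B = A \<bullet> (A ** gram B)"
    by (simp only: inner_matrix_mult_left[of "transpose A"] transpose_transpose)
  also have "\<dots> = (A ** transpose B) \<bullet> (A ** transpose B)"
    by (simp only: inner_matrix_mult_right[of A "transpose B"] transpose_transpose matrix_mul_assoc)
  finally show ?thesis by (simp only: power2_norm_eq_inner)
qed

lemma inner_mat_1_gram: "mat 1 \<bullet> gram A = (norm A)\<^sup>2"
  unfolding power2_norm_eq_inner
  by (subst inner_commute) (simp add: inner_matrix_mult_left)

lemma stiefelD: "x \<in> stiefel \<Longrightarrow> transpose x ** x = mat 1"
  by (simp add: stiefel_def)

lemma stiefel_inner: "x \<in> stiefel \<Longrightarrow> (x ** A) \<bullet> (x ** B) = A \<bullet> B"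
  by (simp add: inner_matrix_mult_left matrix_mul_assoc stiefelD)

lemma stiefel_norm_mult: "x \<in> stiefel \<Longrightarrow> norm (x ** A) = norm A"
  by (simp add: norm_eq_sqrt_inner stiefel_inner)

lemma stiefel_norm_eq:
  fixes x y :: "real^'r^'d"
  shows "x \<in> stiefel \<Longrightarrow> y \<in> stiefel \<Longrightarrow> norm x = norm y"
  using stiefel_norm_mult[of x "mat 1 :: real^'r^'r"] stiefel_norm_mult[of y "mat 1 :: real^'r^'r"] by simp

text \<open>Multiplying by the transpose of a Stiefel point preserves the norm. The constant 2 holds
  however far apart the points are and for any dimensions, so it serves for the minimizer, whose
  distance to the agents is not assumed small.\<close>

lemma norm_mult_transpose_diff_stiefel:
  assumes "x \<in> stiefel" "y \<in> stiefel"
  shows "norm (A ** transpose (x - y)) \<le> 2 * norm A"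
proof -
  have e: "norm (A ** transpose z) = norm A" if "z \<in> stiefel" for z
    using stiefel_norm_mult[OF that, of "transpose A"]
    by (metis matrix_transpose_mul norm_transpose transpose_transpose)
  have "norm (A ** transpose (x - y)) = norm (A ** transpose x - A ** transpose y)"
    by (simp add: transpose_diff matrix_diff_right_distrib)
  also have "\<dots> \<le> norm A + norm A"
    by (metis e assms norm_triangle_ineq4)
  finally show ?thesis by simp
qed

lemma gram_diff_stiefel:
  assumes "x \<in> stiefel" "y \<in> stiefel"
  shows "gram (x - y) = 2 *\<^sub>R mat 1 - (transpose y ** x + transpose x ** y)"
  using stiefelD[OF assms(1)] stiefelD[OF assms(2)]
  by (simp add: transpose_diff matrix_diff_left_distrib matrix_diff_right_distrib scaleR_2)

text \<open>The part of \<open>y - x\<close> that the projection removes is half of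
  \<open>x ** gram (x - y)\<close> up to sign, hence quadratic in the distance. Every second-order
  curvature bound below starts from this identity.\<close>

lemma proj_tangent_stiefel:
  assumes "x \<in> stiefel" "y \<in> stiefel"
  shows "proj_tangent x y = y - x + (1/2) *\<^sub>R (x ** gram (x - y))"
  unfolding gram_diff_stiefel[OF assms] proj_tangent_def
  by (simp add: matrix_diff_right_distrib matrix_mult_scaleR_right scaleR_diff_right)

lemma linear_proj_tangent: "linear (proj_tangent x)"
  by (intro linearI)
     (simp_all add: proj_tangent_def transpose_add transpose_scalar matrix_add_ldistrib matrix_add_right_distrib
       matrix_mult_scaleR_left matrix_mult_scaleR_right algebra_simps)

lemma proj_tangent_tangent: "\<xi> \<in> tangent_space x \<Longrightarrow> proj_tangent x \<xi> = \<xi>"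
  by (simp add: proj_tangent_def tangent_space_def add.commute)

lemma proj_tangent_in:
  assumes "x \<in> stiefel" shows "proj_tangent x y \<in> tangent_space x"
proof -
  define S where "S = transpose y ** x + transpose x ** y"
  have p: "proj_tangent x y = y - (1/2) *\<^sub>R (x ** S)" by (simp add: proj_tangent_def S_def)
  have S: "transpose S = S" by (simp add: S_def transpose_add matrix_transpose_mul add.commute)
  have 1: "transpose x ** proj_tangent x y = transpose x ** y - (1/2) *\<^sub>R S"
    by (simp add: p matrix_diff_right_distrib matrix_mult_scaleR_right matrix_mul_assoc stiefelD[OF assms])
  have "transpose (proj_tangent x y) ** x = transpose (transpose x ** proj_tangent x y)"
    by (simp add: matrix_transpose_mul)
  also have "\<dots> = transpose y ** x - (1/2) *\<^sub>R S"
    unfolding 1 by (simp add: transpose_diff transpose_scalar matrix_transpose_mul S)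
  finally have "transpose x ** proj_tangent x y + transpose (proj_tangent x y) ** x
      = (transpose x ** y + transpose y ** x) - ((1/2) *\<^sub>R S + (1/2) *\<^sub>R S)"
    unfolding 1 by simp
  also have "\<dots> = 0" by (simp add: S_def add.commute scaleR_add_left[symmetric])
  finally show ?thesis by (simp add: tangent_space_def)
qed

lemma proj_tangent_selfadjoint: "proj_tangent x y \<bullet> z = y \<bullet> proj_tangent x z"
proof -
  have "(x ** (transpose y ** x + transpose x ** y)) \<bullet> z =
      (transpose y ** x) \<bullet> (transpose x ** z) + (transpose x ** y) \<bullet> (transpose x ** z)"
    by (simp add: inner_matrix_mult_left[of x] inner_add_left)
  also have "(transpose y ** x) \<bullet> (transpose x ** z) = (transpose z ** x) \<bullet> (transpose x ** y)"
    using inner_transpose[of "transpose y ** x" "transpose x ** z"]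
    by (simp only: matrix_transpose_mul transpose_transpose inner_commute)
  also have "(transpose x ** y) \<bullet> (transpose x ** z) = (transpose x ** z) \<bullet> (transpose x ** y)"
    by (rule inner_commute)
  also have "(transpose z ** x) \<bullet> (transpose x ** y) + \<dots> =
      (x ** (transpose z ** x + transpose x ** z)) \<bullet> y"
    by (simp only: inner_matrix_mult_left[of x] inner_add_left)
  finally show ?thesis
    by (simp add: proj_tangent_def inner_diff_left inner_diff_right inner_commute)
qed

lemma norm_proj_tangent_le:
  assumes "x \<in> stiefel" shows "norm (proj_tangent x y) \<le> norm y"
proof -
  have "norm (proj_tangent x y) * norm (proj_tangent x y) = y \<bullet> proj_tangent x y"
    by (metis assms dot_square_norm power2_eq_square proj_tangent_in proj_tangent_selfadjoint proj_tangent_tangent)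
  also have "\<dots> \<le> norm y * norm (proj_tangent x y)" by (rule norm_cauchy_schwarz)
  finally show ?thesis by (cases "norm (proj_tangent x y) = 0") auto
qed

lemma proj_tangent_self: "x \<in> stiefel \<Longrightarrow> proj_tangent x x = 0"
  using proj_tangent_stiefel[of x x] by (simp add: transpose_def)

lemma subspace_tangent: "subspace (tangent_space x)"
proof -
  show ?thesis
    unfolding subspace_def tangent_space_def
    by (auto simp: transpose_add transpose_scalar matrix_add_ldistrib matrix_add_right_distrib
       matrix_mult_scaleR_left matrix_mult_scaleR_right algebra_simps scaleR_add_right[symmetric]
       simp del: scaleR_add_right)
       (simp_all add: transpose_def matrix_matrix_mult_def vec_eq_iff)
qed

text \<open>A symmetric \<open>G\<close> sees only the symmetric part of
  \<open>transpose p ** (p - q)\<close>, which is half of \<open>gram (p - q)\<close>. An inner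
  product that looks linear in \<open>p - q\<close> is therefore quadratic.\<close>

lemma stiefel_inner_sym:
  assumes p: "p \<in> stiefel" and q: "q \<in> stiefel" and G: "transpose G = G"
  shows "(p ** G) \<bullet> (p - q) = (1/2) * (G \<bullet> gram (p - q))"
proof -
  have "G \<bullet> (transpose q ** p) = G \<bullet> (transpose p ** q)"
    by (metis G inner_transpose matrix_transpose_mul transpose_transpose)
  then show ?thesis
    unfolding gram_diff_stiefel[OF p q]
    by (simp add: inner_matrix_mult_left matrix_diff_right_distrib stiefelD[OF p]
        inner_diff_right inner_add_right)
qed

text \<open>With \<open>z\<close> the retracted point, \<open>x + \<xi> = z T\<close> and \<open>K = T - I\<close> positive semidefinite,
  \<open>|x + \<xi> - y|\<^sup>2 - |z - y|\<^sup>2 = |K|\<^sup>2 + \<langle>K, (z - y)\<^sup>T (z - y)\<rangle>\<close>.\<close>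

lemma polar_retr_stiefel:
  fixes x :: "real^'r^'d"
  assumes x: "x \<in> stiefel" and xi: "\<xi> \<in> tangent_space x"
  shows "polar_retr x \<xi> \<in> stiefel"
    and "y \<in> stiefel \<Longrightarrow> norm (polar_retr x \<xi> - y) \<le> norm (x + \<xi> - y)"
proof -
  define A where "A = mat 1 + gram \<xi>"
  have sA: "transpose A = A" by (simp add: A_def transpose_add matrix_transpose_mul)
  have ge: "v \<bullet> v \<le> v \<bullet> (A *v v)" for v
  proof -
    have "v \<bullet> (gram \<xi> *v v) = (\<xi> *v v) \<bullet> (\<xi> *v v)"
      by (metis dot_lmul_matrix inner_commute matrix_vector_mul_assoc transpose_matrix_vector)
    then show ?thesis by (simp add: A_def matrix_vector_mult_add_rdistrib inner_add_right)
  qed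
  obtain T where T: "transpose T = T" "T ** T = A" "\<And>v. v \<bullet> v \<le> v \<bullet> (T *v v)"
    and TS: "T ** inv_sqrtm A = mat 1" "inv_sqrtm A ** T = mat 1" "transpose (inv_sqrtm A) = inv_sqrtm A"
    using inv_sqrtm_root[OF sA ge] by metis
  define S where "S = inv_sqrtm A"
  define z where "z = polar_retr x \<xi>"
  have z: "z = (x + \<xi>) ** S" by (simp add: z_def polar_retr_def S_def A_def)
  \<comment> \<open>Tangency cancels the two mixed products, so the matrix whose root is taken is
    the Gram matrix of \<open>x + \<xi>\<close>; this makes the retraction its polar factor.\<close>
  have g: "gram (x + \<xi>) = A"
    using xi stiefelD[OF x] by (simp add: A_def tangent_space_def transpose_add matrix_add_ldistrib
        matrix_add_right_distrib add_ac)
  have "transpose z ** z = S ** gram (x + \<xi>) ** S"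
    using TS(3) by (simp add: z S_def matrix_transpose_mul matrix_mul_assoc)
  also have "\<dots> = (S ** T) ** (T ** S)" by (simp only: g T(2)[symmetric] matrix_mul_assoc)
  finally have zS: "z \<in> stiefel" using TS by (simp add: S_def stiefel_def)
  then show "polar_retr x \<xi> \<in> stiefel" by (simp add: z_def)
  have zT: "x + \<xi> = z ** T"
    using TS(2) by (simp add: z S_def matrix_mul_assoc[symmetric])
  assume y: "y \<in> stiefel"
  define K where "K = T - mat 1"
  have sK: "transpose K = K" by (simp add: K_def transpose_diff T(1))
  have "K \<bullet> gram (z - y) = ((z - y) ** K) \<bullet> (z - y)"
    by (rule inner_matrix_mult_left[symmetric])
  also have "\<dots> = (\<Sum>i\<in>UNIV. ((z - y) $ i) \<bullet> (K *v ((z - y) $ i)))"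
  proof -
    have "((z - y) ** K) $ i = K *v ((z - y) $ i)" for i
      by (subst (2) sK[symmetric])
         (simp add: matrix_matrix_mult_def matrix_vector_mult_def vector_matrix_mult_def vec_eq_iff transpose_def mult.commute)
    then show ?thesis
      by (simp only: inner_vec_def[of "(z - y) ** K"]) (simp only: inner_commute)
  qed
  also have "\<dots> \<ge> 0"
  proof (rule sum_nonneg)
    fix i
    show "0 \<le> (z - y) $ i \<bullet> (K *v ((z - y) $ i))"
      using T(3)[of "(z - y) $ i"] unfolding K_def matrix_vector_mult_diff_rdistrib inner_diff_right[of _ "_ *v _"]
      by simp
  qed
  finally have pos: "0 \<le> K \<bullet> gram (z - y)" .
  have "x + \<xi> - y = z ** K + (z - y)"
    by (simp add: zT K_def matrix_diff_right_distrib)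
  then have "(norm (x + \<xi> - y))\<^sup>2 = (norm (z ** K))\<^sup>2 + (norm (z - y))\<^sup>2 + 2 * ((z ** K) \<bullet> (z - y))"
    by (simp only: norm_add_sq)
  also have "(z ** K) \<bullet> (z - y) = (1/2) * (K \<bullet> gram (z - y))"
    by (rule stiefel_inner_sym[OF zS y sK])
  finally have "(norm (z - y))\<^sup>2 \<le> (norm (x + \<xi> - y))\<^sup>2" using pos by simp
  then show "norm (polar_retr x \<xi> - y) \<le> norm (x + \<xi> - y)"
    unfolding z_def[symmetric] by (rule power2_le_imp_le) simp
qed

section \<open>Nearest points on the manifold\<close>

lemma compact_stiefel: "compact (stiefel :: (real^'r^'d) set)"
proof (rule compact_eq_bounded_closed[THEN iffD2], rule conjI)
  have "norm x = norm (mat 1 :: real^'r^'r)" if "x \<in> stiefel" for x :: "real^'r^'d"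
    using stiefel_norm_mult[OF that, of "mat 1"] by simp
  then show "bounded (stiefel :: (real^'r^'d) set)" unfolding bounded_iff by (metis order_refl)
  have "continuous_on UNIV (\<lambda>x :: real^'r^'d. transpose x ** x)"
    unfolding transpose_def matrix_matrix_mult_def by (intro continuous_intros)
  then have "closed ((\<lambda>x :: real^'r^'d. transpose x ** x) -` {mat 1})"
    by (intro closed_vimage) auto
  then show "closed (stiefel :: (real^'r^'d) set)" by (simp add: stiefel_def vimage_def)
qed

lemma proj_stiefel_nearest:
  fixes y :: "real^'r^'d"
  assumes "z \<in> (stiefel :: (real^'r^'d) set)"
  shows "proj_stiefel y \<in> stiefel" "norm (y - proj_stiefel y) \<le> norm (y - z)"
proof -
  obtain p :: "real^'r^'d" where "p \<in> stiefel" "\<forall>z\<in>stiefel. dist y p \<le> dist y z"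
  proof (rule distance_attains_inf[of "stiefel :: (real^'r^'d) set" y])
    show "closed (stiefel :: (real^'r^'d) set)" by (rule compact_imp_closed[OF compact_stiefel])
  qed (use assms in auto)
  then have "\<exists>p. p \<in> stiefel \<and> (\<forall>z\<in>stiefel. norm (y - p) \<le> norm (y - z))"
    by (auto simp: dist_norm)
  then have "proj_stiefel y \<in> stiefel \<and> (\<forall>z\<in>stiefel. norm (y - proj_stiefel y) \<le> norm (y - z))"
    unfolding proj_stiefel_def by (rule someI_ex)
  then show "proj_stiefel y \<in> stiefel" "norm (y - proj_stiefel y) \<le> norm (y - z)"
    using assms by auto
qed

text \<open>All Stiefel points have the same norm, so being nearest to \<open>y\<close> means having
  the largest inner product with \<open>y\<close>, a linear criterion.\<close>

lemma norm_diff_le_of_inner_stiefel: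
  assumes "p \<in> stiefel" "z \<in> stiefel"
  shows "norm (y - p) \<le> norm (y - z) \<longleftrightarrow> y \<bullet> z \<le> y \<bullet> (p :: real^'r^'d)"
proof -
  have "norm (y - p) \<le> norm (y - z) \<longleftrightarrow> (norm (y - p))\<^sup>2 \<le> (norm (y - z))\<^sup>2"
    by (simp add: power_mono_iff)
  also have "\<dots> \<longleftrightarrow> y \<bullet> z \<le> y \<bullet> p"
    using stiefel_norm_eq[OF assms] unfolding power2_norm_eq_inner
    by (simp add: inner_diff_left inner_diff_right inner_commute norm_eq_sqrt_inner)
  finally show ?thesis .
qed

text \<open>First-order optimality of the nearest point, tested along the retraction curve
  \<open>s \<mapsto> polar_retr p (s \<xi>)\<close>.\<close>

lemma proj_tangent_proj_stiefel:
  fixes y z :: "real^'r^'d"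
  assumes ne: "z \<in> stiefel"
    and M: "\<forall>x\<in>(stiefel :: (real^'r^'d) set). \<forall>\<xi>\<in>tangent_space x. norm (polar_retr x \<xi> - (x + \<xi>)) \<le> M * (norm \<xi>)\<^sup>2"
  shows "proj_tangent (proj_stiefel y) y = 0"
proof -
  define p where "p = proj_stiefel y"
  define \<xi> where "\<xi> = proj_tangent p y"
  have p: "p \<in> stiefel" using proj_stiefel_nearest[OF ne] p_def by blast
  have xi: "\<xi> \<in> tangent_space p" unfolding \<xi>_def by (rule proj_tangent_in[OF p])
  \<comment> \<open>Along the curve the inner product with \<open>y\<close> changes by
    \<open>s * (y \<bullet> \<xi>)\<close> up to an error of order \<open>s\<^sup>2\<close>.
    Maximality at \<open>p\<close> for steps of both signs leaves no room for a linear term.\<close>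
  have "0 \<le> 2 * s * (- (y \<bullet> \<xi>) / 2) + s\<^sup>2 * (norm y * M * (norm \<xi>)\<^sup>2)" for s
  proof -
    have sx: "s *\<^sub>R \<xi> \<in> tangent_space p" using subspace_scale[OF subspace_tangent xi] .
    define w where "w = polar_retr p (s *\<^sub>R \<xi>)"
    have w: "w \<in> stiefel" unfolding w_def by (rule polar_retr_stiefel(1)[OF p sx])
    have "y \<bullet> w \<le> y \<bullet> p"
      using proj_stiefel_nearest(2)[OF w, of y] norm_diff_le_of_inner_stiefel[OF p w] p_def by simp
    moreover have "y \<bullet> w = y \<bullet> (w - (p + s *\<^sub>R \<xi>)) + y \<bullet> p + s * (y \<bullet> \<xi>)"
      by (simp add: inner_diff_right inner_add_right)
    moreover have "\<bar>y \<bullet> (w - (p + s *\<^sub>R \<xi>))\<bar> \<le> norm y * (M * (norm (s *\<^sub>R \<xi>))\<^sup>2)"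
    proof (rule order_trans[OF Cauchy_Schwarz_ineq2 mult_left_mono])
      show "norm (w - (p + s *\<^sub>R \<xi>)) \<le> M * (norm (s *\<^sub>R \<xi>))\<^sup>2"
        unfolding w_def using M p sx by blast
    qed simp
    ultimately have "s * (y \<bullet> \<xi>) \<le> norm y * (M * (norm (s *\<^sub>R \<xi>))\<^sup>2)" by linarith
    then show ?thesis by (simp add: power_mult_distrib algebra_simps)
  qed
  then have "- (y \<bullet> \<xi>) / 2 = 0" by (rule linear_term_zero)
  moreover have "\<xi> \<bullet> \<xi> = y \<bullet> \<xi>"
    using proj_tangent_selfadjoint[of p y \<xi>] proj_tangent_tangent[OF xi] by (simp add: \<xi>_def)
  ultimately have "\<xi> \<bullet> \<xi> = 0" by simp
  then show ?thesis by (simp add: \<xi>_def p_def)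
qed

section \<open>One step of the method\<close>

definition mean :: "('n::finite \<Rightarrow> 'a::real_vector) \<Rightarrow> 'a" where
  "mean x = (1 / real CARD('n)) *\<^sub>R (\<Sum>i\<in>UNIV. x i)"

definition disagreement :: "real^'n^'n \<Rightarrow> ('n \<Rightarrow> 'a::real_normed_vector) \<Rightarrow> real" where
  "disagreement P x = (\<Sum>i\<in>UNIV. \<Sum>j\<in>UNIV. P $ i $ j * (norm (x i - x j))\<^sup>2)"

text \<open>The negative Riemannian gradient of the consensus potential \<open>disagreement / 4\<close>.\<close>

definition consensus_dir :: "real^'n^'n \<Rightarrow> ('n \<Rightarrow> real^'r^'d) \<Rightarrow> 'n \<Rightarrow> real^'r^'d" where
  "consensus_dir P x i = proj_tangent (x i) (\<Sum>j\<in>UNIV. P $ i $ j *\<^sub>R x j)"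

lemma sum_mean_diff:
  fixes x :: "'n::finite \<Rightarrow> 'a::real_inner"
  shows "(\<Sum>i\<in>UNIV. (norm (x i - p))\<^sup>2) =
    (\<Sum>i\<in>UNIV. (norm (x i - mean x))\<^sup>2) + real CARD('n) * (norm (mean x - p))\<^sup>2"
proof -
  have s: "(\<Sum>i\<in>UNIV. x i) = real CARD('n) *\<^sub>R mean x" by (simp add: mean_def)
  have "(norm (x i - p))\<^sup>2 = (norm (x i - mean x))\<^sup>2 + (norm (mean x - p))\<^sup>2
      + 2 * ((x i - mean x) \<bullet> (mean x - p))" for i
    using norm_add_sq[of "x i - mean x" "mean x - p"] by simp
  then have "(\<Sum>i\<in>UNIV. (norm (x i - p))\<^sup>2) = (\<Sum>i\<in>UNIV. (norm (x i - mean x))\<^sup>2)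
      + real CARD('n) * (norm (mean x - p))\<^sup>2 + 2 * (((\<Sum>i\<in>UNIV. x i) - real CARD('n) *\<^sub>R mean x) \<bullet> (mean x - p))"
    by (simp add: sum.distrib sum_distrib_left[symmetric] inner_sum_left[symmetric] sum_subtractf sum_constant_scaleR)
  then show ?thesis by (simp add: s)
qed

lemma norm_mean_diff_le:
  fixes x :: "'n::finite \<Rightarrow> 'a::real_inner"
  shows "real CARD('n) * (norm (mean x - p))\<^sup>2 \<le> (\<Sum>i\<in>UNIV. (norm (x i - p))\<^sup>2)"
  unfolding sum_mean_diff[of x p] by (simp add: sum_nonneg)

text \<open>The averaged neighbour is in general off the manifold, but by linearity the projection
  acts on each neighbour separately, where \<open>proj_tangent_stiefel\<close> applies.\<close>

lemma consensus_dir_expand: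
  assumes P: "sym_stochastic P" and x: "\<And>i. x i \<in> stiefel"
  shows "consensus_dir P x i =
    (\<Sum>j\<in>UNIV. P $ i $ j *\<^sub>R x j) - x i + (1/2) *\<^sub>R (x i ** (\<Sum>j\<in>UNIV. P $ i $ j *\<^sub>R gram (x i - x j)))"
proof -
  have "consensus_dir P x i = (\<Sum>j\<in>UNIV. P $ i $ j *\<^sub>R proj_tangent (x i) (x j))"
    by (simp add: consensus_dir_def linear_sum[OF linear_proj_tangent] linear_scale[OF linear_proj_tangent])
  also have "\<dots> = (\<Sum>j\<in>UNIV. P $ i $ j *\<^sub>R x j - P $ i $ j *\<^sub>R x i + (1/2) *\<^sub>R (x i ** (P $ i $ j *\<^sub>R gram (x i - x j))))"
    using x by (simp add: proj_tangent_stiefel matrix_mult_scaleR_right algebra_simps)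
  also have "\<dots> = (\<Sum>j\<in>UNIV. P $ i $ j *\<^sub>R x j) - x i + (1/2) *\<^sub>R (x i ** (\<Sum>j\<in>UNIV. P $ i $ j *\<^sub>R gram (x i - x j)))"
    by (simp add: sum.distrib sum_subtractf scaleR_sum_left[symmetric] sym_stochasticD[OF P]
        scaleR_sum_right[symmetric] matrix_mult_sum_right)
  finally show ?thesis .
qed

text \<open>An exact identity for any target \<open>y\<close> on the manifold: the Euclidean part is
  a Dirichlet form independent of \<open>y\<close>, and curvature adds a nonnegative term.\<close>

lemma consensus_dir_inner:
  assumes P: "sym_stochastic P" and x: "\<And>i. x i \<in> stiefel" and y: "y \<in> stiefel"
  shows "(\<Sum>i\<in>UNIV. consensus_dir P x i \<bullet> (x i - y)) = - disagreement P x / 2 +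
    (1/4) * (\<Sum>i\<in>UNIV. \<Sum>j\<in>UNIV. P $ i $ j * (norm ((x i - x j) ** transpose (x i - y)))\<^sup>2)"
proof -
  have 1: "consensus_dir P x i \<bullet> (x i - y) = - ((x i - y) \<bullet> ((x i - y) - (\<Sum>j\<in>UNIV. P $ i $ j *\<^sub>R (x j - y))))
     + (1/4) * (\<Sum>j\<in>UNIV. P $ i $ j * (norm ((x i - x j) ** transpose (x i - y)))\<^sup>2)" for i
  proof -
    define G where "G = (\<Sum>j\<in>UNIV. P $ i $ j *\<^sub>R gram (x i - x j))"
    have G: "transpose G = G" by (simp add: G_def transpose_sum transpose_scalar matrix_transpose_mul)
    have e: "(\<Sum>j\<in>UNIV. P $ i $ j *\<^sub>R (x j - y)) = (\<Sum>j\<in>UNIV. P $ i $ j *\<^sub>R x j) - y"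
      by (simp add: scaleR_diff_right sum_subtractf scaleR_sum_left[symmetric] sym_stochasticD[OF P])
    have "(x i ** G) \<bullet> (x i - y) = (1/2) * (G \<bullet> gram (x i - y))"
      by (rule stiefel_inner_sym[OF x y G])
    also have "G \<bullet> gram (x i - y) = (\<Sum>j\<in>UNIV. P $ i $ j * (norm ((x i - x j) ** transpose (x i - y)))\<^sup>2)"
      by (simp only: G_def inner_sum_left inner_scaleR_left inner_gram_gram)
    finally have *: "(x i ** G) \<bullet> (x i - y) =
        (1/2) * (\<Sum>j\<in>UNIV. P $ i $ j * (norm ((x i - x j) ** transpose (x i - y)))\<^sup>2)" .
    have d: "(x i - y) - ((\<Sum>j\<in>UNIV. P $ i $ j *\<^sub>R x j) - y) = - ((\<Sum>j\<in>UNIV. P $ i $ j *\<^sub>R x j) - x i)"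
      by simp
    have "consensus_dir P x i \<bullet> (x i - y) = ((\<Sum>j\<in>UNIV. P $ i $ j *\<^sub>R x j) - x i) \<bullet> (x i - y)
        + (1/2) * ((x i ** G) \<bullet> (x i - y))"
      unfolding consensus_dir_expand[OF P x] G_def by (simp only: inner_add_left inner_scaleR_left)
    then show ?thesis
      unfolding e d * inner_minus_right by (simp add: inner_commute)
  qed
  have "(\<Sum>i\<in>UNIV. (x i - y) \<bullet> ((x i - y) - (\<Sum>j\<in>UNIV. P $ i $ j *\<^sub>R (x j - y)))) = disagreement P x / 2"
    using stochastic_dirichlet[OF P, of "\<lambda>i. x i - y"] by (simp add: disagreement_def)
  then show ?thesis
    unfolding 1 sum.distrib sum_distrib_left[symmetric] sum_negf by simp
qed

lemma disagreement_nonneg: "sym_stochastic P \<Longrightarrow> 0 \<le> disagreement P x"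
  unfolding disagreement_def by (intro sum_nonneg mult_nonneg_nonneg) (auto simp: sym_stochasticD)

text \<open>Used at two targets. Near the induced mean \<open>c = \<delta>2\<close>, which gives the
  restricted secant inequality; at a general point of the manifold \<open>c = 2\<close>, which
  leaves only an upper bound by half the disagreement.\<close>

lemma consensus_dir_inner_le:
  fixes x :: "'n::finite \<Rightarrow> real^'r^'d"
  assumes P: "sym_stochastic P" and x: "\<And>i. x i \<in> stiefel" and y: "y \<in> stiefel"
    and b: "\<And>i (A :: real^'r^'d). norm (A ** transpose (x i - y)) \<le> c * norm A"
  shows "(\<Sum>i\<in>UNIV. consensus_dir P x i \<bullet> (x i - y)) \<le> - (2 - c\<^sup>2) / 4 * disagreement P x"
proof -
  have "(\<Sum>i\<in>UNIV. \<Sum>j\<in>UNIV. P $ i $ j * (norm ((x i - x j) ** transpose (x i - y)))\<^sup>2)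
      \<le> (\<Sum>i\<in>UNIV. \<Sum>j\<in>UNIV. P $ i $ j * (c * norm (x i - x j))\<^sup>2)"
    using b by (intro sum_mono mult_left_mono power_mono) (auto simp: sym_stochasticD[OF P])
  also have "\<dots> = c\<^sup>2 * disagreement P x"
    by (simp add: disagreement_def power_mult_distrib sum_distrib_left mult.left_commute)
  finally show ?thesis unfolding consensus_dir_inner[OF P x y] by (simp add: algebra_simps)
qed

lemma norm_consensus_dir_le:
  assumes P: "sym_stochastic P" and x: "\<And>i. x i \<in> stiefel"
  shows "norm (consensus_dir P x i) \<le> norm (x i - (\<Sum>j\<in>UNIV. P $ i $ j *\<^sub>R x j))"
proof -
  have "consensus_dir P x i = proj_tangent (x i) ((\<Sum>j\<in>UNIV. P $ i $ j *\<^sub>R x j) - x i)"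
    using proj_tangent_self[OF x[of i]]
    by (simp add: consensus_dir_def linear_diff[OF linear_proj_tangent])
  then show ?thesis using norm_proj_tangent_le[OF x[of i]] by (metis norm_minus_commute)
qed

lemma norm_sum_gram_le:
  assumes P: "sym_stochastic P" and x: "x i \<in> stiefel"
  shows "norm (x i ** (\<Sum>j\<in>UNIV. P $ i $ j *\<^sub>R gram (x i - x j))) \<le> (\<Sum>j\<in>UNIV. P $ i $ j * (norm (x i - x j))\<^sup>2)"
  unfolding stiefel_norm_mult[OF x]
  by (rule order_trans[OF norm_sum])
     (auto simp: sym_stochasticD[OF P] intro!: sum_mono mult_left_mono norm_gram_le)

text \<open>Unit column sums cancel the linear parts in the sum over agents. What remains is
  quadratic, so the consensus steps barely move the mean.\<close>

lemma norm_sum_consensus_dir_le: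
  assumes P: "sym_stochastic P" and x: "\<And>i. x i \<in> stiefel"
  shows "norm (\<Sum>i\<in>UNIV. consensus_dir P x i) \<le> disagreement P x / 2"
proof -
  have "(\<Sum>i\<in>UNIV. \<Sum>j\<in>UNIV. P $ i $ j *\<^sub>R x j) = (\<Sum>j\<in>UNIV. x j)"
    by (subst sum.swap) (simp add: scaleR_sum_left[symmetric] sym_stochasticD[OF P])
  then have "(\<Sum>i\<in>UNIV. consensus_dir P x i) =
      (1/2) *\<^sub>R (\<Sum>i\<in>UNIV. x i ** (\<Sum>j\<in>UNIV. P $ i $ j *\<^sub>R gram (x i - x j)))"
    unfolding consensus_dir_expand[OF P x] by (simp add: sum.distrib sum_subtractf scaleR_sum_right)
  moreover have "norm (\<Sum>i\<in>UNIV. x i ** (\<Sum>j\<in>UNIV. P $ i $ j *\<^sub>R gram (x i - x j))) \<le> disagreement P x"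
    unfolding disagreement_def by (rule order_trans[OF norm_sum sum_mono]) (rule norm_sum_gram_le[OF P x])
  ultimately show ?thesis by simp
qed

text \<open>Criticality of \<open>p\<close> makes the Euclidean mean equal to \<open>p\<close> times a symmetric matrix that is
  quadratically close to the identity.\<close>

lemma mean_gap:
  fixes x :: "'n::finite \<Rightarrow> real^'r^'d"
  assumes x: "\<And>i. x i \<in> stiefel" and p: "p \<in> stiefel" and z: "proj_tangent p (mean x) = 0"
  obtains G where "transpose G = G" "mean x = p - (1/2) *\<^sub>R (p ** G)"
    "norm G \<le> (1 / real CARD('n)) * (\<Sum>i\<in>UNIV. (norm (x i - p))\<^sup>2)"
proof -
  let ?n = "real CARD('n)"
  define G where "G = (1 / ?n) *\<^sub>R (\<Sum>i\<in>UNIV. gram (p - x i))"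
  have "transpose G = G" by (simp add: G_def transpose_sum transpose_scalar matrix_transpose_mul)
  moreover have "mean x = p - (1/2) *\<^sub>R (p ** G)"
  proof -
    have "0 = (1 / ?n) *\<^sub>R (\<Sum>i\<in>UNIV. proj_tangent p (x i))"
      using z by (simp add: mean_def linear_sum[OF linear_proj_tangent] linear_scale[OF linear_proj_tangent])
    also have "\<dots> = mean x - p + (1/2) *\<^sub>R (p ** G)"
      using x p by (simp add: proj_tangent_stiefel sum.distrib sum_subtractf scaleR_add_right scaleR_diff_right
          mean_def G_def scaleR_sum_right[symmetric] matrix_mult_sum_right matrix_mult_scaleR_right sum_constant_scaleR mult.commute
          del: sum_constant)
    finally show ?thesis by (simp add: algebra_simps)
  qed
  moreover have "norm G \<le> (1 / ?n) * (\<Sum>i\<in>UNIV. (norm (x i - p))\<^sup>2)"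
  proof -
    have "norm (\<Sum>i\<in>UNIV. gram (p - x i)) \<le> (\<Sum>i\<in>UNIV. (norm (x i - p))\<^sup>2)"
      by (rule order_trans[OF norm_sum sum_mono]) (metis norm_gram_le norm_minus_commute)
    then show ?thesis by (simp add: G_def divide_right_mono)
  qed
  ultimately show ?thesis by (rule that)
qed

lemma norm_mean_gap:
  fixes x :: "'n::finite \<Rightarrow> real^'r^'d"
  assumes x: "\<And>i. x i \<in> stiefel" and p: "p \<in> stiefel" and z: "proj_tangent p (mean x) = 0"
  shows "norm (mean x - p) \<le> (\<Sum>i\<in>UNIV. (norm (x i - p))\<^sup>2) / (2 * real CARD('n))"
proof -
  obtain G where G: "mean x = p - (1/2) *\<^sub>R (p ** G)"
    "norm G \<le> (1 / real CARD('n)) * (\<Sum>i\<in>UNIV. (norm (x i - p))\<^sup>2)"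
    using mean_gap[OF x p z] by metis
  have "norm (mean x - p) = norm G / 2" by (simp add: G(1) stiefel_norm_mult[OF p])
  then show ?thesis using G(2) by simp
qed

text \<open>At a critical \<open>p\<close> the mean is \<open>p\<close> times the identity minus
  half of a symmetric matrix of norm at most \<open>e\<close>. Hence its inner product with
  \<open>p - p'\<close> is at least about half of the squared distance. Adding the same estimate
  with the roles exchanged and using Cauchy-Schwarz gives the claim.\<close>

lemma proj_mean_lipschitz:
  fixes x x' :: "'n::finite \<Rightarrow> real^'r^'d"
  assumes x: "\<And>i. x i \<in> stiefel" and p: "p \<in> stiefel" and z: "proj_tangent p (mean x) = 0"
    and x': "\<And>i. x' i \<in> stiefel" and p': "p' \<in> stiefel" and z': "proj_tangent p' (mean x') = 0"
    and c: "(\<Sum>i\<in>UNIV. (norm (x i - p))\<^sup>2) \<le> real CARD('n) * e"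
    and c': "(\<Sum>i\<in>UNIV. (norm (x' i - p'))\<^sup>2) \<le> real CARD('n) * e"
  shows "(1 - e / 2) * norm (p - p') \<le> norm (mean x - mean x')"
proof -
  have half: "(p - p') \<bullet> mean x \<ge> (1/2) * (1 - e / 2) * (norm (p - p'))\<^sup>2"
    if x: "\<And>i. x i \<in> stiefel" and p: "p \<in> stiefel" and z: "proj_tangent p (mean x) = 0"
    and p': "p' \<in> stiefel" and c: "(\<Sum>i\<in>UNIV. (norm (x i - p))\<^sup>2) \<le> real CARD('n) * e"
    for x :: "'n \<Rightarrow> real^'r^'d" and p p'
  proof -
    obtain G where G: "transpose G = G" "mean x = p - (1/2) *\<^sub>R (p ** G)"
      "norm G \<le> (1 / real CARD('n)) * (\<Sum>i\<in>UNIV. (norm (x i - p))\<^sup>2)"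
      using mean_gap[OF x p z] by metis
    have "(1 / real CARD('n)) * (\<Sum>i\<in>UNIV. (norm (x i - p))\<^sup>2) \<le> (1 / real CARD('n)) * (real CARD('n) * e)"
      by (intro mult_left_mono c) simp
    then have nG: "norm G \<le> e" using G(3) by simp
    have "p \<bullet> (p - p') = (1/2) * (norm (p - p'))\<^sup>2"
      using stiefel_inner_sym[OF p p', of "mat 1"] by (simp add: inner_mat_1_gram)
    moreover have "(p ** G) \<bullet> (p - p') \<le> (1/2) * (e * (norm (p - p'))\<^sup>2)"
    proof -
      have "G \<bullet> gram (p - p') \<le> norm G * norm (gram (p - p'))" by (rule norm_cauchy_schwarz)
      also have "\<dots> \<le> e * (norm (p - p'))\<^sup>2"
        using nG norm_gram_le[of "p - p'"] order_trans[OF norm_ge_zero nG] by (intro mult_mono) auto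
      finally show ?thesis using stiefel_inner_sym[OF p p' G(1)] by simp
    qed
    moreover have "(p - p') \<bullet> mean x = p \<bullet> (p - p') - (1/2) * ((p ** G) \<bullet> (p - p'))"
      by (simp add: G(2) inner_diff_left inner_diff_right inner_commute algebra_simps)
    ultimately show ?thesis by (simp add: algebra_simps)
  qed
  have "(1 - e / 2) * (norm (p - p'))\<^sup>2 \<le> (p - p') \<bullet> mean x + (p' - p) \<bullet> mean x'"
    using half[OF x p z p' c] half[OF x' p' z' p c'] by (simp add: norm_minus_commute)
  also have "\<dots> = (p - p') \<bullet> (mean x - mean x')"
    by (simp add: inner_diff_left inner_diff_right)
  also have "\<dots> \<le> norm (p - p') * norm (mean x - mean x')" by (rule norm_cauchy_schwarz)
  finally have "norm (p - p') * ((1 - e / 2) * norm (p - p')) \<le> norm (p - p') * norm (mean x - mean x')"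
    by (simp add: power2_eq_square mult_ac)
  then show ?thesis by (cases "p = p'") auto
qed

text \<open>One iteration with the stepsize and the subgradients as free data, the latter known only
  through tangency and the bound \<open>L\<close>. The estimates thus carry no iteration index and
  are instantiated afresh at each one.\<close>

locale drsm_step =
  fixes P :: "real^'n^'n" and x x' \<xi> :: "'n \<Rightarrow> real^'r^'d"
    and \<alpha> \<beta> L M :: real
  assumes P: "sym_stochastic P" and n2: "CARD('n) \<ge> 2"
    and M: "\<forall>x\<in>(stiefel :: (real^'r^'d) set). \<forall>\<xi>\<in>tangent_space x. norm (polar_retr x \<xi> - (x + \<xi>)) \<le> M * (norm \<xi>)\<^sup>2"
    and Mpos: "M > 0" and alpha: "0 < \<alpha>" and beta: "0 < \<beta>" and Lpos: "0 < L"
    and x: "\<And>i. x i \<in> stiefel"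
    and xi: "\<And>i. \<xi> i \<in> tangent_space (x i)" "\<And>i. norm (\<xi> i) \<le> L"
    and x': "\<And>i. x' i = polar_retr (x i) (\<alpha> *\<^sub>R consensus_dir P x i - \<beta> *\<^sub>R \<xi> i)"
begin

definition dir :: "'n \<Rightarrow> real^'r^'d" where
  "dir i = \<alpha> *\<^sub>R consensus_dir P x i - \<beta> *\<^sub>R \<xi> i"

abbreviation (input) Lt :: real where "Lt \<equiv> 1 - eig_min P"
abbreviation (input) mt :: real where "mt \<equiv> 1 - eig_k 2 P"
abbreviation (input) proj where "proj z \<equiv> proj_stiefel (mean z) :: real^'r^'d"
abbreviation (input) err where "err z \<equiv> L2_set (\<lambda>i. norm (z i - proj z)) (UNIV :: 'n set)"

lemma consensus_dir_tangent: "consensus_dir P x i \<in> tangent_space (x i)"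
  unfolding consensus_dir_def by (rule proj_tangent_in[OF x])

lemma dir_tangent: "dir i \<in> tangent_space (x i)"
  unfolding dir_def
  by (intro subspace_diff subspace_scale subspace_tangent consensus_dir_tangent xi)

lemma next_in: "x' i \<in> stiefel"
  unfolding x' using polar_retr_stiefel(1)[OF x dir_tangent] by (simp add: dir_def)

lemma next_le: "y \<in> stiefel \<Longrightarrow> norm (x' i - y) \<le> norm (x i + dir i - y)"
  unfolding x' using polar_retr_stiefel(2)[OF x dir_tangent] by (simp add: dir_def)

lemma next_gap: "norm (x' i - (x i + dir i)) \<le> M * (norm (dir i))\<^sup>2"
  unfolding x' using M x[of i] dir_tangent[of i] by (simp add: dir_def)

lemma proj_in: "proj z \<in> stiefel"
  by (rule proj_stiefel_nearest(1)[OF x])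

lemma proj_critical: "proj_tangent (proj z) (mean z) = 0"
  by (rule proj_tangent_proj_stiefel[OF x M])

lemma err_sq: "(err z)\<^sup>2 = (\<Sum>i\<in>UNIV. (norm (z i - proj z))\<^sup>2)"
  by (simp add: L2_set_def sum_nonneg)

lemma Lt_bounds: "0 \<le> Lt" "Lt \<le> 2"
proof -
  show "Lt \<le> 2" using stochastic_eig_bounds(2)[OF P n2] by simp
  obtain B b where "orthonormal B" "b \<in> B" "b \<bullet> (P *v b) = eig_min P"
    using stochastic_eigenbasis[OF P n2] by metis
  moreover have "0 \<le> b \<bullet> b - b \<bullet> (P *v b)"
    unfolding stochastic_quadform(1)[OF P]
    by (auto intro!: sum_nonneg mult_nonneg_nonneg sym_stochasticD[OF P])
  ultimately show "0 \<le> Lt" by (simp add: orthonormal_def dot_square_norm)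
qed

lemma disagreement_le: "disagreement P x / 2 \<le> Lt * (err x)\<^sup>2"
proof -
  have "disagreement P x / 2 \<le> Lt * (\<Sum>i\<in>UNIV. (norm (x i - mean x))\<^sup>2)"
    using stochastic_spectral_vec(2)[OF P n2, of x] by (simp add: disagreement_def mean_def)
  also have "\<dots> \<le> Lt * (err x)\<^sup>2"
    unfolding err_sq sum_mean_diff[of x "proj x"] using Lt_bounds by (intro mult_left_mono) auto
  finally show ?thesis .
qed

lemma sum_consensus_dir_sq: "(\<Sum>i\<in>UNIV. (norm (consensus_dir P x i))\<^sup>2) \<le> Lt * (disagreement P x / 2)"
proof -
  have "(\<Sum>i\<in>UNIV. (norm (consensus_dir P x i))\<^sup>2) \<le> (\<Sum>i\<in>UNIV. (norm (x i - (\<Sum>j\<in>UNIV. P $ i $ j *\<^sub>R x j)))\<^sup>2)"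
    by (intro sum_mono power_mono norm_consensus_dir_le P x norm_ge_zero)
  also have "\<dots> \<le> Lt * (disagreement P x / 2)"
    using stochastic_spectral_vec(3)[OF P n2, of x] by (simp add: disagreement_def)
  finally show ?thesis .
qed

lemma L2_consensus_dir: "L2_set (\<lambda>i. norm (consensus_dir P x i)) UNIV \<le> Lt * err x"
proof -
  have "(L2_set (\<lambda>i. norm (consensus_dir P x i)) UNIV)\<^sup>2 \<le> Lt * (disagreement P x / 2)"
    using sum_consensus_dir_sq by (simp add: L2_set_def sum_nonneg)
  also have "\<dots> \<le> Lt * (Lt * (err x)\<^sup>2)" by (intro mult_left_mono disagreement_le Lt_bounds)
  also have "\<dots> = (Lt * err x)\<^sup>2" by (simp add: power2_eq_square)
  finally show ?thesis
    by (rule power2_le_imp_le) (intro mult_nonneg_nonneg Lt_bounds L2_set_nonneg)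
qed

lemma L2_subgrad: "L2_set (\<lambda>i. norm (\<beta> *\<^sub>R \<xi> i)) UNIV \<le> sqrt CARD('n) * L * \<beta>"
proof -
  have "L2_set (\<lambda>i. norm (\<beta> *\<^sub>R \<xi> i)) UNIV \<le> L2_set (\<lambda>i. L * \<beta>) (UNIV :: 'n set)"
    using xi(2) beta by (intro L2_set_mono) (auto simp: mult.commute)
  also have "\<dots> = sqrt CARD('n) * L * \<beta>"
    using beta Lpos by (simp add: L2_set_constant)
  finally show ?thesis .
qed

lemma L2_diff_le:
  "L2_set (\<lambda>i. norm (f i - g i :: real^'r^'d)) (UNIV :: 'n set)
    \<le> L2_set (\<lambda>i. norm (f i)) UNIV + L2_set (\<lambda>i. norm (g i)) UNIV"
  by (rule order_trans[OF _ L2_set_triangle_ineq])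
     (intro L2_set_mono norm_triangle_ineq4 norm_ge_zero)

lemma L2_dir: "L2_set (\<lambda>i. norm (dir i)) UNIV \<le> \<alpha> * (Lt * err x) + sqrt CARD('n) * L * \<beta>"
proof -
  have "L2_set (\<lambda>i. norm (dir i)) UNIV \<le> L2_set (\<lambda>i. norm (\<alpha> *\<^sub>R consensus_dir P x i)) UNIV + L2_set (\<lambda>i. norm (\<beta> *\<^sub>R \<xi> i)) UNIV"
    unfolding dir_def by (rule L2_diff_le)
  also have "L2_set (\<lambda>i. norm (\<alpha> *\<^sub>R consensus_dir P x i)) UNIV = \<alpha> * L2_set (\<lambda>i. norm (consensus_dir P x i)) UNIV"
    using alpha by (simp add: L2_set_right_distrib)
  also have "\<dots> \<le> \<alpha> * (Lt * err x)"
    using alpha L2_consensus_dir by (intro mult_left_mono) auto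
  finally show ?thesis using L2_subgrad by linarith
qed

text \<open>The retraction does not increase the distance to \<open>y\<close>, so the square of
  \<open>x i + dir i - y\<close> is expanded. With target constant 2 the consensus inner product is
  at most \<open>disagreement P x / 2\<close>, hence at most \<open>Lt\<close> times the squared
  consensus error.\<close>

lemma descent:
  assumes y: "y \<in> stiefel"
  shows "(\<Sum>i\<in>UNIV. (norm (x' i - y))\<^sup>2) \<le> (\<Sum>i\<in>UNIV. (norm (x i - y))\<^sup>2)
    - 2 * \<beta> * (\<Sum>i\<in>UNIV. \<xi> i \<bullet> (x i - y)) + 2 * \<alpha> * Lt * (err x)\<^sup>2
    + (\<alpha> * (Lt * err x) + sqrt CARD('n) * L * \<beta>)\<^sup>2"
proof -
  have "(norm (x' i - y))\<^sup>2 \<le> (norm (x i - y))\<^sup>2 + (norm (dir i))\<^sup>2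
      + (2 * \<alpha> * (consensus_dir P x i \<bullet> (x i - y)) - 2 * \<beta> * (\<xi> i \<bullet> (x i - y)))" for i
  proof -
    have "(norm (x' i - y))\<^sup>2 \<le> (norm ((x i - y) + dir i))\<^sup>2"
      using next_le[OF y, of i] by (intro power_mono) (auto simp: algebra_simps)
    also have "\<dots> = (norm (x i - y))\<^sup>2 + (norm (dir i))\<^sup>2 + 2 * (dir i \<bullet> (x i - y))"
      by (simp add: norm_add_sq inner_commute)
    also have "dir i \<bullet> (x i - y) = \<alpha> * (consensus_dir P x i \<bullet> (x i - y)) - \<beta> * (\<xi> i \<bullet> (x i - y))"
      unfolding dir_def by (simp only: inner_diff_left inner_scaleR_left)
    finally show ?thesis by simp
  qed
  then have "(\<Sum>i\<in>UNIV. (norm (x' i - y))\<^sup>2) \<le> (\<Sum>i\<in>UNIV. (norm (x i - y))\<^sup>2 + (norm (dir i))\<^sup>2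
      + (2 * \<alpha> * (consensus_dir P x i \<bullet> (x i - y)) - 2 * \<beta> * (\<xi> i \<bullet> (x i - y))))"
    by (rule sum_mono)
  also have "\<dots> = (\<Sum>i\<in>UNIV. (norm (x i - y))\<^sup>2) + (\<Sum>i\<in>UNIV. (norm (dir i))\<^sup>2)
      + (2 * \<alpha> * (\<Sum>i\<in>UNIV. consensus_dir P x i \<bullet> (x i - y)) - 2 * \<beta> * (\<Sum>i\<in>UNIV. \<xi> i \<bullet> (x i - y)))"
    by (simp only: sum.distrib sum_subtractf sum_distrib_left)
  finally have 1: "(\<Sum>i\<in>UNIV. (norm (x' i - y))\<^sup>2) \<le> (\<Sum>i\<in>UNIV. (norm (x i - y))\<^sup>2) + (\<Sum>i\<in>UNIV. (norm (dir i))\<^sup>2)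
      + (2 * \<alpha> * (\<Sum>i\<in>UNIV. consensus_dir P x i \<bullet> (x i - y)) - 2 * \<beta> * (\<Sum>i\<in>UNIV. \<xi> i \<bullet> (x i - y)))" .
  have "(\<Sum>i\<in>UNIV. consensus_dir P x i \<bullet> (x i - y)) \<le> - (2 - 2\<^sup>2) / 4 * disagreement P x"
    by (rule consensus_dir_inner_le[OF P x y]) (rule norm_mult_transpose_diff_stiefel[OF x y])
  then have "(\<Sum>i\<in>UNIV. consensus_dir P x i \<bullet> (x i - y)) \<le> Lt * (err x)\<^sup>2"
    using disagreement_le by simp
  then have 2: "2 * \<alpha> * (\<Sum>i\<in>UNIV. consensus_dir P x i \<bullet> (x i - y)) \<le> 2 * \<alpha> * (Lt * (err x)\<^sup>2)"
    using alpha by (intro mult_left_mono) auto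
  have "(\<Sum>i\<in>UNIV. (norm (dir i))\<^sup>2) = (L2_set (\<lambda>i. norm (dir i)) UNIV)\<^sup>2"
    by (simp add: L2_set_def sum_nonneg)
  also have "\<dots> \<le> (\<alpha> * (Lt * err x) + sqrt CARD('n) * L * \<beta>)\<^sup>2"
    by (intro power_mono L2_dir L2_set_nonneg)
  finally show ?thesis using 1 2 by (simp only: mult.assoc)
qed

section \<open>Contraction and invariance of the consensus region\<close>

context
  fixes \<delta>1 \<delta>2 \<nu> :: real
  assumes d1: "0 < \<delta>1" "\<delta>1 \<le> \<delta>2 / 5" and d2: "\<delta>2 \<le> 1 / 6"
    and nu: "0 < \<nu>" "\<nu> < 1" and aL: "\<alpha> * Lt \<le> \<nu> * (2 - \<delta>2\<^sup>2)" and a1: "\<alpha> \<le> 1" and aM: "\<alpha> * M \<le> 1"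
    and mt: "0 \<le> mt" and dev: "\<And>i. (\<Sum>j\<in>UNIV. \<bar>P $ i $ j - 1 / real CARD('n)\<bar>) \<le> 1 / 2"
    and err1: "(err x)\<^sup>2 \<le> real CARD('n) * \<delta>1\<^sup>2" and err2: "\<And>i. norm (x i - proj x) \<le> \<delta>2"
    and bL: "\<beta> * L \<le> \<alpha> * \<delta>1 / 5"
begin

lemma scaled_subgrad_le: "norm (\<beta> *\<^sub>R \<xi> i) \<le> \<alpha> * \<delta>1 / 5"
proof -
  have "norm (\<beta> *\<^sub>R \<xi> i) = \<beta> * norm (\<xi> i)" using beta by simp
  also have "\<dots> \<le> \<beta> * L" using beta by (intro mult_left_mono xi) simp
  finally show ?thesis using bL by linarith
qed

lemma mean_gap_le: "norm (mean x - proj x) \<le> \<delta>1\<^sup>2 / 2"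
proof -
  have "norm (mean x - proj x) \<le> (err x)\<^sup>2 / (2 * real CARD('n))"
    unfolding err_sq by (rule norm_mean_gap[OF x proj_in proj_critical])
  also have "\<dots> \<le> real CARD('n) * \<delta>1\<^sup>2 / (2 * real CARD('n))" by (intro divide_right_mono err1) simp
  finally show ?thesis by simp
qed

text \<open>With \<open>E\<close> the disagreement, the inner product contributes
  \<open>- \<alpha> * (2 - \<delta>2\<^sup>2) * (E / 2)\<close>, and the squared step gives back at
  most the fraction \<nu> of it. The fraction \<open>1 - \<nu>\<close> left over is turned into a
  multiple of the squared error by the spectral gap.\<close>

lemma contraction:
  assumes r1: "1 \<le> r"
  shows "(\<Sum>i\<in>UNIV. (norm (x i + \<alpha> *\<^sub>R consensus_dir P x i - proj x))\<^sup>2)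
    \<le> (1 - 2 * (1 - \<nu>) * \<alpha> * ((1 - 4 * r * \<delta>1\<^sup>2) * (1 - \<delta>2\<^sup>2 / 2) * mt)) * (err x)\<^sup>2"
proof -
  let ?h = "consensus_dir P x" and ?p = "proj x" and ?E = "disagreement P x"
  have d2sq: "\<delta>2\<^sup>2 \<le> 1" using d1 d2 by (intro power_le_one) auto
  have "(norm (x i + \<alpha> *\<^sub>R ?h i - ?p))\<^sup>2 = (norm (x i - ?p))\<^sup>2 + \<alpha>\<^sup>2 * (norm (?h i))\<^sup>2
      + 2 * \<alpha> * (?h i \<bullet> (x i - ?p))" for i
    using norm_add_sq[of "x i - ?p" "\<alpha> *\<^sub>R ?h i"]
    by (simp add: power_mult_distrib inner_commute algebra_simps)
  then have "(\<Sum>i\<in>UNIV. (norm (x i + \<alpha> *\<^sub>R ?h i - ?p))\<^sup>2)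
      = (err x)\<^sup>2 + \<alpha>\<^sup>2 * (\<Sum>i\<in>UNIV. (norm (?h i))\<^sup>2) + 2 * \<alpha> * (\<Sum>i\<in>UNIV. ?h i \<bullet> (x i - ?p))"
    unfolding err_sq by (simp only: sum.distrib sum_distrib_left)
  moreover have "2 * \<alpha> * (\<Sum>i\<in>UNIV. ?h i \<bullet> (x i - ?p)) \<le> 2 * \<alpha> * (- (2 - \<delta>2\<^sup>2) / 4 * ?E)"
  proof (intro mult_left_mono consensus_dir_inner_le[OF P x proj_in])
    fix i and A :: "real^'r^'d"
    have "norm (A ** transpose (x i - ?p)) \<le> norm A * norm (x i - ?p)"
      using norm_matrix_mult_le[of A "transpose (x i - ?p)"] by (simp add: norm_transpose)
    also have "\<dots> \<le> norm A * \<delta>2" by (intro mult_left_mono err2) simp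
    finally show "norm (A ** transpose (x i - ?p)) \<le> \<delta>2 * norm A" by (simp add: mult.commute)
  qed (use alpha in simp)
  moreover have "\<alpha>\<^sup>2 * (\<Sum>i\<in>UNIV. (norm (?h i))\<^sup>2) \<le> \<alpha> * (\<nu> * (2 - \<delta>2\<^sup>2)) * (?E / 2)"
  proof -
    have "\<alpha>\<^sup>2 * (\<Sum>i\<in>UNIV. (norm (?h i))\<^sup>2) \<le> \<alpha>\<^sup>2 * (Lt * (?E / 2))"
      by (intro mult_left_mono sum_consensus_dir_sq) simp
    also have "\<dots> = \<alpha> * (\<alpha> * Lt) * (?E / 2)" by (simp add: power2_eq_square)
    also have "\<dots> \<le> \<alpha> * (\<nu> * (2 - \<delta>2\<^sup>2)) * (?E / 2)"
      using alpha aL disagreement_nonneg[OF P, of x] by (intro mult_right_mono mult_left_mono) auto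
    finally show ?thesis .
  qed
  ultimately have 1: "(\<Sum>i\<in>UNIV. (norm (x i + \<alpha> *\<^sub>R ?h i - ?p))\<^sup>2)
      \<le> (err x)\<^sup>2 - \<alpha> * (1 - \<nu>) * (2 - \<delta>2\<^sup>2) * (?E / 2)"
    by (simp add: algebra_simps)
  \<comment> \<open>The spectral gap controls deviations from the Euclidean mean, whereas the error
    is measured from its nearest point. The two squares differ by at most
    \<open>\<delta>1\<^sup>2 / 4\<close> times the squared error, covered by
    \<open>4 * r * \<delta>1\<^sup>2\<close>.\<close>
  have "(1 - 4 * r * \<delta>1\<^sup>2) * (err x)\<^sup>2 \<le> (\<Sum>i\<in>UNIV. (norm (x i - mean x))\<^sup>2)"
  proof -
    have "real CARD('n) * (norm (mean x - ?p))\<^sup>2 \<le> real CARD('n) * ((err x)\<^sup>2 / (2 * real CARD('n)) * (\<delta>1\<^sup>2 / 2))"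
    proof (intro mult_left_mono)
      have "norm (mean x - ?p) \<le> (err x)\<^sup>2 / (2 * real CARD('n))"
        unfolding err_sq by (rule norm_mean_gap[OF x proj_in proj_critical])
      then show "(norm (mean x - ?p))\<^sup>2 \<le> (err x)\<^sup>2 / (2 * real CARD('n)) * (\<delta>1\<^sup>2 / 2)"
        unfolding power2_eq_square[of "norm _"] using mean_gap_le by (intro mult_mono) auto
    qed simp
    also have "\<dots> = \<delta>1\<^sup>2 / 4 * (err x)\<^sup>2" by simp
    also have "\<dots> \<le> 4 * r * \<delta>1\<^sup>2 * (err x)\<^sup>2"
      using mult_right_mono[of "1 / 4" "4 * r" "\<delta>1\<^sup>2"] r1 by (intro mult_right_mono) auto
    finally show ?thesis
      using sum_mean_diff[of x ?p] by (simp only: err_sq[symmetric]) (simp add: algebra_simps)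
  qed
  then have "mt * ((1 - 4 * r * \<delta>1\<^sup>2) * (err x)\<^sup>2) \<le> mt * (\<Sum>i\<in>UNIV. (norm (x i - mean x))\<^sup>2)"
    using mt by (intro mult_left_mono)
  also have "\<dots> \<le> ?E / 2"
    using stochastic_spectral_vec(1)[OF P n2, of x] by (simp add: disagreement_def mean_def)
  finally have "\<alpha> * (1 - \<nu>) * (2 - \<delta>2\<^sup>2) * (mt * ((1 - 4 * r * \<delta>1\<^sup>2) * (err x)\<^sup>2))
      \<le> \<alpha> * (1 - \<nu>) * (2 - \<delta>2\<^sup>2) * (?E / 2)"
    using alpha nu d2sq by (intro mult_left_mono) auto
  moreover have "\<alpha> * (1 - \<nu>) * (2 - \<delta>2\<^sup>2) * (mt * ((1 - 4 * r * \<delta>1\<^sup>2) * (err x)\<^sup>2)) =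
      2 * (1 - \<nu>) * \<alpha> * ((1 - 4 * r * \<delta>1\<^sup>2) * (1 - \<delta>2\<^sup>2 / 2) * mt) * (err x)\<^sup>2"
    by (simp add: field_simps)
  moreover have "(1 - k) * (err x)\<^sup>2 = (err x)\<^sup>2 - k * (err x)\<^sup>2" for k
    by (simp add: left_diff_distrib)
  note this[of "2 * (1 - \<nu>) * \<alpha> * ((1 - 4 * r * \<delta>1\<^sup>2) * (1 - \<delta>2\<^sup>2 / 2) * mt)"]
  ultimately show ?thesis using 1 by linarith
qed

text \<open>The new reference point is nearest to the new mean, so replacing it by the old one can
  only enlarge the error. Relative to the fixed old point the retraction is harmless, and
  Minkowski's inequality separates consensus from subgradients.\<close>

lemma err_next:
  assumes r1: "1 \<le> r" and \<rho>: "\<rho> = sqrt (1 - 2 * (1 - \<nu>) * \<alpha> * ((1 - 4 * r * \<delta>1\<^sup>2) * (1 - \<delta>2\<^sup>2 / 2) * mt))"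
  shows "err x' \<le> \<rho> * err x + sqrt CARD('n) * L * \<beta>"
proof -
  let ?p = "proj x"
  have "(err x')\<^sup>2 \<le> (\<Sum>i\<in>UNIV. (norm (x' i - ?p))\<^sup>2)"
  proof -
    have "norm (mean x' - proj x') \<le> norm (mean x' - ?p)"
      by (rule proj_stiefel_nearest(2)[OF proj_in])
    then have "real CARD('n) * (norm (mean x' - proj x'))\<^sup>2 \<le> real CARD('n) * (norm (mean x' - ?p))\<^sup>2"
      by (intro mult_left_mono power_mono) auto
    then show ?thesis
      unfolding err_sq sum_mean_diff[of x' "proj x'"] sum_mean_diff[of x' ?p] by simp
  qed
  then have "err x' \<le> L2_set (\<lambda>i. norm (x' i - ?p)) UNIV"
    by (simp add: L2_set_def sum_nonneg)
  also have "\<dots> \<le> L2_set (\<lambda>i. norm ((x i + \<alpha> *\<^sub>R consensus_dir P x i - ?p) - \<beta> *\<^sub>R \<xi> i)) UNIV"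
  proof (intro L2_set_mono norm_ge_zero)
    fix i
    have "x i + dir i - ?p = (x i + \<alpha> *\<^sub>R consensus_dir P x i - ?p) - \<beta> *\<^sub>R \<xi> i"
      by (simp add: dir_def)
    then show "norm (x' i - ?p) \<le> norm ((x i + \<alpha> *\<^sub>R consensus_dir P x i - ?p) - \<beta> *\<^sub>R \<xi> i)"
      using next_le[OF proj_in, of i] by metis
  qed
  also have "\<dots> \<le> L2_set (\<lambda>i. norm (x i + \<alpha> *\<^sub>R consensus_dir P x i - ?p)) UNIV + L2_set (\<lambda>i. norm (\<beta> *\<^sub>R \<xi> i)) UNIV"
    by (rule L2_diff_le)
  also have "L2_set (\<lambda>i. norm (x i + \<alpha> *\<^sub>R consensus_dir P x i - ?p)) UNIV \<le> \<rho> * err x"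
  proof -
    have "L2_set (\<lambda>i. norm (x i + \<alpha> *\<^sub>R consensus_dir P x i - ?p)) UNIV \<le>
       sqrt ((1 - 2 * (1 - \<nu>) * \<alpha> * ((1 - 4 * r * \<delta>1\<^sup>2) * (1 - \<delta>2\<^sup>2 / 2) * mt)) * (err x)\<^sup>2)"
      using contraction[OF r1] by (simp add: L2_set_def)
    also have "\<dots> = \<rho> * err x" by (simp add: real_sqrt_mult \<rho>)
    finally show ?thesis .
  qed
  finally show ?thesis using L2_subgrad by linarith
qed

text \<open>From \<open>Lt \<le> 2\<close> and the stepsize bound, the root mean square of the steps
  is at most \<open>\<alpha> * (11/5 * \<delta>1)\<close>. Its square 121/25 enters through the
  retraction error, where \<open>\<alpha> * M \<le> 1\<close> saves one factor \<alpha>; the summed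
  consensus directions add 2, and 171/25 is rounded up to 7.\<close>

lemma mean_shift: "norm (mean x' - mean x) \<le> \<alpha> * (7 * \<delta>1\<^sup>2 + \<delta>1 / 5)"
proof -
  have "err x \<le> sqrt CARD('n) * \<delta>1"
    by (rule power2_le_imp_le) (use err1 d1 in \<open>auto simp: power_mult_distrib\<close>)
  then have "Lt * err x \<le> 2 * (sqrt CARD('n) * \<delta>1)"
    using Lt_bounds by (intro mult_mono) (auto simp: L2_set_nonneg)
  then have "\<alpha> * (Lt * err x) \<le> \<alpha> * (2 * (sqrt CARD('n) * \<delta>1))"
    using alpha by (intro mult_left_mono) auto
  moreover have "sqrt CARD('n) * (\<beta> * L) \<le> sqrt CARD('n) * (\<alpha> * \<delta>1 / 5)"
    by (intro mult_left_mono bL) simp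
  moreover have "sqrt CARD('n) * L * \<beta> = sqrt CARD('n) * (\<beta> * L)" by simp
  moreover have "\<alpha> * (2 * (sqrt CARD('n) * \<delta>1)) + sqrt CARD('n) * (\<alpha> * \<delta>1 / 5)
      = sqrt CARD('n) * (\<alpha> * (11/5 * \<delta>1))" by (simp add: algebra_simps)
  ultimately have "L2_set (\<lambda>i. norm (dir i)) UNIV \<le> sqrt CARD('n) * (\<alpha> * (11/5 * \<delta>1))"
    using L2_dir by linarith
  then have "(L2_set (\<lambda>i. norm (dir i)) UNIV)\<^sup>2 \<le> (sqrt CARD('n) * (\<alpha> * (11/5 * \<delta>1)))\<^sup>2"
    by (intro power_mono L2_set_nonneg)
  then have d: "(\<Sum>i\<in>UNIV. (norm (dir i))\<^sup>2) \<le> real CARD('n) * (\<alpha>\<^sup>2 * (121/25 * \<delta>1\<^sup>2))"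
    by (simp add: L2_set_def sum_nonneg power_mult_distrib power_divide)
  have "norm (\<Sum>i\<in>UNIV. x' i - (x i + dir i)) \<le> (\<Sum>i\<in>UNIV. M * (norm (dir i))\<^sup>2)"
    by (rule order_trans[OF norm_sum sum_mono]) (rule next_gap)
  also have "\<dots> \<le> M * (real CARD('n) * (\<alpha>\<^sup>2 * (121/25 * \<delta>1\<^sup>2)))"
    unfolding sum_distrib_left[symmetric] using Mpos by (intro mult_left_mono d) auto
  also have "\<dots> = (\<alpha> * M) * (real CARD('n) * (\<alpha> * (121/25 * \<delta>1\<^sup>2)))" by (simp add: power2_eq_square)
  also have "\<dots> \<le> 1 * (real CARD('n) * (\<alpha> * (121/25 * \<delta>1\<^sup>2)))"
    using alpha by (intro mult_right_mono aM) auto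
  finally have 1: "norm (\<Sum>i\<in>UNIV. x' i - (x i + dir i)) \<le> real CARD('n) * (\<alpha> * (121/25 * \<delta>1\<^sup>2))" by simp
  have "norm (\<Sum>i\<in>UNIV. dir i) \<le> norm (\<alpha> *\<^sub>R (\<Sum>i\<in>UNIV. consensus_dir P x i)) + norm (\<Sum>i\<in>UNIV. \<beta> *\<^sub>R \<xi> i)"
    unfolding dir_def sum_subtractf scaleR_sum_right[symmetric] by (rule norm_triangle_ineq4)
  also have "norm (\<alpha> *\<^sub>R (\<Sum>i\<in>UNIV. consensus_dir P x i)) \<le> \<alpha> * (2 * (real CARD('n) * \<delta>1\<^sup>2))"
  proof -
    have "norm (\<Sum>i\<in>UNIV. consensus_dir P x i) \<le> Lt * (err x)\<^sup>2"
      using norm_sum_consensus_dir_le[of P x, OF P x] disagreement_le by linarith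
    also have "\<dots> \<le> 2 * (real CARD('n) * \<delta>1\<^sup>2)" using Lt_bounds err1 by (intro mult_mono) auto
    finally show ?thesis using alpha by simp
  qed
  also have "norm (\<Sum>i\<in>UNIV. \<beta> *\<^sub>R \<xi> i) \<le> real CARD('n) * (\<alpha> * \<delta>1 / 5)"
  proof -
    have "norm (\<Sum>i\<in>UNIV. \<beta> *\<^sub>R \<xi> i) \<le> (\<Sum>i\<in>(UNIV :: 'n set). \<alpha> * \<delta>1 / 5)"
      by (intro order_trans[OF norm_sum sum_mono] scaled_subgrad_le)
    then show ?thesis by simp
  qed
  finally have 2: "norm (\<Sum>i\<in>UNIV. dir i) \<le> \<alpha> * (2 * (real CARD('n) * \<delta>1\<^sup>2)) + real CARD('n) * (\<alpha> * \<delta>1 / 5)" by simp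
  have "mean x' - mean x = (1 / real CARD('n)) *\<^sub>R ((\<Sum>i\<in>UNIV. x' i - (x i + dir i)) + (\<Sum>i\<in>UNIV. dir i))"
    by (simp add: mean_def sum.distrib sum_subtractf algebra_simps)
  then have "norm (mean x' - mean x) = (1 / real CARD('n)) * norm ((\<Sum>i\<in>UNIV. x' i - (x i + dir i)) + (\<Sum>i\<in>UNIV. dir i))"
    by simp
  also have "\<dots> \<le> (1 / real CARD('n)) * (real CARD('n) * (\<alpha> * (121/25 * \<delta>1\<^sup>2)) + (\<alpha> * (2 * (real CARD('n) * \<delta>1\<^sup>2)) + real CARD('n) * (\<alpha> * \<delta>1 / 5)))"
    by (intro mult_left_mono order_trans[OF norm_triangle_ineq] add_mono 1 2) auto
  also have "\<dots> = \<alpha> * (171/25 * \<delta>1\<^sup>2 + \<delta>1 / 5)" by (simp add: field_simps)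
  also have "\<dots> \<le> \<alpha> * (7 * \<delta>1\<^sup>2 + \<delta>1 / 5)" using alpha by (intro mult_left_mono) auto
  finally show ?thesis .
qed

text \<open>The step is a convex combination of the old deviation with weight
  \<open>1 - \<alpha>\<close> and of the neighbourhood average with weight \<alpha>. The row bound
  \<open>dev\<close> halves the latter; the gap between mean and reference point and the curvature
  term are quadratic.\<close>

lemma agent_deviation:
  "norm (x' i - proj x) \<le> (1 - \<alpha>) * \<delta>2 + \<alpha> * (\<delta>2 / 2 + \<delta>1\<^sup>2 / 2 + 2 * \<delta>2\<^sup>2) + \<alpha> * \<delta>1 / 5"
proof -
  let ?p = "proj x"
  define u where "u = (\<Sum>j\<in>UNIV. P $ i $ j *\<^sub>R x j)"
  define G where "G = (\<Sum>j\<in>UNIV. P $ i $ j *\<^sub>R gram (x i - x j))"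
  have um: "u - mean x = (\<Sum>j\<in>UNIV. (P $ i $ j - 1 / real CARD('n)) *\<^sub>R (x j - ?p))"
    by (simp add: u_def mean_def scaleR_diff_right scaleR_diff_left sum_subtractf scaleR_sum_left[symmetric]
        scaleR_sum_right[symmetric] sym_stochasticD[OF P] sum_constant_scaleR del: sum_constant)
  have "norm (u - mean x) \<le> (\<Sum>j\<in>UNIV. \<bar>P $ i $ j - 1 / real CARD('n)\<bar> * \<delta>2)"
    unfolding um by (rule order_trans[OF norm_sum sum_mono]) (simp add: mult_left_mono err2)
  also have "\<dots> \<le> 1 / 2 * \<delta>2"
    unfolding sum_distrib_right[symmetric] using d1 by (intro mult_right_mono dev) auto
  finally have b1: "norm (u - mean x) \<le> \<delta>2 / 2" by simp
  have b2: "norm (x i ** G) \<le> 4 * \<delta>2\<^sup>2"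
  proof -
    have "norm (x i ** G) \<le> (\<Sum>j\<in>UNIV. P $ i $ j * (norm (x i - x j))\<^sup>2)"
      unfolding G_def by (rule norm_sum_gram_le[OF P x])
    also have "\<dots> \<le> (\<Sum>j\<in>UNIV. P $ i $ j * (2 * \<delta>2)\<^sup>2)"
    proof (intro sum_mono mult_left_mono power_mono norm_ge_zero)
      fix j
      show "norm (x i - x j) \<le> 2 * \<delta>2"
        using norm_triangle_ineq4[of "x i - ?p" "x j - ?p"] err2[of i] err2[of j] by simp
    qed (simp add: sym_stochasticD[OF P])
    also have "\<dots> = 4 * \<delta>2\<^sup>2"
      by (simp add: sum_distrib_right[symmetric] sym_stochasticD[OF P] power_mult_distrib)
    finally show ?thesis .
  qed
  have e: "x i + dir i - ?p = (1 - \<alpha>) *\<^sub>R (x i - ?p) + \<alpha> *\<^sub>R ((u - mean x) + (mean x - ?p) + (1/2) *\<^sub>R (x i ** G)) - \<beta> *\<^sub>R \<xi> i"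
    unfolding dir_def consensus_dir_expand[OF P x] u_def[symmetric] G_def[symmetric]
    by (simp add: algebra_simps)
  have "norm (x' i - ?p) \<le> norm (x i + dir i - ?p)" by (rule next_le[OF proj_in])
  also have "\<dots> \<le> norm ((1 - \<alpha>) *\<^sub>R (x i - ?p)) + norm (\<alpha> *\<^sub>R ((u - mean x) + (mean x - ?p) + (1/2) *\<^sub>R (x i ** G))) + norm (\<beta> *\<^sub>R \<xi> i)"
    unfolding e by (rule order_trans[OF norm_triangle_ineq4 add_right_mono[OF norm_triangle_ineq]])
  also have "\<dots> \<le> (1 - \<alpha>) * \<delta>2 + \<alpha> * (\<delta>2 / 2 + \<delta>1\<^sup>2 / 2 + 2 * \<delta>2\<^sup>2) + \<alpha> * \<delta>1 / 5"
  proof (intro add_mono scaled_subgrad_le)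
    show "norm ((1 - \<alpha>) *\<^sub>R (x i - ?p)) \<le> (1 - \<alpha>) * \<delta>2"
      using a1 err2[of i] by (simp add: mult_left_mono)
    have "norm ((u - mean x) + (mean x - ?p) + (1/2) *\<^sub>R (x i ** G)) \<le> norm (u - mean x) + norm (mean x - ?p) + norm ((1/2) *\<^sub>R (x i ** G))"
      by (rule order_trans[OF norm_triangle_ineq add_right_mono[OF norm_triangle_ineq]])
    also have "\<dots> \<le> \<delta>2 / 2 + \<delta>1\<^sup>2 / 2 + 2 * \<delta>2\<^sup>2"
      using b1 b2 mean_gap_le by simp
    finally show "norm (\<alpha> *\<^sub>R ((u - mean x) + (mean x - ?p) + (1/2) *\<^sub>R (x i ** G))) \<le> \<alpha> * (\<delta>2 / 2 + \<delta>1\<^sup>2 / 2 + 2 * \<delta>2\<^sup>2)"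
      using alpha by (simp add: mult_left_mono)
  qed
  finally show ?thesis .
qed

text \<open>The move of the reference point is charged to the mean shift. As all powers of \<delta>1
  and \<delta>2 are bounded by multiples of \<delta>2, the balance is linear: the gain \<delta>2 / 2
  exceeds the curvature cost \<delta>2 / 3 together with the small remaining terms.\<close>

lemma agent_deviation_next:
  assumes err1': "(err x')\<^sup>2 \<le> real CARD('n) * \<delta>1\<^sup>2"
  shows "norm (x' i - proj x') \<le> \<delta>2"
proof -
  have d1s: "\<delta>1\<^sup>2 \<le> \<delta>2 / 150" "\<delta>1\<^sup>2 \<le> 1 / 900" "\<delta>2\<^sup>2 \<le> \<delta>2 / 6"
  proof -
    have "\<delta>1 * \<delta>1 \<le> (1 / 30) * (\<delta>2 / 5)" using d1 d2 by (intro mult_mono) auto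
    then show "\<delta>1\<^sup>2 \<le> \<delta>2 / 150" by (simp add: power2_eq_square)
    then show "\<delta>1\<^sup>2 \<le> 1 / 900" using d2 by simp
    have "\<delta>2 * \<delta>2 \<le> (1 / 6) * \<delta>2" using d1 d2 by (intro mult_right_mono) auto
    then show "\<delta>2\<^sup>2 \<le> \<delta>2 / 6" by (simp add: power2_eq_square)
  qed
  have "(1 - \<delta>1\<^sup>2 / 2) * norm (proj x' - proj x) \<le> norm (mean x' - mean x)"
    by (rule proj_mean_lipschitz[OF next_in proj_in proj_critical x proj_in proj_critical])
       (use err1 err1' in \<open>simp_all add: err_sq\<close>)
  \<comment> \<open>\<open>\<delta>1\<^sup>2 \<le> 1 / 900\<close> gives
    \<open>1 - \<delta>1\<^sup>2 / 2 \<ge> 1799/1800\<close>, so the nearest-point map is almost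
    nonexpansive here.\<close>
  moreover have "(1799/1800) * norm (proj x' - proj x) \<le> (1 - \<delta>1\<^sup>2 / 2) * norm (proj x' - proj x)"
    using d1s by (intro mult_right_mono) auto
  ultimately have "norm (proj x' - proj x) \<le> (1800/1799) * (\<alpha> * (7 * \<delta>1\<^sup>2 + \<delta>1 / 5))"
    using mean_shift by linarith
  then have s: "norm (proj x - proj x') \<le> \<alpha> * ((1800/1799) * (7 * \<delta>1\<^sup>2 + \<delta>1 / 5))"
    by (simp only: norm_minus_commute[of "proj x"] mult.left_commute[of \<alpha>])
  have "norm (x' i - proj x') \<le> norm (x' i - proj x) + norm (proj x - proj x')"
    using norm_triangle_ineq[of "x' i - proj x" "proj x - proj x'"] by simp
  also have "\<dots> \<le> \<delta>2 + \<alpha> * (- \<delta>2 + (\<delta>2 / 2 + \<delta>1\<^sup>2 / 2 + 2 * \<delta>2\<^sup>2) + \<delta>1 / 5 + (1800/1799) * (7 * \<delta>1\<^sup>2 + \<delta>1 / 5))"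
  proof -
    have "(1 - \<alpha>) * \<delta>2 + \<alpha> * A + \<alpha> * \<delta>1 / 5 + \<alpha> * C = \<delta>2 + \<alpha> * (- \<delta>2 + A + \<delta>1 / 5 + C)" for A C
      by (simp add: algebra_simps)
    then show ?thesis using add_mono[OF agent_deviation[of i] s] by metis
  qed
  also have "\<dots> \<le> \<delta>2 + \<alpha> * 0"
  proof (intro add_left_mono mult_left_mono)
    show "- \<delta>2 + (\<delta>2 / 2 + \<delta>1\<^sup>2 / 2 + 2 * \<delta>2\<^sup>2) + \<delta>1 / 5 + (1800/1799) * (7 * \<delta>1\<^sup>2 + \<delta>1 / 5) \<le> 0"
      using d1s d1 by argo
  qed (use alpha in simp)
  finally show ?thesis by simp
qed

end

end

section \<open>Linear convergence\<close>

lemma sum_le_sqrt_card_L2: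
  "(\<Sum>i\<in>UNIV. norm (f i)) \<le> sqrt CARD('n) * L2_set (\<lambda>i. norm (f i)) (UNIV :: 'n::finite set)"
proof -
  have "(\<Sum>i\<in>UNIV. norm (f i)) = (\<Sum>i\<in>UNIV. \<bar>1\<bar> * \<bar>norm (f i)\<bar>)" by simp
  also have "\<dots> \<le> L2_set (\<lambda>i. 1) (UNIV :: 'n set) * L2_set (\<lambda>i. norm (f i)) UNIV"
    by (rule L2_set_mult_ineq)
  finally show ?thesis by (simp add: L2_set_constant)
qed

text \<open>Sharpness concerns the sum of the \<open>f i\<close> at a single point, so it is used at
  the common reference \<open>p\<close>. Moving function values from \<open>x i\<close> to
  \<open>p\<close> costs \<open>L\<close>, and moving the distance to \<open>y\<close> back to
  \<open>x i\<close> costs \<kappa>, both times the summed distance of the agents from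
  \<open>p\<close>.\<close>

lemma sharp_subgradient_bound:
  fixes f :: "'n::finite \<Rightarrow> 'a::real_inner \<Rightarrow> real"
  assumes lower: "\<And>i. f i y \<ge> f i (x i) + \<xi> i \<bullet> (y - x i) - (\<rho> + L) / 2 * (norm (y - x i))\<^sup>2"
    and lip: "\<And>i. f i p - f i (x i) \<le> L * norm (x i - p)"
    and sharp: "CARD('n) * (\<kappa> * norm (p - y)) \<le> (\<Sum>i\<in>UNIV. f i p - f i y)"
    and k: "0 \<le> \<kappa>" and L: "0 \<le> L"
  shows "\<kappa> * (\<Sum>i\<in>UNIV. norm (x i - y)) - (\<kappa> + L) * (sqrt CARD('n) * L2_set (\<lambda>i. norm (x i - p)) UNIV)
    - (\<rho> + L) / 2 * (\<Sum>i\<in>UNIV. (norm (x i - y))\<^sup>2) \<le> (\<Sum>i\<in>UNIV. \<xi> i \<bullet> (x i - y))"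
proof -
  have "(f i p - f i y) - L * norm (x i - p) - (\<rho> + L) / 2 * (norm (x i - y))\<^sup>2 \<le> \<xi> i \<bullet> (x i - y)" for i
    using lower[of i] lip[of i] by (simp add: inner_diff_right norm_minus_commute)
  then have "(\<Sum>i\<in>UNIV. (f i p - f i y) - L * norm (x i - p) - (\<rho> + L) / 2 * (norm (x i - y))\<^sup>2)
      \<le> (\<Sum>i\<in>UNIV. \<xi> i \<bullet> (x i - y))" by (rule sum_mono)
  then have 1: "(\<Sum>i\<in>UNIV. f i p - f i y) - L * (\<Sum>i\<in>UNIV. norm (x i - p)) - (\<rho> + L) / 2 * (\<Sum>i\<in>UNIV. (norm (x i - y))\<^sup>2)
      \<le> (\<Sum>i\<in>UNIV. \<xi> i \<bullet> (x i - y))" by (simp only: sum_subtractf sum_distrib_left)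
  have "(\<Sum>i\<in>UNIV. norm (x i - y)) \<le> (\<Sum>i\<in>UNIV. norm (x i - p) + norm (p - y))"
    by (intro sum_mono) (metis norm_triangle_ineq diff_add_cancel add_diff_eq)
  also have "\<dots> = (\<Sum>i\<in>UNIV. norm (x i - p)) + CARD('n) * norm (p - y)" by (simp add: sum.distrib)
  finally have "\<kappa> * (\<Sum>i\<in>UNIV. norm (x i - y)) \<le> \<kappa> * (\<Sum>i\<in>UNIV. norm (x i - p)) + CARD('n) * (\<kappa> * norm (p - y))"
    using k by (metis distrib_left mult.left_commute mult_left_mono)
  moreover have "(\<kappa> + L) * (\<Sum>i\<in>UNIV. norm (x i - p)) \<le> (\<kappa> + L) * (sqrt CARD('n) * L2_set (\<lambda>i. norm (x i - p)) UNIV)"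
    using k L by (intro mult_left_mono sum_le_sqrt_card_L2) simp
  moreover have "(\<kappa> + L) * (\<Sum>i\<in>UNIV. norm (x i - p)) = \<kappa> * (\<Sum>i\<in>UNIV. norm (x i - p)) + L * (\<Sum>i\<in>UNIV. norm (x i - p))"
    by (rule distrib_right)
  ultimately show ?thesis using 1 sharp by linarith
qed

text \<open>Here \<open>s\<close> stands for \<open>\<surd>n\<close> and \<open>c\<close> for the consensus error. The term \<open>L\<^sup>2\<close> coming from
  the subgradient steps is absorbed by the slack in \<open>a \<ge> 2 L\<^sup>2\<close>.\<close>

lemma consensus_cost_bound:
  fixes \<alpha> L Lt \<kappa> r s c C \<beta> :: real
  assumes c: "0 \<le> c" "c \<le> s * L * \<beta> * C" and C: "2 \<le> C"
    and pos: "0 < \<alpha>" "0 < L" "0 \<le> Lt" "Lt \<le> 2" "0 \<le> \<kappa>" "1 \<le> r" "0 < \<beta>" "0 \<le> s"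
    and a: "a = 2 * (L + \<kappa> + \<alpha> * L * Lt) * L"
    and b: "b = (4 * \<alpha> * sqrt r + 2 * \<alpha>\<^sup>2 * r) * Lt * L\<^sup>2"
  shows "2 * \<beta> * ((\<kappa> + L) * (s * c)) + 2 * \<alpha> * Lt * c\<^sup>2 + (\<alpha> * (Lt * c) + s * L * \<beta>)\<^sup>2
    \<le> s\<^sup>2 * \<beta>\<^sup>2 * (C\<^sup>2 * (a + b))"
proof -
  let ?c = "s * L * \<beta> * C"
  have "2 * \<beta> * ((\<kappa> + L) * (s * c)) + 2 * \<alpha> * Lt * c\<^sup>2 + (\<alpha> * (Lt * c) + s * L * \<beta>)\<^sup>2
      \<le> 2 * \<beta> * ((\<kappa> + L) * (s * ?c)) + 2 * \<alpha> * Lt * ?c\<^sup>2 + (\<alpha> * (Lt * ?c) + s * L * \<beta>)\<^sup>2"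
    using pos c by (intro add_mono mult_left_mono power_mono add_right_mono) auto
  also have "\<dots> = s\<^sup>2 * \<beta>\<^sup>2 * (C * a + C\<^sup>2 * ((2 * \<alpha> + \<alpha>\<^sup>2 * Lt) * Lt * L\<^sup>2) + L\<^sup>2)"
    by (simp add: a power2_eq_square algebra_simps)
  also have "\<dots> \<le> s\<^sup>2 * \<beta>\<^sup>2 * (C\<^sup>2 * (a + b))"
  proof (rule mult_left_mono)
    have la: "2 * L\<^sup>2 \<le> a"
      using pos by (simp add: a power2_eq_square algebra_simps)
    then have a0: "0 \<le> a" using zero_le_power2[of L] by linarith
    \<comment> \<open>Since \<open>C \<ge> 2\<close>, one half of \<open>C\<^sup>2 * a\<close>
      dominates \<open>C * a\<close> and the other half dominates \<open>L\<^sup>2\<close>.\<close>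
    have CC: "2 * C \<le> C\<^sup>2" using C by (simp add: power2_eq_square mult_right_mono)
    have 1: "C * a \<le> C\<^sup>2 / 2 * a" using CC a0 by (intro mult_right_mono) auto
    have "4 \<le> C\<^sup>2" using CC C by linarith
    then have "1 * a \<le> C\<^sup>2 / 4 * a" using a0 by (intro mult_right_mono) auto
    then have 2: "L\<^sup>2 \<le> C\<^sup>2 / 2 * a" using la a0 by (simp add: field_simps)
    have "(2 * \<alpha> + \<alpha>\<^sup>2 * Lt) * Lt * L\<^sup>2 \<le> b"
      unfolding b
    proof (intro mult_right_mono add_mono)
      have "1 \<le> sqrt r" using pos by simp
      then have "1 \<le> 2 * sqrt r" by linarith
      then show "2 * \<alpha> \<le> 4 * \<alpha> * sqrt r" using pos by simp
      show "\<alpha>\<^sup>2 * Lt \<le> 2 * \<alpha>\<^sup>2 * r"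
        using mult_left_mono[of Lt "2 * r" "\<alpha>\<^sup>2"] pos by simp
    qed (use pos in auto)
    then have 3: "C\<^sup>2 * ((2 * \<alpha> + \<alpha>\<^sup>2 * Lt) * Lt * L\<^sup>2) \<le> C\<^sup>2 * b" by (intro mult_left_mono) auto
    show "C * a + C\<^sup>2 * ((2 * \<alpha> + \<alpha>\<^sup>2 * Lt) * Lt * L\<^sup>2) + L\<^sup>2 \<le> C\<^sup>2 * (a + b)"
      using 1 2 3 by (simp add: distrib_left)
  qed simp
  finally show ?thesis .
qed

text \<open>Here \<open>G\<close> is the current power of the rate. Once the sharpness gain is a
  multiple of \<open>D\<close>, the condition \<open>small\<close> makes the coefficient of
  \<open>D\<close> nonnegative, so \<open>D\<close> may be replaced by its inductive bound; this is
  the step that would fail for a large stepsize.\<close>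

lemma linear_rate_step:
  fixes D D' S T c e G \<beta> \<mu> :: real
  assumes desc: "D' \<le> D - 2 * \<beta> * S + R"
    and S: "\<kappa> * T - (\<rho> + L) / 2 * D - K \<le> S"
    and T: "D \<le> T * (\<Gamma> * (G * e))" and D: "D \<le> N * (G\<^sup>2 * e\<^sup>2)"
    and \<beta>: "\<beta> = \<mu> * G" and G: "0 < G" "G \<le> 1"
    and R: "2 * \<beta> * K + R \<le> N * \<beta>\<^sup>2 * Q"
    and pos: "0 < \<mu>" "0 < e" "0 < \<Gamma>" "0 \<le> \<kappa>" "0 \<le> \<rho> + L" "0 \<le> N"
    and small: "2 * \<kappa> * \<mu> \<le> \<Gamma> * e"
  shows "D' \<le> N * G\<^sup>2 * (e\<^sup>2 - \<mu> * (2 * \<kappa> * e / \<Gamma> - (\<rho> + L) * e\<^sup>2) + \<mu>\<^sup>2 * Q)"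
proof -
  have b: "0 < \<beta>" using \<beta> pos G by simp
  have "2 * \<beta> * (\<kappa> * T - (\<rho> + L) / 2 * D - K) \<le> 2 * \<beta> * S"
    using b by (intro mult_left_mono S) auto
  moreover have "2 * \<beta> * (\<kappa> * T - (\<rho> + L) / 2 * D - K) =
      2 * \<beta> * \<kappa> * T - \<beta> * (\<rho> + L) * D - 2 * \<beta> * K"
    by (simp add: field_simps)
  ultimately have 1: "D' \<le> D - 2 * \<beta> * \<kappa> * T + \<beta> * (\<rho> + L) * D + N * \<beta>\<^sup>2 * Q"
    using desc R by linarith
  have "2 * \<mu> * \<kappa> / (\<Gamma> * e) * D \<le> 2 * \<mu> * \<kappa> / (\<Gamma> * e) * (T * (\<Gamma> * (G * e)))"
    using pos by (intro mult_left_mono T) auto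
  also have "\<dots> = 2 * \<beta> * \<kappa> * T" using pos by (simp add: \<beta>)
  finally have 2: "D' \<le> (1 - 2 * \<mu> * \<kappa> / (\<Gamma> * e) + \<beta> * (\<rho> + L)) * D + N * \<beta>\<^sup>2 * Q"
    using 1 by (simp add: algebra_simps)
  have "2 * \<mu> * \<kappa> / (\<Gamma> * e) \<le> 1" using small pos by (simp add: divide_le_eq mult_ac)
  then have "(1 - 2 * \<mu> * \<kappa> / (\<Gamma> * e) + \<beta> * (\<rho> + L)) * D
      \<le> (1 - 2 * \<mu> * \<kappa> / (\<Gamma> * e) + \<beta> * (\<rho> + L)) * (N * (G\<^sup>2 * e\<^sup>2))"
    using b pos by (intro mult_left_mono D add_nonneg_nonneg) auto
  also have "\<dots> \<le> (1 - 2 * \<mu> * \<kappa> / (\<Gamma> * e) + \<mu> * (\<rho> + L)) * (N * (G\<^sup>2 * e\<^sup>2))"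
    using G pos by (intro mult_right_mono add_left_mono) (auto simp: \<beta> mult_left_le)
  also have "\<dots> = N * G\<^sup>2 * (e\<^sup>2 - \<mu> * (2 * \<kappa> * e / \<Gamma> - (\<rho> + L) * e\<^sup>2))"
    using pos by (simp add: field_simps power2_eq_square)
  finally have "D' \<le> N * G\<^sup>2 * (e\<^sup>2 - \<mu> * (2 * \<kappa> * e / \<Gamma> - (\<rho> + L) * e\<^sup>2)) + N * \<beta>\<^sup>2 * Q"
    using 2 by linarith
  also have "\<dots> = N * G\<^sup>2 * (e\<^sup>2 - \<mu> * (2 * \<kappa> * e / \<Gamma> - (\<rho> + L) * e\<^sup>2) + \<mu>\<^sup>2 * Q)"
    by (simp add: \<beta> power_mult_distrib algebra_simps)
  finally show ?thesis .
qed

text \<open>Powers of \<rho> approach 1 as the exponent shrinks, so both lower bounds can be met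
  together. The first lets the consensus recursion follow the stepsizes; the second, reached through
  the square of \<open>1 - \<epsilon> / 2\<close>, serves the distance to the minimizer.\<close>

lemma powr_exponent_near_one:
  fixes \<rho> \<epsilon> :: real
  assumes \<rho>: "0 < \<rho>" "\<rho> < 1" and eps: "0 < \<epsilon>"
  obtains \<delta> where "0 < \<delta>" "\<delta> < 1" "(1 + \<rho>) / 2 \<le> \<rho> powr \<delta>" "1 - \<epsilon> \<le> (\<rho> powr \<delta>)\<^sup>2" "\<rho> powr \<delta> < 1"
proof -
  define \<theta> where "\<theta> = max ((1 + \<rho>) / 2) (1 - \<epsilon> / 2)"
  have \<theta>: "0 < \<theta>" "\<theta> < 1" "(1 + \<rho>) / 2 \<le> \<theta>" "1 - \<epsilon> / 2 \<le> \<theta>" using \<rho> eps by (auto simp: \<theta>_def less_max_iff_disj)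
  define \<delta> where "\<delta> = min (1 / 2) (ln \<theta> / ln \<rho>)"
  have l: "ln \<rho> < 0" "ln \<theta> < 0" using \<rho> \<theta> by auto
  then have d: "0 < \<delta>" "\<delta> < 1" by (auto simp: \<delta>_def divide_neg_neg)
  have "\<delta> \<le> ln \<theta> / ln \<rho>" by (simp add: \<delta>_def)
  then have "ln \<theta> \<le> \<delta> * ln \<rho>" using l by (simp add: neg_le_divide_eq)
  then have "exp (ln \<theta>) \<le> exp (\<delta> * ln \<rho>)" by (rule exp_le_cancel_iff[THEN iffD2])
  then have t: "\<theta> \<le> \<rho> powr \<delta>" using \<rho> \<theta> by (simp add: powr_def)
  have "1 - \<epsilon> \<le> (\<rho> powr \<delta>)\<^sup>2"
  proof (cases "\<epsilon> \<le> 2")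
    case True
    have "1 - \<epsilon> \<le> (1 - \<epsilon> / 2)\<^sup>2" by (simp add: power2_eq_square algebra_simps)
    also have "\<dots> \<le> (\<rho> powr \<delta>)\<^sup>2" using True \<theta> t by (intro power_mono) auto
    finally show ?thesis .
  next
    case False
    then show ?thesis using zero_le_power2[of "\<rho> powr \<delta>"] by linarith
  qed
  moreover have "\<rho> powr \<delta> < 1" using \<rho> mult_pos_neg[OF d(1) l(1)] by (simp add: powr_def)
  ultimately show ?thesis using that d \<theta> t by (meson order_trans)
qed

text \<open>The stepsize bound gives at most \<open>\<nu> * (1 - \<nu>)\<close> times the square of
  \<open>2 - \<delta>2\<^sup>2\<close>, which is strictly below
  \<open>4 * \<nu> * (1 - \<nu>) \<le> 1\<close>. So the number under the root in
  \<open>\<rho>\<^sub>t\<close> is positive and real powers of \<open>\<rho>\<^sub>t\<close> behave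
  as intended.\<close>

lemma contraction_factor_lt_1:
  fixes \<alpha> \<nu> \<delta>2 w mt Lt :: real
  assumes nu: "0 < \<nu>" "\<nu> < 1" and a: "0 < \<alpha>" "\<alpha> * Lt \<le> \<nu> * (2 - \<delta>2\<^sup>2)"
    and d: "0 < \<delta>2" "\<delta>2 \<le> 1" and w: "0 \<le> w" "w \<le> 1" and mt: "0 \<le> mt" "mt \<le> Lt"
  shows "2 * (1 - \<nu>) * \<alpha> * (w * (1 - \<delta>2\<^sup>2 / 2) * mt) < 1"
proof -
  let ?F = "2 - \<delta>2\<^sup>2"
  have F: "0 < ?F" "?F < 2" using d power_le_one[of \<delta>2 2] by auto
  have "2 * (1 - \<nu>) * \<alpha> * (w * (1 - \<delta>2\<^sup>2 / 2) * mt) = (1 - \<nu>) * ?F * (w * (\<alpha> * mt))"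
    by (simp add: field_simps)
  also have "\<dots> \<le> (1 - \<nu>) * ?F * (1 * (\<nu> * ?F))"
  proof (rule mult_left_mono)
    have "\<alpha> * mt \<le> \<nu> * ?F" using mult_left_mono[OF mt(2), of \<alpha>] a by linarith
    then show "w * (\<alpha> * mt) \<le> 1 * (\<nu> * ?F)" using w a mt by (intro mult_mono[OF w(2)]) auto
  qed (use nu F in auto)
  also have "\<dots> = \<nu> * (1 - \<nu>) * (?F * ?F)" by simp
  also have "\<dots> < \<nu> * (1 - \<nu>) * (2 * 2)"
    using nu F by (intro mult_strict_left_mono mult_strict_mono) auto
  also have "\<dots> \<le> 1" using zero_le_power2[of "1 - 2 * \<nu>"] by (simp add: power2_eq_square algebra_simps)
  finally show ?thesis .
qed

theorem theorem5p2:
  fixes f :: "'n::finite \<Rightarrow> real^'r::finite^'d::finite \<Rightarrow> real"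
    and \<rho> L M :: real
    and W :: "real^'n^'n"
    and t :: nat
    and \<alpha> \<nu> \<delta>\<^sub>1 \<delta>\<^sub>2 \<kappa> B \<Gamma> \<mu>\<^sub>0 :: real
    and x\<^sub>0 :: "'n \<Rightarrow> real^'r^'d"
    and xs :: "real^'r^'d"
    and n r L\<^sub>t \<mu>\<^sub>t \<sigma>\<^sub>2 \<Phi> \<gamma>\<^sub>t \<rho>\<^sub>t e\<^sub>0 a b q :: real
    and Wt :: "real^'n^'n"
    and F :: "real^'r^'d \<Rightarrow> real"
  assumes def0: "n = real CARD('n)"
    and def1: "r = real CARD('r)"
    and def2: "Wt = mpow W t"
    and def3: "L\<^sub>t = 1 - eig_min (mpow W t)"
    and def4: "\<mu>\<^sub>t = 1 - eig_k 2 (mpow W t)"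
    and def5: "\<sigma>\<^sub>2 = sing_k 2 W"
    and def6: "\<Phi> = 2 - \<delta>\<^sub>2\<^sup>2"
    and def7: "\<gamma>\<^sub>t = (1 - 4 * r * \<delta>\<^sub>1\<^sup>2) * (1 - \<delta>\<^sub>2\<^sup>2 / 2) * \<mu>\<^sub>t"
    and def8: "\<rho>\<^sub>t = sqrt (1 - 2 * (1 - \<nu>) * \<alpha> * \<gamma>\<^sub>t)"
    and def9: "F = (\<lambda>x. (1 / n) * (\<Sum>i\<in>UNIV. f i x))"
    and def10: "e\<^sub>0 = min (max (\<kappa> / ((\<rho> + L) * \<Gamma>)) (sqrt ((1 / n) * (\<Sum>i\<in>UNIV. (norm (x\<^sub>0 i - xs))\<^sup>2)))) (B / \<Gamma>)"
    and def11: "a = 2 * (L + \<kappa> + \<alpha> * L * L\<^sub>t) * L"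
    and def12: "b = (4 * \<alpha> * sqrt r + 2 * \<alpha>\<^sup>2 * r) * L\<^sub>t * L\<^sup>2"
    and def13: "q = 2 * \<kappa> * e\<^sub>0 / \<Gamma> - (\<rho> + L) * e\<^sub>0\<^sup>2"
    and dr: "CARD('r) \<le> CARD('d)"
    and n2: "CARD('n) \<ge> 2"
    \<comment> \<open>weak convexity\<close>
    and rho: "\<rho> \<ge> 0"
    and wconv: "\<forall>i. convex_on UNIV (\<lambda>x. f i x + \<rho> / 2 * (norm x)\<^sup>2)"
    \<comment> \<open>the constant L\<close>
    and Lpos: "L > 0"
    and Lip: "\<exists>U. bounded U \<and> open U \<and> convex U \<and> stiefel \<subseteq> U \<and> (\<forall>i. L-lipschitz_on U (f i))"
    and Lineq: "\<forall>i. \<forall>x\<in>stiefel. \<forall>y\<in>stiefel. \<forall>\<xi>\<in>riem_subdiff \<rho> (f i) x.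
                  f i y \<ge> f i x + inner \<xi> (y - x) - (\<rho> + L) / 2 * (norm (y - x))\<^sup>2"
    and Lbound: "\<forall>i. \<forall>x\<in>stiefel. \<forall>\<xi>\<in>riem_subdiff \<rho> (f i) x. norm \<xi> \<le> L"
    \<comment> \<open>network / mixing matrix\<close>
    and Wsym: "transpose W = W"
    and Wnonneg: "\<forall>i j. W $ i $ j \<ge> 0"
    and Wstoch: "\<forall>i. (\<Sum>j\<in>UNIV. W $ i $ j) = 1"
    and graph: "\<exists>E :: 'n \<Rightarrow> 'n \<Rightarrow> bool.
                  (\<forall>i j. E i j \<longrightarrow> E j i) \<and> (\<forall>i. \<not> E i i) \<and>
                  (\<forall>i j. (i, j) \<in> {(u, v). E u v}\<^sup>*) \<and>
                  (\<forall>i j. W $ i $ j = 0 \<longleftrightarrow> \<not> (j = i \<or> E i j))"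
    \<comment> \<open>retraction constant\<close>
    and Mpos: "M > 0"
    and Mretr: "\<forall>x\<in>(stiefel :: (real^'r^'d) set). \<forall>\<xi>\<in>tangent_space x. norm (polar_retr x \<xi> - (x + \<xi>)) \<le> M * (norm \<xi>)\<^sup>2"
    \<comment> \<open>algorithm parameters\<close>
    and delta2: "\<delta>\<^sub>2 \<le> 1 / 6"
    and delta1: "\<delta>\<^sub>1 \<le> \<delta>\<^sub>2 / (5 * sqrt r)"
    and nu: "0 < \<nu>" "\<nu> < 1"
    and alpha: "0 < \<alpha>" "\<alpha> \<le> min (\<nu> * \<Phi> / L\<^sub>t) (min 1 (1 / M))"
    and tlow: "t \<ge> 1" "real t \<ge> of_int \<lceil>log \<sigma>\<^sub>2 (1 / (2 * sqrt n))\<rceil>"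
    \<comment> \<open>isolated weak sharp minimum\<close>
    and xs: "xs \<in> stiefel"
    and kappa: "\<kappa> > 0" and Bpos: "B > 0"
    and sharp: "\<forall>x\<in>stiefel. norm (x - xs) < B \<longrightarrow> F x - F xs \<ge> \<kappa> * norm (x - xs)"
    and Gamma: "\<Gamma> \<ge> 3"
    \<comment> \<open>initialization\<close>
    and x0M: "\<forall>i. x\<^sub>0 i \<in> stiefel"
    and init1: "(\<Sum>i\<in>UNIV. (norm (x\<^sub>0 i - xs))\<^sup>2) < n / \<Gamma>\<^sup>2 * min ((2 * \<kappa> / (\<rho> + L))\<^sup>2) (B\<^sup>2)"
    and init2: "sqrt (\<Sum>i\<in>UNIV. (norm (x\<^sub>0 i - proj_stiefel ((1 / n) *\<^sub>R (\<Sum>j\<in>UNIV. x\<^sub>0 j))))\<^sup>2) = 0"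
    \<comment> \<open>initial stepsize\<close>
    and mu0: "0 < \<mu>\<^sub>0" "\<mu>\<^sub>0 \<le> min ((1 - \<rho>\<^sub>t) * \<delta>\<^sub>1 / L) (\<alpha> * \<delta>\<^sub>1 / (5 * L))"
      "\<mu>\<^sub>0 < min (e\<^sub>0 / (2 * \<kappa> - (\<rho> + L) * e\<^sub>0))
              (min (q / (L\<^sup>2 * e\<^sub>0\<^sup>2 + 4 * (a + b) / (1 - \<rho>\<^sub>t)\<^sup>2))
                   ((1 - \<rho>\<^sub>t) * e\<^sub>0 / (2 * sqrt n * L)))"
  shows "\<exists>\<delta>. 0 < \<delta> \<and> \<delta> < 1 \<and>
    (\<forall>(x :: nat \<Rightarrow> 'n \<Rightarrow> real^'r^'d) (\<xi> :: nat \<Rightarrow> 'n \<Rightarrow> real^'r^'d).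
       x 0 = x\<^sub>0 \<longrightarrow>
       (\<forall>k i. \<xi> k i \<in> riem_subdiff \<rho> (f i) (x k i)) \<longrightarrow>
       (\<forall>k i. x (Suc k) i =
          polar_retr (x k i)
            (\<alpha> *\<^sub>R proj_tangent (x k i) (\<Sum>j\<in>UNIV. Wt $ i $ j *\<^sub>R x k j)
             - (\<mu>\<^sub>0 * (\<rho>\<^sub>t powr \<delta>) ^ k) *\<^sub>R \<xi> k i)) \<longrightarrow>
       (\<forall>k. (\<Sum>i\<in>UNIV. (norm (x k i - xs))\<^sup>2) \<le> n * ((\<rho>\<^sub>t powr \<delta>) ^ (2 * k)) * e\<^sub>0\<^sup>2 \<and>
            (\<forall>i. (norm (x k i - xs))\<^sup>2 \<le> \<Gamma>\<^sup>2 * ((\<rho>\<^sub>t powr \<delta>) ^ (2 * k)) * e\<^sub>0\<^sup>2)))"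
proof -
  have rpos: "1 \<le> r" by (simp add: def1 Suc_leI)
  have npos: "2 \<le> n" using n2 by (simp add: def0)
  have W: "sym_stochastic W"
    using Wsym Wnonneg Wstoch by (simp add: sym_stochastic_def)
  obtain E :: "'n \<Rightarrow> 'n \<Rightarrow> bool" where conn: "\<forall>i j. (i, j) \<in> {(u, v). E u v}\<^sup>*"
    and supp: "\<forall>i j. W $ i $ j = 0 \<longleftrightarrow> \<not> (j = i \<or> E i j)"
    using graph by blast
  have Wpos: "W $ i $ j > 0" if "j = i \<or> E i j" for i j
    using that supp Wnonneg by (metis order_le_less)
  have "{(u, v). E u v} \<subseteq> {(u, v). W $ u $ v > 0}" using Wpos by auto
  then have Wconn: "(i, j) \<in> {(u, v). W $ u $ v > 0}\<^sup>*" for i j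
    using conn rtrancl_mono by blast
  have s2: "0 \<le> \<sigma>\<^sub>2" "\<sigma>\<^sub>2 < 1"
    unfolding def5 using sing2_bounds[OF W n2 Wpos Wconn] by auto
  have Pst: "sym_stochastic Wt" unfolding def2 by (rule sym_stochastic_mpow[OF W])
  have L\<^sub>t: "L\<^sub>t = 1 - eig_min Wt" and \<mu>\<^sub>t: "\<mu>\<^sub>t = 1 - eig_k 2 Wt" by (simp_all add: def2 def3 def4)
  have Ltb: "\<mu>\<^sub>t \<le> L\<^sub>t" "L\<^sub>t \<le> 2"
    using stochastic_eig_bounds[OF Pst n2] by (auto simp: L\<^sub>t \<mu>\<^sub>t)
  have dev: "(\<Sum>j\<in>UNIV. \<bar>Wt $ i $ j - 1 / CARD('n)\<bar>) \<le> 1 / 2" for i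
  proof -
    have sn: "1 \<le> sqrt n" "0 < sqrt n" using npos by auto
    have "\<sigma>\<^sub>2 ^ t \<le> 1 / (2 * sqrt n)"
    proof (rule power_le_of_log_le[OF s2 _ _ tlow])
      have "1 < 2 * sqrt n" using sn by linarith
      then show "1 / (2 * sqrt n) < 1" using npos by (simp add: divide_less_eq)
    qed (use npos in simp)
    then have "sqrt n * \<sigma>\<^sub>2 ^ t \<le> sqrt n * (1 / (2 * sqrt n))"
      using sn by (intro mult_left_mono) auto
    then show ?thesis
      using mpow_row_deviation[OF W n2, where t=t and i=i] s2 sn by (simp add: def0 def2 def5)
  qed

  \<comment> \<open>Positivity of the radii is read off from the existence of a positive stepsize
    below a multiple of \<open>\<delta>\<^sub>1\<close>.\<close>
  have d1: "0 < \<delta>\<^sub>1"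
  proof -
    have "0 < \<alpha> * \<delta>\<^sub>1 / (5 * L)" using mu0(1,2) by linarith
    then show ?thesis using alpha(1) Lpos by (simp add: zero_less_divide_iff zero_less_mult_iff)
  qed
  have sr: "1 \<le> sqrt r" using rpos by simp
  have d2: "0 < \<delta>\<^sub>2"
  proof -
    have "0 < \<delta>\<^sub>2 / (5 * sqrt r)" using d1 delta1 by linarith
    then show ?thesis using sr by (simp add: zero_less_divide_iff)
  qed
  have d12: "\<delta>\<^sub>1 \<le> \<delta>\<^sub>2 / 5"
    using delta1 d2 sr by (smt (verit) frac_le mult_left_mono mult.right_neutral)
  have "5 * sqrt r * \<delta>\<^sub>1 \<le> \<delta>\<^sub>2" using delta1 sr by (simp add: pos_le_divide_eq mult.commute)
  then have "(5 * sqrt r * \<delta>\<^sub>1)\<^sup>2 \<le> 1\<^sup>2"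
    using delta2 sr d1 by (intro power_mono) auto
  then have "25 * (r * \<delta>\<^sub>1\<^sup>2) \<le> 1" using rpos by (simp add: power_mult_distrib)
  moreover have "0 \<le> r * \<delta>\<^sub>1\<^sup>2" using rpos by simp
  ultimately have w: "0 < 1 - 4 * r * \<delta>\<^sub>1\<^sup>2" "1 - 4 * r * \<delta>\<^sub>1\<^sup>2 \<le> 1" by linarith+
  have d2s: "0 < \<delta>\<^sub>2\<^sup>2" "\<delta>\<^sub>2\<^sup>2 \<le> 1" using d2 delta2 power_le_one[of \<delta>\<^sub>2 2] by auto
  \<comment> \<open>Again from the stepsize bound. Strict contraction then forces
    \<open>\<gamma>\<^sub>t\<close>, \<open>\<mu>\<^sub>t\<close> and \<open>L\<^sub>t\<close> to be
    positive, so the spectral gap of the power needs no separate argument.\<close>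
  have \<rho>1: "\<rho>\<^sub>t < 1"
  proof -
    have "0 < (1 - \<rho>\<^sub>t) * \<delta>\<^sub>1 / L" using mu0(1,2) by linarith
    then show ?thesis using d1 Lpos by (simp add: zero_less_divide_iff zero_less_mult_iff)
  qed
  have "0 < 2 * (1 - \<nu>) * \<alpha> * \<gamma>\<^sub>t"
    using \<rho>1 real_sqrt_lt_1_iff[of "1 - 2 * (1 - \<nu>) * \<alpha> * \<gamma>\<^sub>t"] by (simp add: def8)
  then have "0 < \<gamma>\<^sub>t" by (rule zero_less_mult_pos) (use nu alpha(1) in simp)
  then have mt: "0 < \<mu>\<^sub>t"
    unfolding def7 by (rule zero_less_mult_pos) (use w(1) d2s in \<open>auto intro!: mult_pos_pos\<close>)
  then have Ltp: "0 < L\<^sub>t" using Ltb by simp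
  have "\<alpha> \<le> \<nu> * \<Phi> / L\<^sub>t" and a1: "\<alpha> \<le> 1" and "\<alpha> \<le> 1 / M" using alpha(2) by auto
  then have aL: "\<alpha> * L\<^sub>t \<le> \<nu> * (2 - \<delta>\<^sub>2\<^sup>2)" and aM: "\<alpha> * M \<le> 1"
    using Ltp Mpos by (simp_all add: def6 pos_le_divide_eq)
  have \<rho>0: "0 < \<rho>\<^sub>t"
    unfolding def8 def7
    using contraction_factor_lt_1[OF nu alpha(1) aL d2 _ _ w(2) _ Ltb(1)] w(1) mt delta2 by simp

  have rL: "0 < \<rho> + L" using rho Lpos by simp
  define D\<^sub>0 where "D\<^sub>0 = sqrt ((1 / n) * (\<Sum>i\<in>UNIV. (norm (x\<^sub>0 i - xs))\<^sup>2))"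
  have D0_sq: "D\<^sub>0\<^sup>2 = (1 / n) * (\<Sum>i\<in>UNIV. (norm (x\<^sub>0 i - xs))\<^sup>2)" "0 \<le> D\<^sub>0"
    using npos by (simp_all add: D\<^sub>0_def sum_nonneg)
  have init: "D\<^sub>0 < 2 * \<kappa> / ((\<rho> + L) * \<Gamma>)" "D\<^sub>0 < B / \<Gamma>"
  proof -
    have m: "D\<^sub>0\<^sup>2 < min ((2 * \<kappa> / (\<rho> + L))\<^sup>2) (B\<^sup>2) / \<Gamma>\<^sup>2"
      using init1 npos unfolding D0_sq by (simp add: field_simps)
    have "min ((2 * \<kappa> / (\<rho> + L))\<^sup>2) (B\<^sup>2) / \<Gamma>\<^sup>2 \<le> (2 * \<kappa> / ((\<rho> + L) * \<Gamma>))\<^sup>2"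
      using Gamma by (simp add: power_mult_distrib power_divide divide_right_mono
          flip: divide_divide_eq_left)
    then show "D\<^sub>0 < 2 * \<kappa> / ((\<rho> + L) * \<Gamma>)"
      using m kappa rL Gamma by (intro power_less_imp_less_base[of D\<^sub>0 2]) auto
    have "min ((2 * \<kappa> / (\<rho> + L))\<^sup>2) (B\<^sup>2) / \<Gamma>\<^sup>2 \<le> (B / \<Gamma>)\<^sup>2"
      by (simp add: power_divide divide_right_mono)
    then show "D\<^sub>0 < B / \<Gamma>"
      using m Bpos Gamma by (intro power_less_imp_less_base[of D\<^sub>0 2]) auto
  qed
  \<comment> \<open>This entry of the maximum keeps \<open>e\<^sub>0\<close> positive even when all
    agents start at the minimizer, while staying below the threshold
    \<open>2 * \<kappa> / ((\<rho> + L) * \<Gamma>)\<close>.\<close>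
  have A: "0 < \<kappa> / ((\<rho> + L) * \<Gamma>)" "\<kappa> / ((\<rho> + L) * \<Gamma>) < 2 * \<kappa> / ((\<rho> + L) * \<Gamma>)"
    using kappa rL Gamma by (auto intro!: divide_strict_right_mono)
  have e0: "0 < e\<^sub>0" "D\<^sub>0 \<le> e\<^sub>0" "e\<^sub>0 \<le> B / \<Gamma>" "e\<^sub>0 < 2 * \<kappa> / ((\<rho> + L) * \<Gamma>)"
    using init A Bpos Gamma unfolding def10 D\<^sub>0_def[symmetric] by (auto simp: less_max_iff_disj min_less_iff_disj)
  have e0k: "(\<rho> + L) * e\<^sub>0 < 2 * \<kappa> / \<Gamma>"
  proof -
    have "0 < (\<rho> + L) * \<Gamma>" using rL Gamma by simp
    then have "e\<^sub>0 * ((\<rho> + L) * \<Gamma>) < 2 * \<kappa>" using e0(4) by (simp only: pos_less_divide_eq)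
    then show ?thesis using Gamma by (simp add: pos_less_divide_eq mult_ac)
  qed
  have kG: "2 * \<kappa> / \<Gamma> \<le> \<kappa>" using kappa Gamma by (simp add: field_simps)

  \<comment> \<open>\<open>C\<close> solves
    \<open>(1 + \<rho>\<^sub>t) / 2 * C = \<rho>\<^sub>t * C + 1\<close>: a consensus error of
    \<open>C\<close> times the subgradient scale is reproduced when stepsizes shrink no faster than
    by the midpoint between \<open>\<rho>\<^sub>t\<close> and 1. Its square is the factor of
    \<open>a + b\<close> in \<open>Q\<close>.\<close>
  define C where "C = 2 / (1 - \<rho>\<^sub>t)"
  have C: "2 \<le> C" "C * (1 - \<rho>\<^sub>t) = 2" using \<rho>0 \<rho>1 by (auto simp: C_def field_simps)
  define Q where "Q = L\<^sup>2 * e\<^sub>0\<^sup>2 + 4 * (a + b) / (1 - \<rho>\<^sub>t)\<^sup>2"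
  have "0 \<le> a" "0 \<le> b"
    using Lpos kappa alpha(1) Ltp rpos by (auto simp: def11 def12 intro!: mult_nonneg_nonneg add_nonneg_nonneg)
  then have Qp: "0 < Q" using Lpos e0(1) by (auto simp: Q_def intro!: add_pos_nonneg divide_nonneg_nonneg)
  have CQ: "C\<^sup>2 * (a + b) \<le> Q" by (simp add: C_def Q_def power_divide)
  \<comment> \<open>The first bound keeps the total consensus error in the region, the second the
    error of each agent. Below, \<open>mu2\<close> makes the coefficient in the rate step
    nonnegative, \<open>mu3\<close> leaves a strict decrease, and \<open>mu4\<close> keeps the
    consensus error within the target accuracy.\<close>
  have mu1: "\<mu>\<^sub>0 * L \<le> (1 - \<rho>\<^sub>t) * \<delta>\<^sub>1" "\<mu>\<^sub>0 * L \<le> \<alpha> * \<delta>\<^sub>1 / 5"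
    using mu0(2) Lpos by (simp_all add: field_simps)
  have mu2: "2 * \<kappa> * \<mu>\<^sub>0 \<le> \<Gamma> * e\<^sub>0"
  proof -
    have "\<mu>\<^sub>0 < e\<^sub>0 / (2 * \<kappa> - (\<rho> + L) * e\<^sub>0)" using mu0(3) by simp
    moreover have "0 < 2 * \<kappa> - (\<rho> + L) * e\<^sub>0" using e0k kG kappa by linarith
    ultimately have "\<mu>\<^sub>0 * (2 * \<kappa> - (\<rho> + L) * e\<^sub>0) < e\<^sub>0" by (simp add: pos_less_divide_eq)
    moreover have "\<mu>\<^sub>0 * (2 * \<kappa> / \<Gamma>) \<le> \<mu>\<^sub>0 * (2 * \<kappa> - (\<rho> + L) * e\<^sub>0)"
      using mu0(1) e0k kG by (intro mult_left_mono) auto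
    ultimately have "\<mu>\<^sub>0 * (2 * \<kappa> / \<Gamma>) \<le> e\<^sub>0" by linarith
    then show ?thesis using Gamma by (simp add: field_simps)
  qed
  have mu3: "\<mu>\<^sub>0 * Q < q"
  proof -
    have "\<mu>\<^sub>0 < q / Q" using mu0(3) unfolding Q_def by (simp only: min_less_iff_conj)
    then show ?thesis using Qp by (simp add: pos_less_divide_eq)
  qed
  have mu4: "sqrt n * L * \<mu>\<^sub>0 * C \<le> e\<^sub>0"
  proof -
    have "0 < 2 * sqrt n * L" using npos Lpos by simp
    then have "\<mu>\<^sub>0 * (2 * sqrt n * L) < (1 - \<rho>\<^sub>t) * e\<^sub>0" using mu0(3) by (simp add: pos_less_divide_eq)
    then show ?thesis using \<rho>1 by (simp add: C_def field_simps)
  qed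
  \<comment> \<open>The relative decrease of one step: \<open>(1 - \<epsilon>) * e\<^sub>0\<^sup>2 =
    e\<^sub>0\<^sup>2 - \<mu>\<^sub>0 * q + \<mu>\<^sub>0\<^sup>2 * Q\<close>.\<close>
  define \<epsilon> where "\<epsilon> = \<mu>\<^sub>0 * (q - \<mu>\<^sub>0 * Q) / e\<^sub>0\<^sup>2"
  have "0 < \<epsilon>" using mu3 mu0(1) e0(1) by (simp add: \<epsilon>_def)
  then obtain \<delta> where \<delta>: "0 < \<delta>" "\<delta> < 1" "(1 + \<rho>\<^sub>t) / 2 \<le> \<rho>\<^sub>t powr \<delta>"
    "1 - \<epsilon> \<le> (\<rho>\<^sub>t powr \<delta>)\<^sup>2" "\<rho>\<^sub>t powr \<delta> < 1"
    using powr_exponent_near_one[OF \<rho>0 \<rho>1] by blast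
  define g where "g = \<rho>\<^sub>t powr \<delta>"
  have g: "0 < g" "g < 1" "(1 + \<rho>\<^sub>t) / 2 \<le> g" "e\<^sub>0\<^sup>2 - \<mu>\<^sub>0 * q + \<mu>\<^sub>0\<^sup>2 * Q \<le> g\<^sup>2 * e\<^sub>0\<^sup>2"
  proof -
    have "(1 - \<epsilon>) * e\<^sub>0\<^sup>2 \<le> g\<^sup>2 * e\<^sub>0\<^sup>2" using \<delta>(4) by (intro mult_right_mono) (auto simp: g_def)
    moreover have "(1 - \<epsilon>) * e\<^sub>0\<^sup>2 = e\<^sub>0\<^sup>2 - \<mu>\<^sub>0 * q + \<mu>\<^sub>0\<^sup>2 * Q"
      using e0(1) by (simp add: \<epsilon>_def field_simps power2_eq_square)
    ultimately show "e\<^sub>0\<^sup>2 - \<mu>\<^sub>0 * q + \<mu>\<^sub>0\<^sup>2 * Q \<le> g\<^sup>2 * e\<^sub>0\<^sup>2" by simp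
  qed (use \<rho>0 \<delta> in \<open>auto simp: g_def\<close>)
  obtain U where U: "stiefel \<subseteq> U" "\<forall>i. L-lipschitz_on U (f i)" using Lip by blast
  have lip: "f i u - f i v \<le> L * norm (v - u)" if "u \<in> stiefel" "v \<in> stiefel" for i u v
  proof -
    have "dist (f i u) (f i v) \<le> L * dist u v"
      using U that by (meson lipschitz_onD subsetD)
    then show ?thesis by (simp add: dist_norm norm_minus_commute)
  qed

  have main: "(\<Sum>i\<in>UNIV. (norm (x k i - xs))\<^sup>2) \<le> n * (g ^ k)\<^sup>2 * e\<^sub>0\<^sup>2 \<and> (\<forall>i. norm (x k i - xs) \<le> \<Gamma> * (g ^ k * e\<^sub>0))"
    if x0: "x 0 = x\<^sub>0" and xi: "\<forall>k i. \<xi> k i \<in> riem_subdiff \<rho> (f i) (x k i)"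
      and upd: "\<forall>k i. x (Suc k) i = polar_retr (x k i)
            (\<alpha> *\<^sub>R proj_tangent (x k i) (\<Sum>j\<in>UNIV. Wt $ i $ j *\<^sub>R x k j) - (\<mu>\<^sub>0 * g ^ k) *\<^sub>R \<xi> k i)"
    for x \<xi> :: "nat \<Rightarrow> 'n \<Rightarrow> real^'r^'d" and k
  proof -
    define p where "p k = proj_stiefel (mean (x k))" for k
    define err where "err k = L2_set (\<lambda>i. norm (x k i - p k)) UNIV" for k
    \<comment> \<open>The first three parts keep the one-step estimates applicable, the fourth ties
      the consensus error to the stepsize, and the last is the claimed rate. The bound for single
      agents is not carried along; it follows from the rest.\<close>
    define Inv where "Inv k \<longleftrightarrow> (\<forall>i. x k i \<in> stiefel) \<and> err k \<le> sqrt n * \<delta>\<^sub>1 \<and> (\<forall>i. norm (x k i - p k) \<le> \<delta>\<^sub>2)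
      \<and> err k \<le> sqrt n * L * (\<mu>\<^sub>0 * g ^ k) * C \<and> (\<Sum>i\<in>UNIV. (norm (x k i - xs))\<^sup>2) \<le> n * ((g ^ k)\<^sup>2 * e\<^sub>0\<^sup>2)" for k
    have gk: "0 < g ^ k" "g ^ k \<le> 1" for k using g by (auto simp: power_le_one)
    have pM: "p k \<in> stiefel" for k
      unfolding p_def by (rule proj_stiefel_nearest(1)[OF \<open>xs \<in> stiefel\<close>])
    \<comment> \<open>The mean is within \<open>g ^ k * e\<^sub>0\<close> of the minimizer, passing
      to the nearest point at most doubles this, and the consensus error adds one more unit: the
      total 3 is the origin of \<open>\<Gamma> \<ge> 3\<close>.\<close>
    have near: "norm (p k - xs) \<le> 2 * (g ^ k * e\<^sub>0)" "norm (x k i - xs) \<le> \<Gamma> * (g ^ k * e\<^sub>0)" if "Inv k" for k i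
    proof -
      have "n * (norm (mean (x k) - xs))\<^sup>2 \<le> (\<Sum>i\<in>UNIV. (norm (x k i - xs))\<^sup>2)"
        unfolding def0 by (rule norm_mean_diff_le)
      also have "\<dots> \<le> n * (g ^ k * e\<^sub>0)\<^sup>2"
        using that by (simp only: Inv_def power_mult_distrib)
      finally have "(norm (mean (x k) - xs))\<^sup>2 \<le> (g ^ k * e\<^sub>0)\<^sup>2" using npos by simp
      then have m: "norm (mean (x k) - xs) \<le> g ^ k * e\<^sub>0"
        by (rule power2_le_imp_le) (use gk[of k] e0 in simp)
      have "norm (mean (x k) - p k) \<le> norm (mean (x k) - xs)"
        unfolding p_def by (rule proj_stiefel_nearest(2)[OF \<open>xs \<in> stiefel\<close>])
      moreover have "norm (p k - xs) \<le> norm (mean (x k) - p k) + norm (mean (x k) - xs)"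
        using norm_triangle_ineq4[of "mean (x k) - xs" "mean (x k) - p k"] by simp
      ultimately show pk: "norm (p k - xs) \<le> 2 * (g ^ k * e\<^sub>0)" using m by linarith
      have "norm (x k i - p k) \<le> err k"
        unfolding err_def by (rule member_le_L2_set) auto
      also have "\<dots> \<le> (sqrt n * L * \<mu>\<^sub>0 * C) * g ^ k" using that by (simp add: Inv_def mult_ac)
      also have "\<dots> \<le> e\<^sub>0 * g ^ k" using gk[of k] by (intro mult_right_mono mu4) simp
      finally have "norm (x k i - p k) \<le> g ^ k * e\<^sub>0" by (simp add: mult.commute)
      then have "norm (x k i - xs) \<le> 3 * (g ^ k * e\<^sub>0)"
        using pk norm_triangle_ineq[of "x k i - p k" "p k - xs"] by simp
      also have "\<dots> \<le> \<Gamma> * (g ^ k * e\<^sub>0)" using Gamma gk[of k] e0 by (intro mult_right_mono) auto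
      finally show "norm (x k i - xs) \<le> \<Gamma> * (g ^ k * e\<^sub>0)" .
    qed
    have "Inv k" for k
    proof (induction k)
      case 0
      have "(\<Sum>i\<in>UNIV. (norm (x 0 i - p 0))\<^sup>2) = 0"
        using init2 by (simp add: x0 p_def mean_def def0)
      then have z: "norm (x 0 i - p 0) = 0" for i
        by (simp add: sum_nonneg_eq_0_iff)
      then have "err 0 = 0" by (simp add: err_def L2_set_def)
      moreover have "(\<Sum>i\<in>UNIV. (norm (x 0 i - xs))\<^sup>2) \<le> n * e\<^sub>0\<^sup>2"
      proof -
        have "(\<Sum>i\<in>UNIV. (norm (x 0 i - xs))\<^sup>2) = n * D\<^sub>0\<^sup>2" using npos by (simp add: D0_sq x0)
        also have "\<dots> \<le> n * e\<^sub>0\<^sup>2" using npos e0 D0_sq by (intro mult_left_mono power_mono) auto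
        finally show ?thesis .
      qed
      ultimately show ?case
        using z x0M d1 d2 C mu0(1) Lpos npos by (simp add: Inv_def x0)
    next
      case (Suc k)
      define \<beta> where "\<beta> = \<mu>\<^sub>0 * g ^ k"
      have \<beta>: "0 < \<beta>" "\<beta> \<le> \<mu>\<^sub>0" using mu0(1) gk[of k] by (auto simp: \<beta>_def mult_left_le)
      have x: "x k i \<in> stiefel" and err1: "err k \<le> sqrt n * \<delta>\<^sub>1" and err2: "norm (x k i - p k) \<le> \<delta>\<^sub>2"
        and err3: "err k \<le> sqrt n * L * \<beta> * C"
        and D: "(\<Sum>i\<in>UNIV. (norm (x k i - xs))\<^sup>2) \<le> n * ((g ^ k)\<^sup>2 * e\<^sub>0\<^sup>2)" for i
        using Suc by (auto simp: Inv_def \<beta>_def)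
      interpret step: drsm_step Wt "x k" "x (Suc k)" "\<xi> k" \<alpha> \<beta> L M
      proof
        show "\<xi> k i \<in> tangent_space (x k i)" for i
          using xi[rule_format, of k i] proj_tangent_in[OF x[of i]] by (auto simp: riem_subdiff_def)
        show "norm (\<xi> k i) \<le> L" for i using xi Lbound x by blast
        show "x (Suc k) i = polar_retr (x k i) (\<alpha> *\<^sub>R consensus_dir Wt (x k) i - \<beta> *\<^sub>R \<xi> k i)" for i
          using upd by (simp add: consensus_dir_def \<beta>_def)
      qed (use Pst n2 Mretr Mpos alpha(1) \<beta> Lpos x in auto)
      have errk: "L2_set (\<lambda>i. norm (x k i - proj_stiefel (mean (x k)))) UNIV = err k" for k
        by (simp add: err_def p_def)
      have err0: "0 \<le> err k" for k by (simp add: err_def L2_set_nonneg)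
      have sq: "(err k)\<^sup>2 \<le> CARD('n) * \<delta>\<^sub>1\<^sup>2" if "err k \<le> sqrt n * \<delta>\<^sub>1" for k
        using power_mono[OF that err0, of 2] by (simp add: power_mult_distrib def0)
      have bL: "\<beta> * L \<le> \<alpha> * \<delta>\<^sub>1 / 5" using \<beta>(2) mu1(2) Lpos by (smt (verit) mult_right_mono)
      note params = d1 d12 delta2 nu aL[unfolded L\<^sub>t] a1 aM less_imp_le[OF mt[unfolded \<mu>\<^sub>t]] dev
        sq[OF err1, folded errk] err2[unfolded p_def] bL
      have rec: "err (Suc k) \<le> \<rho>\<^sub>t * err k + sqrt n * L * \<beta>"
        using step.err_next[OF params rpos refl] unfolding errk by (simp add: def7 def8 def0 \<mu>\<^sub>t)
      have E1: "err (Suc k) \<le> sqrt n * \<delta>\<^sub>1"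
      proof -
        have "L * \<beta> \<le> (1 - \<rho>\<^sub>t) * \<delta>\<^sub>1"
          using \<beta>(2) mu1(1) Lpos by (smt (verit) mult_left_mono mult.commute)
        then have "sqrt n * (L * \<beta>) \<le> sqrt n * ((1 - \<rho>\<^sub>t) * \<delta>\<^sub>1)"
          using npos by (intro mult_left_mono) auto
        moreover have "\<rho>\<^sub>t * err k \<le> \<rho>\<^sub>t * (sqrt n * \<delta>\<^sub>1)" using \<rho>0 err1 by (intro mult_left_mono) auto
        moreover have "\<rho>\<^sub>t * (sqrt n * \<delta>\<^sub>1) + sqrt n * ((1 - \<rho>\<^sub>t) * \<delta>\<^sub>1) = sqrt n * \<delta>\<^sub>1"
          by (simp add: algebra_simps)
        ultimately show ?thesis using rec by (simp only: mult.assoc)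
      qed
      have E2: "norm (x (Suc k) i - p (Suc k)) \<le> \<delta>\<^sub>2" for i
        using step.agent_deviation_next[OF params sq[OF E1, folded errk]] by (simp add: p_def)
      have E3: "err (Suc k) \<le> sqrt n * L * (\<mu>\<^sub>0 * g ^ Suc k) * C"
      proof -
        have "\<rho>\<^sub>t * err k \<le> \<rho>\<^sub>t * (sqrt n * L * \<beta> * C)" using \<rho>0 err3 by (intro mult_left_mono) auto
        then have "err (Suc k) \<le> sqrt n * L * \<beta> * (\<rho>\<^sub>t * C + 1)"
          using rec by (simp add: algebra_simps)
        also have "\<dots> \<le> sqrt n * L * \<beta> * (g * C)"
        proof (rule mult_left_mono)
          have "(1 + \<rho>\<^sub>t) / 2 * C \<le> g * C" using g C by (intro mult_right_mono) auto
          moreover have "(1 + \<rho>\<^sub>t) / 2 * C = \<rho>\<^sub>t * C + 1" using C(2) by (simp add: field_simps)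
          ultimately show "\<rho>\<^sub>t * C + 1 \<le> g * C" by simp
        qed (use npos Lpos \<beta> in simp)
        finally show ?thesis by (simp add: \<beta>_def mult_ac)
      qed
      have E4: "(\<Sum>i\<in>UNIV. (norm (x (Suc k) i - xs))\<^sup>2) \<le> n * ((g ^ Suc k)\<^sup>2 * e\<^sub>0\<^sup>2)"
      proof -
        let ?D = "\<Sum>i\<in>UNIV. (norm (x k i - xs))\<^sup>2" and ?T = "\<Sum>i\<in>UNIV. norm (x k i - xs)"
        define K where "K = (\<kappa> + L) * (sqrt n * err k)"
        define R where "R = 2 * \<alpha> * L\<^sub>t * (err k)\<^sup>2 + (\<alpha> * (L\<^sub>t * err k) + sqrt n * L * \<beta>)\<^sup>2"
        have desc: "(\<Sum>i\<in>UNIV. (norm (x (Suc k) i - xs))\<^sup>2) \<le> ?D - 2 * \<beta> * (\<Sum>i\<in>UNIV. \<xi> k i \<bullet> (x k i - xs)) + R"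
          using step.descent[OF \<open>xs \<in> stiefel\<close>] unfolding errk by (simp add: R_def L\<^sub>t def0 add.assoc)
        \<comment> \<open>The reference point is within two thirds of \<open>B\<close> of the
          minimizer, so the local sharpness condition applies to it.\<close>
        have "g ^ k * e\<^sub>0 \<le> e\<^sub>0" using gk[of k] e0 by (intro mult_left_le_one_le) auto
        also have "\<dots> \<le> B / 3" using e0(3) Bpos Gamma by (smt (verit) frac_le)
        finally have "norm (p k - xs) < B" using near(1)[OF Suc] Bpos by simp
        then have "\<kappa> * norm (p k - xs) \<le> F (p k) - F xs" using sharp pM by simp
        also have "\<dots> = (1 / n) * (\<Sum>i\<in>UNIV. f i (p k) - f i xs)"
          by (simp add: def9 sum_subtractf diff_divide_distrib)
        finally have sh: "CARD('n) * (\<kappa> * norm (p k - xs)) \<le> (\<Sum>i\<in>UNIV. f i (p k) - f i xs)"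
          using npos by (simp add: def0 field_simps)
        have S: "\<kappa> * ?T - (\<rho> + L) / 2 * ?D - K \<le> (\<Sum>i\<in>UNIV. \<xi> k i \<bullet> (x k i - xs))"
        proof -
          have "\<kappa> * ?T - (\<kappa> + L) * (sqrt CARD('n) * L2_set (\<lambda>i. norm (x k i - p k)) UNIV)
              - (\<rho> + L) / 2 * ?D \<le> (\<Sum>i\<in>UNIV. \<xi> k i \<bullet> (x k i - xs))"
            by (rule sharp_subgradient_bound[where f = f and y = xs and x = "x k" and \<xi> = "\<xi> k"
                  and \<rho> = \<rho> and L = L and p = "p k" and \<kappa> = \<kappa>])
               (use Lineq x xs xi lip[OF pM x] sh kappa Lpos in auto)
          then show ?thesis by (simp add: K_def err_def def0)
        qed
        have T: "?D \<le> ?T * (\<Gamma> * (g ^ k * e\<^sub>0))"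
          unfolding sum_distrib_right power2_eq_square
          by (intro sum_mono mult_left_mono near(2)[OF Suc]) simp
        have "2 * \<beta> * ((\<kappa> + L) * (sqrt n * err k)) + 2 * \<alpha> * L\<^sub>t * (err k)\<^sup>2 + (\<alpha> * (L\<^sub>t * err k) + sqrt n * L * \<beta>)\<^sup>2
            \<le> (sqrt n)\<^sup>2 * \<beta>\<^sup>2 * (C\<^sup>2 * (a + b))"
          by (rule consensus_cost_bound[OF err0 err3 C(1)])
             (use alpha(1) Lpos Ltp Ltb kappa rpos \<beta> npos def11 def12 in auto)
        also have "\<dots> \<le> n * \<beta>\<^sup>2 * Q" using npos by (simp add: mult_left_mono CQ)
        finally have R: "2 * \<beta> * K + R \<le> n * \<beta>\<^sup>2 * Q" by (simp add: K_def R_def)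
        have "(\<Sum>i\<in>UNIV. (norm (x (Suc k) i - xs))\<^sup>2)
            \<le> n * (g ^ k)\<^sup>2 * (e\<^sub>0\<^sup>2 - \<mu>\<^sub>0 * (2 * \<kappa> * e\<^sub>0 / \<Gamma> - (\<rho> + L) * e\<^sub>0\<^sup>2) + \<mu>\<^sub>0\<^sup>2 * Q)"
          by (rule linear_rate_step[OF desc S T D \<beta>_def gk R])
             (use mu0(1) e0 Gamma kappa rL npos mu2 in auto)
        also have "\<dots> \<le> n * (g ^ k)\<^sup>2 * (g\<^sup>2 * e\<^sub>0\<^sup>2)"
          unfolding def13[symmetric] using npos by (intro mult_left_mono g(4)) auto
        finally show ?thesis by (simp add: power_mult_distrib mult_ac)
      qed
      show ?case using E1 E2 E3 E4 step.next_in by (simp add: Inv_def)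
    qed
    then show ?thesis using near(2)[of k] by (auto simp: Inv_def mult.assoc)
  qed

  show ?thesis
  proof (intro exI[of _ \<delta>] conjI \<delta> allI impI)
    fix x \<xi> :: "nat \<Rightarrow> 'n \<Rightarrow> real^'r^'d" and k i
    assume "x 0 = x\<^sub>0" "\<forall>k i. \<xi> k i \<in> riem_subdiff \<rho> (f i) (x k i)"
      "\<forall>k i. x (Suc k) i = polar_retr (x k i)
            (\<alpha> *\<^sub>R proj_tangent (x k i) (\<Sum>j\<in>UNIV. Wt $ i $ j *\<^sub>R x k j) - (\<mu>\<^sub>0 * (\<rho>\<^sub>t powr \<delta>) ^ k) *\<^sub>R \<xi> k i)"
    note m = main[OF this[folded g_def], of k]
    then show "(\<Sum>i\<in>UNIV. (norm (x k i - xs))\<^sup>2) \<le> n * (\<rho>\<^sub>t powr \<delta>) ^ (2 * k) * e\<^sub>0\<^sup>2"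
      by (simp add: g_def power_mult[symmetric] mult.commute[of k])
    have "(norm (x k i - xs))\<^sup>2 \<le> (\<Gamma> * (g ^ k * e\<^sub>0))\<^sup>2" using m by (intro power_mono) auto
    then show "(norm (x k i - xs))\<^sup>2 \<le> \<Gamma>\<^sup>2 * (\<rho>\<^sub>t powr \<delta>) ^ (2 * k) * e\<^sub>0\<^sup>2"
      by (simp add: g_def power_mult_distrib power_mult[symmetric] mult.commute[of k] mult.assoc)
  qed
qed

end
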